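(* Let $r\ge0$, $q=r+1$, $p\ge1$, $d_h,\rho_h>0$ ($1\le h\le r$), $\widehat a_*\in\mathbb R$, $\xi_1,\dots,\xi_p\in\mathbb R$ with $\rho_h+\xi_i>0$ for all $i,h$. For large $\tau$ put $$a_h(\tau)+1=\rho_h\sqrt\tau,\quad b_h(\tau)-a_h(\tau)=d_h\ (1\le h\le r),\quad a_q(\tau)+1=\tau+\widehat a_*\sqrt\tau,\quad b_q(\tau)+1=2\tau,\quad\alpha_i(\tau)=\xi_i\sqrt\tau,$$ and let $V^{\mathrm J}_{j,\tau}$, $C^{\mathrm J}_{i,\tau}$ be the transformed Jacobi rows and columns on $I^{\mathrm J}_\tau=(-\sqrt\tau,\sqrt\tau)$, and $U_j^{\mathrm H}$ the Hermite rows (see context). (1) For $1\le j\le q$, $1\le i\le p$ and every fixed $v\in\mathbb N_0$, $$\int_{I_\tau^{\mathrm J}}t^vV^{\mathrm J}_{j,\tau}(t)C^{\mathrm J}_{i,\tau}(t)\,\mathrm dt=\int_{\mathbb R}t^vU_j^{\mathrm H}(t)\mathrm e^{\xi_it}\,\mathrm dt+\mathrm O(\tau^{-1/2}),\qquad\tau\to+\infty.$$ The corresponding positive matrix measures $[V^{\mathrm J}_{j,\tau}C^{\mathrm J}_{i,\tau}]_{j,i}\,\mathrm dt$ (extended by zero) converge weakly, entry by entry, to $[U_j^{\mathrm H}(t)\mathrm e^{\xi_it}]_{j,i}\,\mathrm dt$. (2) Fix a Laguerre-admissible row index $\boldsymbol\lambda=(n_1,\dots,n_r,\eta)$ (entries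 pairwise differing by at most one). Suppose that the column nodes $\xi_i$ are pairwise distinct and that the rates $\rho_h$ with $n_h>0$ are pairwise distinct. In each of the balances $|\boldsymbol m|=|\boldsymbol\lambda|+1$ and $|\boldsymbol\lambda|=|\boldsymbol m|+1$, respectively, the finite transformed $A$- and $B$-problems (those of the matrix $[V^{\mathrm J}_{j,\tau}C^{\mathrm J}_{i,\tau}]$) are weakly normal for sufficiently large $\tau$. Let $\boldsymbol A^{\mathrm H}$, $\boldsymbol B^{\mathrm H}$ be the nonzero solution vectors (unique up to scalar) of the $A$- and $B$-problems for $[U_j^{\mathrm H}\mathrm e^{\xi_it}]$, with one chosen nonzero coefficient normalized to one, and normalize the same coefficient of the finite solution vectors $\widetilde{\boldsymbol A}_\tau$, $\widetilde{\boldsymbol B}_\tau$ to one. Then $$\widetilde{\boldsymbol A}_\tau\xrightarrow[\tau\to+\infty]{}\boldsymbol A^{\mathrm H},\qquad\widetilde{\boldsymbol B}_\tau\xrightarrow[\tau\to+\infty]{}\boldsymbol B^{\mathrm H}$$ coefficientwise, with error $\mathrm O(\tau^{-1/2})$ in every coefficient as $\tau\to+\infty$.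
   Context: Jacobi weights: $\mathcal B_{a,b}(x)=\frac{x^a(1-x)^{b-a-1}}{\Gamma(b-a)}\mathbf 1_{(0,1)}(x)$; Mellin convolution $(f*g)(x)=\int_0^\infty f(u)g(x/u)\frac{\mathrm du}u$; $w^{\mathrm J}_{j,\tau}=\mathcal B_{a_1(\tau),b_1(\tau)+\delta_{1,j}}*\cdots*\mathcal B_{a_q(\tau),b_q(\tau)+\delta_{q,j}}$, $1\le j\le q$. $Z^{\mathrm J}_{j,\tau}=\int_0^1w^{\mathrm J}_{j,\tau}(x)\,\mathrm dx$. With $\varepsilon=\tau^{-1/2}$ and $x^{\mathrm J}_\tau(t)=\frac12(1+\varepsilon t)$: $V^{\mathrm J}_{j,\tau}(t)=\frac{\varepsilon}{2Z^{\mathrm J}_{j,\tau}}w^{\mathrm J}_{j,\tau}(x^{\mathrm J}_\tau(t))$, $C^{\mathrm J}_{i,\tau}(t)=(1+\varepsilon t)^{\alpha_i(\tau)}$, $t\in I^{\mathrm J}_\tau$. (Solution vectors for the original Jacobi matrix $[w^{\mathrm J}_{j,\tau}(x)x^{\alpha_i(\tau)}]\,\mathrm dx$ transform as $\widetilde A^{(i)}_\tau(t)=2^{-\alpha_i(\tau)}A^{(i),\mathrm J}_\tau(x^{\mathrm J}_\tau(t))$, $\widetilde B^{(j)}_\tau(t)=Z^{\mathrm J}_{j,\tau}B^{(j),\mathrm J}_\tau(x^{\mathrm J}_\tau(t))$.) Hermite rows: $\phi_a(t)=\pi^{-1/2}\mathrm e^{-(t-a)^2}$; $(K_{\rho,d}f)(t)=\int_0^\infty\frac{\rho^d}{\Gamma(d)}u^{d-1}\mathrm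 e^{-\rho u}f(t+u)\,\mathrm du$; $F=K_{\rho_1,d_1}\cdots K_{\rho_r,d_r}\phi_{\widehat a_*}$; $U_h^{\mathrm H}=K_{\rho_h,1}F$ ($1\le h\le r$), $U_q^{\mathrm H}=F$. Put $\lambda_h=n_h$ ($h\le r$), $\lambda_q=\eta$. For a matrix $[U_jV_i]$ of weights: $A$-problem ($|\boldsymbol m|=|\boldsymbol\lambda|+1$): polynomial vectors $(A_i)_{i\le p}$, $\deg A_i\le m_i-1$, with $\int t^kU_j\sum_iA_iV_i\,\mathrm dt=0$, $0\le k<\lambda_j$, $1\le j\le q$. $B$-problem ($|\boldsymbol\lambda|=|\boldsymbol m|+1$): $(B_j)_{j\le q}$, $\deg B_j\le\lambda_j-1$, with $\int t^kV_i\sum_jB_jU_j\,\mathrm dt=0$, $0\le k<m_i$, $1\le i\le p$. Zero index = zero component; weakly normal = one-dimensional solution space. The Hermite problems are weakly normal under the hypotheses of (2). Weak convergence of measures: against bounded continuous functions. *)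

theory Defs
  imports
    "HOL-Analysis.Analysis"
    "HOL-Computational_Algebra.Polynomial"
    "HOL-Library.Function_Algebras"
    "HOL-Library.Landau_Symbols"
begin

text \<open>
  Rows are indexed by \<open>j \<in> {1..r + 1}\<close> (so \<open>q = r + 1\<close>), columns by \<open>i \<in> {1..p}\<close>.  Parameter
  families are functions on \<^typ>\<open>nat\<close>; only their values on these index ranges are used.
\<close>

subsection \<open>Jacobi weights\<close>

definition beta_weight :: "real \<Rightarrow> real \<Rightarrow> real \<Rightarrow> real" where
  "beta_weight a b x =
     (if 0 < x \<and> x < 1 then x powr a * (1 - x) powr (b - a - 1) / Gamma (b - a) else 0)"

definition mellin_conv :: "(real \<Rightarrow> real) \<Rightarrow> (real \<Rightarrow> real) \<Rightarrow> real \<Rightarrow> real" where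
  "mellin_conv f g x = (LBINT u:{0<..}. f u * g (x / u) / u)"

text \<open>The \<open>q\<close>-fold convolution is bracketed to the left; here \<open>q \<ge> 1\<close>.\<close>

definition jacobi_weight ::
    "nat \<Rightarrow> (nat \<Rightarrow> real) \<Rightarrow> (nat \<Rightarrow> real) \<Rightarrow> nat \<Rightarrow> real \<Rightarrow> real" where
  "jacobi_weight q a b j =
     (let \<beta> = (\<lambda>h. beta_weight (a h) (b h + (if h = j then 1 else 0)))
      in foldl mellin_conv (\<beta> 1) (map \<beta> [2..<q + 1]))"

definition param_a :: "nat \<Rightarrow> (nat \<Rightarrow> real) \<Rightarrow> real \<Rightarrow> real \<Rightarrow> nat \<Rightarrow> real" where
  "param_a r \<rho> a_hat \<tau> h = (if h \<le> r then \<rho> h * sqrt \<tau> else \<tau> + a_hat * sqrt \<tau>) - 1"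

definition param_b ::
    "nat \<Rightarrow> (nat \<Rightarrow> real) \<Rightarrow> (nat \<Rightarrow> real) \<Rightarrow> real \<Rightarrow> real \<Rightarrow> nat \<Rightarrow> real" where
  "param_b r \<rho> d a_hat \<tau> h = (if h \<le> r then param_a r \<rho> a_hat \<tau> h + d h else 2 * \<tau> - 1)"

definition w_jacobi ::
    "nat \<Rightarrow> (nat \<Rightarrow> real) \<Rightarrow> (nat \<Rightarrow> real) \<Rightarrow> real \<Rightarrow> real \<Rightarrow> nat \<Rightarrow> real \<Rightarrow> real" where
  "w_jacobi r \<rho> d a_hat \<tau> =
     jacobi_weight (r + 1) (param_a r \<rho> a_hat \<tau>) (param_b r \<rho> d a_hat \<tau>)"

definition Z_jacobi ::
    "nat \<Rightarrow> (nat \<Rightarrow> real) \<Rightarrow> (nat \<Rightarrow> real) \<Rightarrow> real \<Rightarrow> real \<Rightarrow> nat \<Rightarrow> real" where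
  "Z_jacobi r \<rho> d a_hat \<tau> j = (LBINT x:{0<..<1}. w_jacobi r \<rho> d a_hat \<tau> j x)"

definition I_jacobi :: "real \<Rightarrow> real set" where
  "I_jacobi \<tau> = {- sqrt \<tau> <..< sqrt \<tau>}"

definition V_jacobi ::
    "nat \<Rightarrow> (nat \<Rightarrow> real) \<Rightarrow> (nat \<Rightarrow> real) \<Rightarrow> real \<Rightarrow> real \<Rightarrow> nat \<Rightarrow> real \<Rightarrow> real" where
  "V_jacobi r \<rho> d a_hat \<tau> j t =
     (let \<epsilon> = \<tau> powr (- 1 / 2)
      in \<epsilon> / (2 * Z_jacobi r \<rho> d a_hat \<tau> j) * w_jacobi r \<rho> d a_hat \<tau> j ((1 + \<epsilon> * t) / 2))"

definition C_jacobi :: "(nat \<Rightarrow> real) \<Rightarrow> real \<Rightarrow> nat \<Rightarrow> real \<Rightarrow> real" where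
  "C_jacobi \<xi> \<tau> i t = (1 + \<tau> powr (- 1 / 2) * t) powr (\<xi> i * sqrt \<tau>)"

subsection \<open>Hermite rows\<close>

definition gauss :: "real \<Rightarrow> real \<Rightarrow> real" where
  "gauss a t = pi powr (- 1 / 2) * exp (- ((t - a)\<^sup>2))"

definition gamma_op :: "real \<Rightarrow> real \<Rightarrow> (real \<Rightarrow> real) \<Rightarrow> real \<Rightarrow> real" where
  "gamma_op \<rho> d f t =
     (LBINT u:{0<..}. \<rho> powr d / Gamma d * u powr (d - 1) * exp (- \<rho> * u) * f (t + u))"

definition F_hermite ::
    "nat \<Rightarrow> (nat \<Rightarrow> real) \<Rightarrow> (nat \<Rightarrow> real) \<Rightarrow> real \<Rightarrow> real \<Rightarrow> real" where
  "F_hermite r \<rho> d a_hat = foldr (\<lambda>h. gamma_op (\<rho> h) (d h)) [1..<r + 1] (gauss a_hat)"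

definition U_hermite ::
    "nat \<Rightarrow> (nat \<Rightarrow> real) \<Rightarrow> (nat \<Rightarrow> real) \<Rightarrow> real \<Rightarrow> nat \<Rightarrow> real \<Rightarrow> real" where
  "U_hermite r \<rho> d a_hat j =
     (if j \<le> r then gamma_op (\<rho> j) 1 (F_hermite r \<rho> d a_hat) else F_hermite r \<rho> d a_hat)"

definition V_hermite :: "(nat \<Rightarrow> real) \<Rightarrow> nat \<Rightarrow> real \<Rightarrow> real" where
  "V_hermite \<xi> i t = exp (\<xi> i * t)"

subsection \<open>Mixed-type problems for a matrix of weights \<open>U\<^sub>j V\<^sub>i\<close> on a set \<open>S\<close>\<close>

text \<open>
  Vectors of at most \<open>n\<close> polynomials, indexed by \<open>{1..n}\<close> and zero outside, with
  \<open>deg (X i) \<le> m i - 1\<close>.  Since \<^term>\<open>degree 0 = 0\<close>, a zero index forces a zero component.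
\<close>

definition poly_vectors :: "nat \<Rightarrow> (nat \<Rightarrow> nat) \<Rightarrow> (nat \<Rightarrow> real poly) set" where
  "poly_vectors n m =
     {X. (\<forall>i\<in>{1..n}. X i = 0 \<or> degree (X i) < m i) \<and> (\<forall>i. i \<notin> {1..n} \<longrightarrow> X i = 0)}"

definition A_solutions ::
    "real set \<Rightarrow> nat \<Rightarrow> nat \<Rightarrow> (nat \<Rightarrow> real \<Rightarrow> real) \<Rightarrow> (nat \<Rightarrow> real \<Rightarrow> real) \<Rightarrow>
     (nat \<Rightarrow> nat) \<Rightarrow> (nat \<Rightarrow> nat) \<Rightarrow> (nat \<Rightarrow> real poly) set" where
  "A_solutions S q p U V lam m =
     {A \<in> poly_vectors p m.
        \<forall>j\<in>{1..q}. \<forall>k<lam j. (LBINT t:S. t ^ k * U j t * (\<Sum>i=1..p. poly (A i) t * V i t)) = 0}"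

definition B_solutions ::
    "real set \<Rightarrow> nat \<Rightarrow> nat \<Rightarrow> (nat \<Rightarrow> real \<Rightarrow> real) \<Rightarrow> (nat \<Rightarrow> real \<Rightarrow> real) \<Rightarrow>
     (nat \<Rightarrow> nat) \<Rightarrow> (nat \<Rightarrow> nat) \<Rightarrow> (nat \<Rightarrow> real poly) set" where
  "B_solutions S q p U V lam m =
     {B \<in> poly_vectors q lam.
        \<forall>i\<in>{1..p}. \<forall>k<m i. (LBINT t:S. t ^ k * V i t * (\<Sum>j=1..q. poly (B j) t * U j t)) = 0}"

definition scale_vec :: "real \<Rightarrow> (nat \<Rightarrow> real poly) \<Rightarrow> nat \<Rightarrow> real poly" where
  "scale_vec c X = (\<lambda>i. smult c (X i))"

text \<open>Function spaces carry a pointwise additive structure but no \<^class>\<open>real_vector\<close> instance.\<close>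

lemma vector_space_scale_vec: "vector_space scale_vec"
  by unfold_locales (auto simp: scale_vec_def fun_eq_iff plus_fun_def smult_add_right smult_add_left)

definition weakly_normal :: "(nat \<Rightarrow> real poly) set \<Rightarrow> bool" where
  "weakly_normal S \<longleftrightarrow> module.subspace scale_vec S \<and> vector_space.dim scale_vec S = 1"

definition laguerre_admissible :: "nat \<Rightarrow> (nat \<Rightarrow> nat) \<Rightarrow> bool" where
  "laguerre_admissible q lam \<longleftrightarrow> (\<forall>j\<in>{1..q}. \<forall>k\<in>{1..q}. lam j \<le> lam k + 1)"

subsection \<open>Modes of convergence as \<open>\<tau> \<rightarrow> \<infinity>\<close>\<close>

text \<open>Lebesgue density extended by zero outside \<open>S\<close>; meaningful for \<open>f \<ge> 0\<close> on \<open>S\<close>.\<close>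

definition density_on :: "real set \<Rightarrow> (real \<Rightarrow> real) \<Rightarrow> real measure" where
  "density_on S f = density lborel (\<lambda>t. ennreal (indicator S t * f t))"

definition weak_conv_measures :: "(real \<Rightarrow> real measure) \<Rightarrow> real measure \<Rightarrow> bool" where
  "weak_conv_measures M N \<longleftrightarrow>
     (\<forall>\<^sub>F \<tau> in at_top. finite_measure (M \<tau>)) \<and> finite_measure N \<and>
     (\<forall>f :: real \<Rightarrow> real. continuous_on UNIV f \<and> bounded (range f) \<longrightarrow>
        ((\<lambda>\<tau>. integral\<^sup>L (M \<tau>) f) \<longlongrightarrow> integral\<^sup>L N f) at_top)"

definition coefficientwise_conv ::
    "nat \<Rightarrow> (real \<Rightarrow> nat \<Rightarrow> real poly) \<Rightarrow> (nat \<Rightarrow> real poly) \<Rightarrow> bool" where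
  "coefficientwise_conv n X Y \<longleftrightarrow>
     (\<forall>i\<in>{1..n}. \<forall>k.
        ((\<lambda>\<tau>. coeff (X \<tau> i) k) \<longlongrightarrow> coeff (Y i) k) at_top \<and>
        (\<lambda>\<tau>. coeff (X \<tau> i) k - coeff (Y i) k) \<in> O[at_top](\<lambda>\<tau>. \<tau> powr (- 1 / 2)))"

text \<open>
  Whenever the coefficient of \<open>z ^ k\<close> in component \<open>i\<close> of a limit solution is \<open>1\<close>, for large \<open>\<tau>\<close> the
  solutions in \<open>S \<tau>\<close> can be normalized, uniquely, to have the same coefficient \<open>1\<close>, and any such
  choice converges.
\<close>

definition normalized_solutions_conv ::
    "nat \<Rightarrow> (real \<Rightarrow> (nat \<Rightarrow> real poly) set) \<Rightarrow> (nat \<Rightarrow> real poly) set \<Rightarrow> bool" where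
  "normalized_solutions_conv n S S_lim \<longleftrightarrow>
     (\<forall>Y\<in>S_lim. \<forall>i\<in>{1..n}. \<forall>k. coeff (Y i) k = 1 \<longrightarrow>
        (\<forall>\<^sub>F \<tau> in at_top. \<exists>!X. X \<in> S \<tau> \<and> coeff (X i) k = 1) \<and>
        (\<forall>X. (\<forall>\<^sub>F \<tau> in at_top. X \<tau> \<in> S \<tau> \<and> coeff (X \<tau> i) k = 1) \<longrightarrow>
           coefficientwise_conv n X Y))"

end

theory Submission
  imports Defs "HOL-Probability.Probability" "HOL-Real_Asymp.Real_Asymp"
begin

text \<open>
  Write \<open>e = \<tau> powr (-1/2)\<close> and \<open>J v y\<close> for the integral of \<open>t ^ v * V_j(t) * (1 + e * t) powr (y / e)\<close>.  Since
  \<open>J v (y + e) = J v y + e * J (v + 1) y\<close>, all moments are difference quotients of \<open>J 0\<close>, which is a ratio of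
  Gamma functions because the Mellin transform is multiplicative; \<open>J 0 (y + e) / J 0 y\<close> is \<open>1 + e * P(e, y)\<close> with \<open>P\<close>
  rational and regular at \<open>e = 0\<close>.  Hence \<open>J v y = f_v(e, y) * J 0 y\<close> with rational \<open>f_v\<close>, and \<open>f_v(0, y)\<close> satisfies
  the recursion of the logarithmic derivatives of the Laplace transform of the Hermite row.  Only \<open>J 0\<close> needs
  an asymptotic estimate, which follows from bounds on the digamma function.

  Weak convergence is the method of moments: the limit has exponential moments, so moment convergence
  gives convergence of characteristic functions.

  Normality of the Hermite problems is a zero count.  A combination of the functions \<open>\<integral> t ^ k * U_j(t) * exp (z * t) dt\<close>
  is a nonvanishing function times \<open>S(z) / Q(z) ^ M\<close>, where \<open>Q\<close> is the product of the \<open>z + \<rho>_h\<close> with \<open>n_h > 0\<close>,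
  \<open>M\<close> is the largest row index and \<open>S\<close> is a polynomial.  The orthogonality conditions, together with the zeros of
  \<open>S\<close> at \<open>- \<rho>_h\<close> for \<open>n_h = M - 1\<close>, are more zeros than its degree allows.  Solution vectors then depend
  continuously on the moment matrix, with a linear error bound.
\<close>

subsection \<open>Linear systems\<close>

text \<open>A \<open>v\<close>-th difference quotient divides by a power of \<open>e\<close>, so
  estimating \<open>J 0\<close> with error \<open>O(e)\<close> and then differencing would lose the
  rate. The recursion is therefore carried out exactly at finite \<tau>, on rational functions, and
  the limit is taken only once. Admissibility leaves only \<open>M\<close> and \<open>M - 1\<close>
  as row indices, so clearing denominators by one power \<open>Q ^ M\<close> yields one extra zero
  of \<open>S\<close> for every deficient row with a rate in \<open>Q\<close>. Passing to a square
  system lowers one index and must preserve this shape: with a surplus row coefficient a largest row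
  index is lowered, otherwise a column index, on which nothing is imposed. At finite \<tau> no zero
  count is made: weak normality there comes from the perturbation bound. The inequalities
  \<open>\<rho> h + \<xi> i > 0\<close> are open conditions, and the room they leave pays for powers
  of \<open>t\<close>, for differentiation under the integral, and for the exponential
  moments.\<close>

lemma underdetermined_system:
  fixes M :: "'r \<Rightarrow> 'c \<Rightarrow> real"
  assumes "finite R" "finite C" "card R < card C"
  shows "\<exists>X. (\<exists>c\<in>C. X c \<noteq> 0) \<and> (\<forall>r\<in>R. (\<Sum>c\<in>C. M r c * X c) = 0)"
  using assms
proof (induction R arbitrary: C M rule: finite_induct)
  case empty
  then have "C \<noteq> {}" by auto
  then show ?case by (intro exI[of _ "\<lambda>_. 1"]) auto
next
  case (insert r R)
  show ?case
  proof (cases "\<forall>c\<in>C. M r c = 0")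
    case True
    obtain X where "\<exists>c\<in>C. X c \<noteq> 0" "\<forall>r\<in>R. (\<Sum>c\<in>C. M r c * X c) = 0"
      using insert.IH[of C M] insert.prems insert.hyps by auto
    then show ?thesis using True by (intro exI[of _ X]) auto
  next
    case False
    then obtain c0 where c0: "c0 \<in> C" "M r c0 \<noteq> 0" by auto
    define C' where "C' = C - {c0}"
    have fC': "finite C'" "c0 \<notin> C'" "C = insert c0 C'" using insert.prems c0 by (auto simp: C'_def)
    have "card R < card C'" using insert.prems insert.hyps c0 by (simp add: C'_def)
    from insert.IH[OF fC'(1) this, of "\<lambda>s c. M s c - M s c0 * M r c / M r c0"]
    obtain X where X: "\<exists>c\<in>C'. X c \<noteq> 0"
      "\<And>s. s \<in> R \<Longrightarrow> (\<Sum>c\<in>C'. (M s c - M s c0 * M r c / M r c0) * X c) = 0" by auto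
    \<comment> \<open>The pivot unknown is solved from equation \<open>r\<close>; the matrix passed
      to the induction hypothesis is the one obtained by this elimination.\<close>
    define Y where "Y = X(c0 := - (\<Sum>c\<in>C'. M r c * X c) / M r c0)"
    have YX: "(\<Sum>c\<in>C'. M s c * Y c) = (\<Sum>c\<in>C'. M s c * X c)" for s
      using fC' by (intro sum.cong) (auto simp: Y_def)
    have S: "(\<Sum>c\<in>C. M s c * Y c) = (\<Sum>c\<in>C'. M s c * X c) - M s c0 * (\<Sum>c\<in>C'. M r c * X c) / M r c0" for s
      unfolding fC'(3) using fC' by (simp add: YX) (simp add: Y_def)
    have "(\<Sum>c\<in>C. M s c * Y c) = 0" if "s \<in> R" for s
      using X(2)[OF that] unfolding S
      by (simp add: algebra_simps sum_subtractf sum_distrib_left sum_divide_distrib)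
    moreover have "(\<Sum>c\<in>C. M r c * Y c) = 0" using c0 unfolding S by simp
    moreover have "\<exists>c\<in>C. Y c \<noteq> 0" using X(1) fC' by (auto simp: Y_def)
    ultimately show ?thesis by (intro exI[of _ Y]) auto
  qed
qed

text \<open>Columns are added one at a time. If the residual \<open>w\<close> of the new column
  against the old ones vanished on \<open>R\<close>, it would give a kernel vector with entry 1 at
  \<open>c\<close>; so some \<open>w r0\<close> is nonzero. The functional \<open>n\<close> built
  from that entry kills the old columns and is 1 on the new one, and subtracting multiples of it
  corrects the old left inverse.\<close>

lemma left_inverse_of_trivial_kernel:
  fixes M :: "'r \<Rightarrow> 'c \<Rightarrow> real"
  assumes "finite C" "finite R"
    and "\<And>X. (\<And>r. r \<in> R \<Longrightarrow> (\<Sum>c\<in>C. M r c * X c) = 0) \<Longrightarrow> \<forall>c\<in>C. X c = 0"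
  shows "\<exists>N. \<forall>c\<in>C. \<forall>c'\<in>C. (\<Sum>r\<in>R. N c r * M r c') = (if c = c' then 1 else 0)"
  using assms(1,3)
proof (induction C rule: finite_induct)
  case (insert c C)
  have "\<forall>c\<in>C. X c = 0" if X: "\<And>r. r \<in> R \<Longrightarrow> (\<Sum>c\<in>C. M r c * X c) = 0" for X
  proof -
    have "(\<Sum>a\<in>insert c C. M r a * (X(c := 0)) a) = (\<Sum>c\<in>C. M r c * X c)" for r
      using insert.hyps by (simp, intro sum.cong) auto
    then have "\<forall>a\<in>insert c C. (X(c := 0)) a = 0" using X insert.prems[of "X(c := 0)"] by metis
    then show ?thesis using insert.hyps by (auto split: if_splits)
  qed
  from insert.IH[OF this] obtain N where
    N: "\<And>a b. a \<in> C \<Longrightarrow> b \<in> C \<Longrightarrow> (\<Sum>r\<in>R. N a r * M r b) = (if a = b then 1 else 0)" by blast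
  define x where "x a = (\<Sum>r\<in>R. N a r * M r c)" for a
  define w where "w r = M r c - (\<Sum>a\<in>C. M r a * x a)" for r
  have "\<exists>r0\<in>R. w r0 \<noteq> 0"
  proof (rule ccontr)
    assume "\<not> ?thesis"
    then have w: "\<And>r. r \<in> R \<Longrightarrow> w r = 0" by auto
    have "(\<Sum>a\<in>insert c C. M r a * ((\<lambda>a. - x a)(c := 1)) a) = w r" for r
    proof -
      have "(\<Sum>a\<in>C. M r a * ((\<lambda>a. - x a)(c := 1)) a) = (\<Sum>a\<in>C. - (M r a * x a))"
        using insert.hyps by (intro sum.cong) auto
      then show ?thesis using insert.hyps by (simp add: w_def sum_negf)
    qed
    then have "\<forall>a\<in>insert c C. ((\<lambda>a. - x a)(c := 1)) a = 0"
      using insert.prems[of "(\<lambda>a. - x a)(c := 1)"] w by metis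
    then show False by simp
  qed
  then obtain r0 where r0: "r0 \<in> R" "w r0 \<noteq> 0" by auto
  define n where "n r = ((if r = r0 then 1 else 0) - (\<Sum>a\<in>C. M r0 a * N a r)) / w r0" for r
  have nM: "(\<Sum>r\<in>R. n r * M r b) = (M r0 b - (\<Sum>a\<in>C. M r0 a * (\<Sum>r\<in>R. N a r * M r b))) / w r0" for b
  proof -
    have "(\<Sum>r\<in>R. n r * M r b) = ((\<Sum>r\<in>R. (if r = r0 then 1 else 0) * M r b)
        - (\<Sum>r\<in>R. \<Sum>a\<in>C. M r0 a * N a r * M r b)) / w r0"
      by (simp add: n_def sum_divide_distrib sum_subtractf[symmetric] sum_distrib_right left_diff_distrib
          del: mult_if_delta)
    also have "(\<Sum>r\<in>R. (if r = r0 then 1 else 0) * M r b) = (\<Sum>r\<in>R. if r = r0 then M r b else 0)"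
      by (intro sum.cong) auto
    also have "\<dots> = M r0 b" using r0 assms(2) by simp
    also have "(\<Sum>r\<in>R. \<Sum>a\<in>C. M r0 a * N a r * M r b) = (\<Sum>a\<in>C. M r0 a * (\<Sum>r\<in>R. N a r * M r b))"
      by (subst sum.swap) (simp add: sum_distrib_left mult.assoc)
    finally show ?thesis .
  qed
  have nc: "(\<Sum>r\<in>R. n r * M r c) = 1" using r0 unfolding nM by (simp add: w_def x_def)
  have nb: "(\<Sum>r\<in>R. n r * M r b) = 0" if "b \<in> C" for b
  proof -
    have "(\<Sum>a\<in>C. M r0 a * (\<Sum>r\<in>R. N a r * M r b)) = (\<Sum>a\<in>C. if a = b then M r0 a else 0)"
      using that by (intro sum.cong) (auto simp: N)
    then show ?thesis using that insert.hyps unfolding nM by simp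
  qed
  define N' where "N' a r = (if a = c then n r else N a r - x a * n r)" for a r
  have N'1: "(\<Sum>r\<in>R. N' c r * M r b) = (\<Sum>r\<in>R. n r * M r b)" for b by (simp add: N'_def)
  have N'2: "(\<Sum>r\<in>R. N' a r * M r b) = (\<Sum>r\<in>R. N a r * M r b) - x a * (\<Sum>r\<in>R. n r * M r b)"
    if "a \<in> C" for a b
  proof -
    have "a \<noteq> c" using that insert.hyps by auto
    then show ?thesis
      by (simp add: N'_def left_diff_distrib sum_subtractf sum_distrib_left mult.assoc)
  qed
  show ?case
  proof (intro exI[of _ N'] ballI)
    fix a b assume ab: "a \<in> insert c C" "b \<in> insert c C"
    show "(\<Sum>r\<in>R. N' a r * M r b) = (if a = b then 1 else 0)"
    proof (cases "a = c")
      case True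
      then show ?thesis using ab nc nb insert.hyps by (auto simp: N'1)
    next
      case False
      then have "a \<in> C" using ab by auto
      then show ?thesis using ab False nc nb insert.hyps
        by (cases "b = c") (auto simp: N'2 N x_def)
    qed
  qed
qed auto

text \<open>A kernel vector \<open>y\<close> of the transpose with \<open>y r0 \<noteq> 0\<close>
  makes row \<open>r0\<close> redundant. Without that row there are fewer equations than unknowns,
  so some nonzero \<open>X\<close> solves them; pairing with \<open>y\<close> shows that it
  satisfies row \<open>r0\<close> too, against injectivity. Squareness enters as a count, without
  determinants.\<close>

lemma transpose_trivial_kernel:
  fixes M :: "'r \<Rightarrow> 'c \<Rightarrow> real"
  assumes "finite C" "finite R" "card R = card C"
    and inj: "\<And>X. (\<And>r. r \<in> R \<Longrightarrow> (\<Sum>c\<in>C. M r c * X c) = 0) \<Longrightarrow> \<forall>c\<in>C. X c = 0"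
    and y: "\<And>c. c \<in> C \<Longrightarrow> (\<Sum>r\<in>R. M r c * y r) = 0"
  shows "\<forall>r\<in>R. y r = 0"
proof (rule ccontr)
  assume "\<not> ?thesis"
  then obtain r0 where r0: "r0 \<in> R" "y r0 \<noteq> 0" by auto
  have "card (R - {r0}) < card C" using r0 assms(2,3) by (metis card_Diff1_less)
  from underdetermined_system[OF _ assms(1) this, of M] assms(2)
  obtain X where X: "\<exists>c\<in>C. X c \<noteq> 0" "\<forall>r\<in>R - {r0}. (\<Sum>c\<in>C. M r c * X c) = 0" by auto
  have "(\<Sum>r\<in>R. y r * (\<Sum>c\<in>C. M r c * X c)) = (\<Sum>c\<in>C. X c * (\<Sum>r\<in>R. M r c * y r))"
    by (simp add: sum_distrib_left) (subst sum.swap, simp add: mult_ac)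
  also have "\<dots> = 0" using y by simp
  finally have "0 = y r0 * (\<Sum>c\<in>C. M r0 c * X c) + (\<Sum>r\<in>R - {r0}. y r * (\<Sum>c\<in>C. M r c * X c))"
    using r0 assms(2) by (simp add: sum.remove)
  then have "(\<Sum>c\<in>C. M r0 c * X c) = 0" using X r0 by simp
  with X(2) have "\<forall>c\<in>C. X c = 0" by (intro inj) auto
  with X(1) show False by auto
qed

text \<open>The normalized kernel vector solves a system with a left inverse, so a perturbation of the
  matrix of size \<open>\<epsilon>\<close> moves it by \<open>O(\<epsilon>)\<close>.\<close>

lemma kernel_perturbation:
  fixes M :: "'t \<Rightarrow> 'r \<Rightarrow> 'c \<Rightarrow> real" and M0 :: "'r \<Rightarrow> 'c \<Rightarrow> real"
  assumes fin: "finite C" "finite R" and c0: "c0 \<in> C"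
    and Y: "\<And>r. r \<in> R \<Longrightarrow> (\<Sum>c\<in>C. M0 r c * Y c) = 0" "Y c0 = 1"
    and inj: "\<And>X. (\<And>r. r \<in> R \<Longrightarrow> (\<Sum>c\<in>C. M0 r c * X c) = 0) \<Longrightarrow> X c0 = 0 \<Longrightarrow> \<forall>c\<in>C. X c = 0"
    and \<epsilon>: "(\<epsilon> \<longlongrightarrow> 0) F" "eventually (\<lambda>\<tau>. \<epsilon> \<tau> > 0) F"
    and M: "\<And>r c. r \<in> R \<Longrightarrow> c \<in> C \<Longrightarrow> (\<lambda>\<tau>. M \<tau> r c - M0 r c) \<in> O[F](\<epsilon>)"
  shows "\<exists>K. \<forall>\<^sub>F \<tau> in F. \<forall>X. (\<forall>r\<in>R. (\<Sum>c\<in>C. M \<tau> r c * X c) = 0) \<longrightarrow>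
           (\<forall>c\<in>C. \<bar>X c - X c0 * Y c\<bar> \<le> K * \<bar>X c0\<bar> * \<epsilon> \<tau>)"
proof -
  let ?R = "insert None (Some ` R)"
  \<comment> \<open>The additional row \<open>None\<close> reads off the coordinate
    \<open>c0\<close>. It turns injectivity on the hyperplane \<open>X c0 = 0\<close> into
    injectivity of a linear system.\<close>
  define A where "A r c = (case r of None \<Rightarrow> if c = c0 then 1 else 0 | Some r \<Rightarrow> M0 r c)" for r c
  have sumR: "(\<Sum>r\<in>?R. f r) = f None + (\<Sum>r\<in>R. f (Some r))" for f :: "_ \<Rightarrow> real"
    using fin by (simp add: sum.reindex)
  have "\<forall>c\<in>C. X c = 0" if "\<And>r. r \<in> ?R \<Longrightarrow> (\<Sum>c\<in>C. A r c * X c) = 0" for X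
  proof (rule inj)
    have "(\<Sum>c\<in>C. (if c = c0 then 1 else 0) * X c) = (\<Sum>c\<in>C. if c = c0 then X c else 0)"
      by (intro sum.cong) auto
    then show "X c0 = 0" using that[of None] c0 fin by (simp add: A_def)
    show "(\<Sum>c\<in>C. M0 r c * X c) = 0" if "r \<in> R" for r
      using \<open>\<And>r. r \<in> ?R \<Longrightarrow> _\<close>[of "Some r"] that by (simp add: A_def)
  qed
  then have "\<exists>N. \<forall>a\<in>C. \<forall>b\<in>C. (\<Sum>r\<in>?R. N a r * A r b) = (if a = b then 1 else 0)"
    using fin by (intro left_inverse_of_trivial_kernel) auto
  then obtain N where "\<forall>a\<in>C. \<forall>b\<in>C. (\<Sum>r\<in>?R. N a r * A r b) = (if a = b then 1 else 0)" ..
  then have N: "\<And>a b. a \<in> C \<Longrightarrow> b \<in> C \<Longrightarrow> (\<Sum>r\<in>?R. N a r * A r b) = (if a = b then 1 else 0)" by simp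
  \<comment> \<open>For vectors with \<open>D c0 = 0\<close> the row \<open>None\<close> contributes
    nothing, so \<open>D\<close> is recovered from its residuals under \<open>M0\<close>
    alone.\<close>
  have rep: "D a = (\<Sum>r\<in>R. N a (Some r) * (\<Sum>c\<in>C. M0 r c * D c))" if "a \<in> C" "D c0 = 0" for D a
  proof -
    have "(\<Sum>c\<in>C. (\<Sum>r\<in>?R. N a r * A r c) * D c) = (\<Sum>c\<in>C. if c = a then D c else 0)"
      using that by (intro sum.cong) (auto simp: N)
    then have "D a = (\<Sum>c\<in>C. (\<Sum>r\<in>?R. N a r * A r c) * D c)" using that fin by simp
    also have "\<dots> = (\<Sum>c\<in>C. N a None * A None c * D c) + (\<Sum>r\<in>R. N a (Some r) * (\<Sum>c\<in>C. M0 r c * D c))"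
      unfolding sumR by (simp add: A_def distrib_right sum.distrib sum_distrib_right sum_distrib_left mult.assoc)
        (subst sum.swap, simp)
    also have "(\<Sum>c\<in>C. N a None * A None c * D c) = 0"
      using that by (intro sum.neutral) (auto simp: A_def)
    finally show ?thesis by simp
  qed
  define S where "S \<tau> = (\<Sum>r\<in>R. \<Sum>c\<in>C. \<bar>M \<tau> r c - M0 r c\<bar>)" for \<tau>
  have "S \<in> O[F](\<epsilon>)" unfolding S_def using M by (intro big_sum_in_bigo) auto
  then obtain k where k: "k > 0" "eventually (\<lambda>\<tau>. norm (S \<tau>) \<le> k * norm (\<epsilon> \<tau>)) F"
    by (elim landau_o.bigE) auto
  define L where "L = (\<Sum>a\<in>C. \<Sum>r\<in>R. \<bar>N a (Some r)\<bar>)"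
  define y where "y = (\<Sum>c\<in>C. \<bar>Y c\<bar>)"
  have L0: "L \<ge> 0" "y \<ge> 0" unfolding L_def y_def by (auto intro!: sum_nonneg)
  have "((\<lambda>\<tau>. L * k * \<epsilon> \<tau>) \<longlongrightarrow> L * k * 0) F" by (intro tendsto_intros \<epsilon>)
  then have "eventually (\<lambda>\<tau>. L * k * \<epsilon> \<tau> < 1/2) F" by (rule order_tendstoD) simp
  then have "\<forall>\<^sub>F \<tau> in F. \<forall>X. (\<forall>r\<in>R. (\<Sum>c\<in>C. M \<tau> r c * X c) = 0) \<longrightarrow>
           (\<forall>c\<in>C. \<bar>X c - X c0 * Y c\<bar> \<le> (2 * L * k * y) * \<bar>X c0\<bar> * \<epsilon> \<tau>)"
    using k(2) \<epsilon>(2)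
  proof (eventually_elim, intro allI impI ballI)
    fix \<tau> X c
    assume small: "L * k * \<epsilon> \<tau> < 1/2" and kS: "norm (S \<tau>) \<le> k * norm (\<epsilon> \<tau>)" and e0: "\<epsilon> \<tau> > 0"
      and X: "\<forall>r\<in>R. (\<Sum>c\<in>C. M \<tau> r c * X c) = 0" and c: "c \<in> C"
    define D where "D c = X c - X c0 * Y c" for c
    define n where "n = (\<Sum>c\<in>C. \<bar>X c\<bar>)"
    have n0: "n \<ge> 0" unfolding n_def by (auto intro!: sum_nonneg)
    have D0: "D c0 = 0" using Y by (simp add: D_def)
    have M0D: "\<bar>\<Sum>c\<in>C. M0 r c * D c\<bar> \<le> S \<tau> * n" if "r \<in> R" for r
    proof -
      have "(\<Sum>c\<in>C. M0 r c * D c) = (\<Sum>c\<in>C. M0 r c * X c) - X c0 * (\<Sum>c\<in>C. M0 r c * Y c)"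
        by (simp add: D_def sum_subtractf sum_distrib_left algebra_simps)
      also have "\<dots> = (\<Sum>c\<in>C. M0 r c * X c) - (\<Sum>c\<in>C. M \<tau> r c * X c)" using Y X that by simp
      also have "\<bar>\<dots>\<bar> \<le> (\<Sum>c\<in>C. \<bar>M \<tau> r c - M0 r c\<bar> * \<bar>X c\<bar>)"
        unfolding sum_subtractf[symmetric]
        by (rule order.trans[OF sum_abs]) (auto intro!: sum_mono simp: abs_mult[symmetric] algebra_simps abs_minus_commute)
      also have "\<dots> \<le> (\<Sum>c\<in>C. S \<tau> * \<bar>X c\<bar>)"
      proof (intro sum_mono mult_right_mono)
        fix c assume "c \<in> C"
        then have "\<bar>M \<tau> r c - M0 r c\<bar> \<le> (\<Sum>c\<in>C. \<bar>M \<tau> r c - M0 r c\<bar>)" using fin by (intro member_le_sum) auto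
        also have "\<dots> \<le> S \<tau>" unfolding S_def using that fin
          by (intro member_le_sum[where f = "\<lambda>r. \<Sum>c\<in>C. \<bar>M \<tau> r c - M0 r c\<bar>"]) (auto intro!: sum_nonneg)
        finally show "\<bar>M \<tau> r c - M0 r c\<bar> \<le> S \<tau>" .
      qed auto
      finally show ?thesis by (simp add: n_def sum_distrib_left)
    qed
    have "(\<Sum>a\<in>C. \<bar>D a\<bar>) \<le> (\<Sum>a\<in>C. \<Sum>r\<in>R. \<bar>N a (Some r)\<bar> * (S \<tau> * n))"
    proof (rule sum_mono)
      fix a assume "a \<in> C"
      show "\<bar>D a\<bar> \<le> (\<Sum>r\<in>R. \<bar>N a (Some r)\<bar> * (S \<tau> * n))"
        unfolding rep[of a D, OF \<open>a \<in> C\<close> D0]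
        by (rule order.trans[OF sum_abs]) (auto intro!: sum_mono mult_left_mono M0D simp: abs_mult)
    qed
    also have "\<dots> = L * S \<tau> * n" by (simp add: L_def sum_distrib_right mult.assoc)
    also have "\<dots> \<le> L * (k * \<epsilon> \<tau>) * n" using kS e0 L0 n0 by (intro mult_right_mono mult_left_mono) auto
    finally have 1: "(\<Sum>a\<in>C. \<bar>D a\<bar>) \<le> L * k * \<epsilon> \<tau> * n" by (simp add: mult.assoc)
    have "n \<le> (\<Sum>a\<in>C. \<bar>D a\<bar> + \<bar>X c0\<bar> * \<bar>Y a\<bar>)"
      unfolding n_def by (intro sum_mono) (auto simp: D_def abs_mult[symmetric])
    then have 2: "n \<le> (\<Sum>a\<in>C. \<bar>D a\<bar>) + \<bar>X c0\<bar> * y" by (simp add: sum.distrib y_def sum_distrib_left)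
    \<comment> \<open>Absorption: the deviation is at most \<open>L * k * \<epsilon> \<tau>\<close>
      times the total size \<open>n\<close>, and \<open>n\<close> is at most the deviation plus the
      \<open>Y\<close> part. Once the factor is below 1/2, the \<open>n\<close> on the right can be
      moved to the left; this is the source of the 2 in the final constant.\<close>
    have "L * k * \<epsilon> \<tau> * n \<le> n / 2" using mult_right_mono[of "L * k * \<epsilon> \<tau>" "1/2" n] small n0 by simp
    then have "n \<le> 2 * (\<bar>X c0\<bar> * y)" using 1 2 by linarith
    then have "L * k * \<epsilon> \<tau> * n \<le> L * k * \<epsilon> \<tau> * (2 * (\<bar>X c0\<bar> * y))"
      using L0 k e0 by (intro mult_left_mono) auto
    moreover have "\<bar>D c\<bar> \<le> (\<Sum>a\<in>C. \<bar>D a\<bar>)" using c fin by (intro member_le_sum) auto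
    ultimately show "\<bar>X c - X c0 * Y c\<bar> \<le> (2 * L * k * y) * \<bar>X c0\<bar> * \<epsilon> \<tau>"
      using 1 unfolding D_def by (simp add: mult_ac)
  qed
  then show ?thesis by blast
qed

lemma bigo_tendsto_0:
  fixes f g :: "'a \<Rightarrow> real"
  assumes "f \<in> O[F](g)" "(g \<longlongrightarrow> 0) F"
  shows "(f \<longlongrightarrow> 0) F"
proof -
  obtain c where "\<forall>\<^sub>F x in F. norm (f x) \<le> c * norm (g x)" using assms(1) by (elim landau_o.bigE)
  moreover have "((\<lambda>x. c * norm (g x)) \<longlongrightarrow> 0) F"
    using tendsto_mult_right_zero[OF tendsto_norm_zero[OF assms(2)]] .
  ultimately show ?thesis by (rule Lim_null_comparison)
qed

section \<open>Solution spaces as kernels of moment matrices\<close>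

definition coeff_index :: "nat \<Rightarrow> (nat \<Rightarrow> nat) \<Rightarrow> (nat \<times> nat) set" where
  "coeff_index n m = (SIGMA i:{1..n}. {..<m i})"

definition coeff_at :: "(nat \<Rightarrow> real poly) \<Rightarrow> nat \<times> nat \<Rightarrow> real" where
  "coeff_at X c = coeff (X (fst c)) (snd c)"

text \<open>The common form of both problems: equations are indexed by an arbitrary set
  \<open>R\<close>, so the convergence argument is done once and applied to the moment matrix and to
  its transpose.\<close>

definition kernel_vectors ::
    "nat \<Rightarrow> (nat \<Rightarrow> nat) \<Rightarrow> 'r set \<Rightarrow> ('r \<Rightarrow> nat \<times> nat \<Rightarrow> real) \<Rightarrow> (nat \<Rightarrow> real poly) set" where
  "kernel_vectors n m R M =
     {X \<in> poly_vectors n m. \<forall>r\<in>R. (\<Sum>c\<in>coeff_index n m. M r c * coeff_at X c) = 0}"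

lemma finite_coeff_index [simp]: "finite (coeff_index n m)"
  by (simp add: coeff_index_def)

lemma card_coeff_index: "card (coeff_index n m) = sum m {1..n}"
  by (simp add: coeff_index_def)

lemma coeff_at_outside:
  assumes "X \<in> poly_vectors n m" "c \<notin> coeff_index n m"
  shows "coeff_at X c = 0"
proof (cases c)
  case (Pair i l)
  show ?thesis
  proof (cases "i \<in> {1..n} \<and> X i \<noteq> 0")
    case True
    then have "degree (X i) < m i" using assms(1) by (auto simp: poly_vectors_def)
    then have "degree (X i) < l" using assms(2) True Pair by (auto simp: coeff_index_def)
    then show ?thesis using Pair by (simp add: coeff_at_def coeff_eq_0)
  next
    case False
    then show ?thesis using assms(1) Pair by (auto simp: poly_vectors_def coeff_at_def)
  qed
qed

lemma poly_vectors_zero_iff: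
  assumes "X \<in> poly_vectors n m"
  shows "X = 0 \<longleftrightarrow> (\<forall>c\<in>coeff_index n m. coeff_at X c = 0)"
proof
  assume "\<forall>c\<in>coeff_index n m. coeff_at X c = 0"
  then have "coeff_at X c = 0" for c using coeff_at_outside[OF assms] by (cases "c \<in> coeff_index n m") auto
  then have "coeff (X i) l = 0" for i l by (metis coeff_at_def fst_conv snd_conv)
  then show "X = 0" by (auto simp: fun_eq_iff poly_eq_iff)
qed (auto simp: coeff_at_def)

lemma poly_vectors_add_scale:
  assumes "X \<in> poly_vectors n m" "Y \<in> poly_vectors n m"
  shows "X + Y \<in> poly_vectors n m" "scale_vec a X \<in> poly_vectors n m"
proof -
  have "X i + Y i = 0 \<or> degree (X i + Y i) < m i" if "i \<in> {1..n}" for i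
  proof -
    have "X i = 0 \<or> degree (X i) < m i" "Y i = 0 \<or> degree (Y i) < m i"
      using assms that by (auto simp: poly_vectors_def)
    then show ?thesis by (cases "X i = 0"; cases "Y i = 0") (auto intro: degree_add_less)
  qed
  then show "X + Y \<in> poly_vectors n m" using assms by (auto simp: poly_vectors_def)
  show "scale_vec a X \<in> poly_vectors n m" using assms by (auto simp: poly_vectors_def scale_vec_def)
qed

lemma coeff_at_add: "coeff_at (X + Y) c = coeff_at X c + coeff_at Y c"
  and coeff_at_diff: "coeff_at (X - Y) c = coeff_at X c - coeff_at Y c"
  and coeff_at_scale: "coeff_at (scale_vec a X) c = a * coeff_at X c"
  by (auto simp: coeff_at_def scale_vec_def)

lemma exists_poly_vector:
  "\<exists>X\<in>poly_vectors n m. \<forall>c\<in>coeff_index n m. coeff_at X c = x c"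
proof -
  define X where "X i = (if i \<in> {1..n} then \<Sum>l<m i. monom (x (i, l)) l else 0)" for i
  have "degree (X i) < m i" if "i \<in> {1..n}" "X i \<noteq> 0" for i
  proof -
    have "m i \<noteq> 0" using that by (cases "m i") (auto simp: X_def)
    moreover have "degree (X i) \<le> m i - 1"
      unfolding X_def using that
      by (auto intro!: degree_sum_le order.trans[OF degree_monom_le])
    ultimately show ?thesis by linarith
  qed
  then have "X \<in> poly_vectors n m" by (auto simp: poly_vectors_def) (auto simp: X_def)
  moreover have "\<forall>c\<in>coeff_index n m. coeff_at X c = x c"
    by (auto simp: coeff_index_def coeff_at_def X_def coeff_sum)
  ultimately show ?thesis by blast
qed

lemma kernel_vectors_add_scale:
  assumes "X \<in> kernel_vectors n m R M" "Y \<in> kernel_vectors n m R M"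
  shows "X + Y \<in> kernel_vectors n m R M" "scale_vec a X \<in> kernel_vectors n m R M"
proof -
  have "(\<Sum>c\<in>coeff_index n m. M r c * (a * coeff_at X c)) = a * (\<Sum>c\<in>coeff_index n m. M r c * coeff_at X c)" for r
    by (simp add: sum_distrib_left mult_ac)
  then show "X + Y \<in> kernel_vectors n m R M" "scale_vec a X \<in> kernel_vectors n m R M"
    using assms poly_vectors_add_scale[of X n m Y]
    by (auto simp: kernel_vectors_def coeff_at_add coeff_at_scale algebra_simps sum.distrib)
qed

lemma kernel_vectors_nontrivial:
  assumes "finite R" "sum m {1..n} = card R + 1"
  shows "\<exists>X\<in>kernel_vectors n m R M. X \<noteq> 0"
proof -
  obtain x where x: "\<exists>c\<in>coeff_index n m. x c \<noteq> 0"
      "\<forall>r\<in>R. (\<Sum>c\<in>coeff_index n m. M r c * x c) = 0"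
    using underdetermined_system[of R "coeff_index n m" M] assms by (auto simp: card_coeff_index)
  obtain X where X: "X \<in> poly_vectors n m" "\<forall>c\<in>coeff_index n m. coeff_at X c = x c"
    using exists_poly_vector by metis
  then have "X \<in> kernel_vectors n m R M" using x(2) by (simp add: kernel_vectors_def)
  moreover have "X \<noteq> 0" using poly_vectors_zero_iff[OF X(1)] X(2) x(1) by auto
  ultimately show ?thesis by blast
qed

text \<open>There is one unknown more than there are equations, so the kernel is nonzero; a single
  coordinate \<open>c\<close> that vanishes only at the zero vector makes it at most
  one-dimensional.\<close>

lemma weakly_normal_kernel:
  assumes "finite R" "sum m {1..n} = card R + 1"
    and inj: "\<And>X. X \<in> kernel_vectors n m R M \<Longrightarrow> coeff_at X c = 0 \<Longrightarrow> X = 0"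
  shows "weakly_normal (kernel_vectors n m R M)"
proof -
  interpret vector_space scale_vec by (rule vector_space_scale_vec)
  let ?S = "kernel_vectors n m R M"
  obtain Y where Y: "Y \<in> ?S" "Y \<noteq> 0" using kernel_vectors_nontrivial[OF assms(1,2)] by blast
  have sub: "subspace ?S"
    using kernel_vectors_add_scale[of _ n m R M] Y(1)
    by (auto simp: subspace_def) (auto simp: kernel_vectors_def poly_vectors_def coeff_at_def)
  have "?S \<subseteq> span {Y}"
  proof
    fix X assume X: "X \<in> ?S"
    define a where "a = coeff_at X c / coeff_at Y c"
    have "coeff_at Y c \<noteq> 0" using inj Y by blast
    then have "coeff_at (X + scale_vec (-a) Y) c = 0" by (simp add: coeff_at_diff coeff_at_scale a_def)
    moreover have "X + scale_vec (-a) Y \<in> ?S" using X Y kernel_vectors_add_scale by blast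
    ultimately have "X + scale_vec (-a) Y = 0" using inj by blast
    then have "X = scale_vec a Y" by (metis add_eq_0_iff2 add.inverse_inverse scale_minus_left)
    then show "X \<in> span {Y}" by (simp add: span_base span_scale)
  qed
  moreover have "span {Y} \<subseteq> ?S" using sub Y by (intro span_minimal) auto
  ultimately have "span {Y} = span ?S" using sub by (metis span_eq_iff subset_antisym)
  moreover have "independent {Y}" using Y by simp
  ultimately have "dim ?S = 1" using dim_eq_card[of "{Y}" ?S] by simp
  then show ?thesis using sub by (simp add: weakly_normal_def)
qed

text \<open>Injectivity is assumed at one coordinate \<open>c\<close>, while the normalization may
  use any coefficient that is nonzero in the limit. The limit kernel is a line spanned by
  \<open>Z\<close>, so every coordinate at which \<open>Z\<close> is nonzero separates it equally
  well.\<close>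

lemma normalized_kernel_conv:
  fixes M :: "real \<Rightarrow> 'r \<Rightarrow> nat \<times> nat \<Rightarrow> real" and M0 :: "'r \<Rightarrow> nat \<times> nat \<Rightarrow> real"
  assumes fin: "finite R" and card: "sum m {1..n} = card R + 1"
    and c: "c \<in> coeff_index n m"
    and inj: "\<And>x. (\<And>r. r \<in> R \<Longrightarrow> (\<Sum>a\<in>coeff_index n m. M0 r a * x a) = 0) \<Longrightarrow> x c = 0 \<Longrightarrow>
                \<forall>a\<in>coeff_index n m. x a = 0"
    and M: "\<And>r a. r \<in> R \<Longrightarrow> a \<in> coeff_index n m \<Longrightarrow>
              (\<lambda>\<tau>. M \<tau> r a - M0 r a) \<in> O[at_top](\<lambda>\<tau>. \<tau> powr (-1/2))"
    and S: "\<forall>\<^sub>F \<tau> in at_top. S \<tau> = kernel_vectors n m R (M \<tau>)" "S0 = kernel_vectors n m R M0"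
  shows "(\<forall>\<^sub>F \<tau> in at_top. weakly_normal (S \<tau>)) \<and> weakly_normal S0 \<and>
         normalized_solutions_conv n S S0"
proof -
  let ?I = "coeff_index n m"
  have \<epsilon>: "((\<lambda>\<tau>::real. \<tau> powr (-1/2)) \<longlongrightarrow> 0) at_top" "\<forall>\<^sub>F \<tau>::real in at_top. \<tau> powr (-1/2) > 0"
    by real_asymp+
  have wnS0: "weakly_normal S0"
    unfolding S(2)
  proof (rule weakly_normal_kernel[OF fin card])
    fix X assume X: "X \<in> kernel_vectors n m R M0" "coeff_at X c = 0"
    then have "\<forall>a\<in>?I. coeff_at X a = 0" by (intro inj) (auto simp: kernel_vectors_def)
    then show "X = 0" using X poly_vectors_zero_iff[of X n m] by (auto simp: kernel_vectors_def)
  qed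
  obtain Z where Z: "Z \<in> S0" "Z \<noteq> 0"
    using kernel_vectors_nontrivial[OF fin card] S by blast
  have Zc: "coeff_at Z c \<noteq> 0"
  proof
    assume "coeff_at Z c = 0"
    then have "\<forall>a\<in>?I. coeff_at Z a = 0"
      using Z(1) unfolding S(2) by (intro inj) (auto simp: kernel_vectors_def)
    then show False using Z poly_vectors_zero_iff[of Z n m] unfolding S(2) by (simp add: kernel_vectors_def)
  qed
  have injc: "\<forall>a\<in>?I. x a = 0"
    if x: "\<And>r. r \<in> R \<Longrightarrow> (\<Sum>a\<in>?I. M0 r a * x a) = 0" "x b = 0" and b: "coeff_at Z b \<noteq> 0" "b \<in> ?I" for x b
  proof -
    have 1: "\<forall>a\<in>?I. x a - x c / coeff_at Z c * coeff_at Z a = 0"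
    proof (rule inj)
      show "(\<Sum>a\<in>?I. M0 r a * (x a - x c / coeff_at Z c * coeff_at Z a)) = 0" if "r \<in> R" for r
      proof -
        have "(\<Sum>a\<in>?I. M0 r a * (x a - x c / coeff_at Z c * coeff_at Z a)) =
          (\<Sum>a\<in>?I. M0 r a * x a) - x c / coeff_at Z c * (\<Sum>a\<in>?I. M0 r a * coeff_at Z a)"
          by (simp add: right_diff_distrib sum_subtractf sum_distrib_left mult_ac)
        then show ?thesis using x(1)[OF that] Z(1) that unfolding S(2) by (simp add: kernel_vectors_def)
      qed
    qed (use Zc in simp)
    then have "x c = 0" using b x(2) Zc by force
    with 1 show ?thesis by simp
  qed
  have Zb: "coeff_at Z b \<noteq> 0" if Y: "Y \<in> S0" "coeff_at Y b = 1" "b \<in> ?I" for Y b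
  proof
    assume "coeff_at Z b = 0"
    define W where "W = scale_vec (coeff_at Y c / coeff_at Z c) Z"
    have W: "W \<in> S0" unfolding W_def S(2) using Z(1) S(2) kernel_vectors_add_scale by blast
    have "\<forall>a\<in>?I. coeff_at Y a - coeff_at W a = 0"
    proof (rule inj)
      show "(\<Sum>a\<in>?I. M0 r a * (coeff_at Y a - coeff_at W a)) = 0" if "r \<in> R" for r
        using Y W that unfolding S(2) by (simp add: kernel_vectors_def right_diff_distrib sum_subtractf)
      show "coeff_at Y c - coeff_at W c = 0" using Zc by (simp add: W_def coeff_at_scale)
    qed
    then show False using Y \<open>coeff_at Z b = 0\<close> by (auto simp: W_def coeff_at_scale)
  qed
  have pert: "\<exists>K. \<forall>\<^sub>F \<tau> in at_top. \<forall>x. (\<forall>r\<in>R. (\<Sum>c\<in>?I. M \<tau> r c * x c) = 0) \<longrightarrow>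
           (\<forall>a\<in>?I. \<bar>x a - x b * coeff_at Y a\<bar> \<le> K * \<bar>x b\<bar> * \<tau> powr (-1/2))"
    if Y: "Y \<in> S0" "coeff_at Y b = 1" "b \<in> ?I" for Y b
  proof -
    have Y0: "(\<Sum>c\<in>?I. M0 r c * coeff_at Y c) = 0" if "r \<in> R" for r
      using Y that unfolding S(2) by (simp add: kernel_vectors_def)
    have I: "\<forall>c\<in>?I. x c = 0" if "\<And>r. r \<in> R \<Longrightarrow> (\<Sum>c\<in>?I. M0 r c * x c) = 0" "x b = 0" for x
      by (rule injc[OF that(1) that(2) Zb[OF Y] Y(3)])
    show ?thesis
      by (rule kernel_perturbation[where M = M and ?M0.0 = M0 and Y = "coeff_at Y" and ?c0.0 = b and R = R
          and C = ?I and F = at_top and \<epsilon> = "\<lambda>\<tau>. \<tau> powr (-1/2)"])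
        (rule finite_coeff_index fin Y Y0 \<epsilon> M I | assumption)+
  qed
  \<comment> \<open>Putting \<open>x b = 0\<close> into the perturbation bound makes its right-hand
    side zero, so for large \<tau> a solution whose coefficient \<open>b\<close> is zero vanishes:
    one estimate gives both normality and convergence.\<close>
  have unique: "\<forall>\<^sub>F \<tau> in at_top. \<forall>X\<in>kernel_vectors n m R (M \<tau>). coeff_at X b = 0 \<longrightarrow> X = 0"
    if Y: "Y \<in> S0" "coeff_at Y b = 1" "b \<in> ?I" for Y b
  proof -
    obtain K where "\<forall>\<^sub>F \<tau> in at_top. \<forall>x. (\<forall>r\<in>R. (\<Sum>c\<in>?I. M \<tau> r c * x c) = 0) \<longrightarrow>
           (\<forall>a\<in>?I. \<bar>x a - x b * coeff_at Y a\<bar> \<le> K * \<bar>x b\<bar> * \<tau> powr (-1/2))"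
      using pert[OF Y] by blast
    then show ?thesis
    proof eventually_elim
      case (elim \<tau>)
      show ?case
      proof (intro ballI impI)
        fix X assume X: "X \<in> kernel_vectors n m R (M \<tau>)" "coeff_at X b = 0"
        then have "\<forall>a\<in>?I. \<bar>coeff_at X a - coeff_at X b * coeff_at Y a\<bar> \<le> K * \<bar>coeff_at X b\<bar> * \<tau> powr (-1/2)"
          using elim by (auto simp: kernel_vectors_def)
        then have "\<forall>a\<in>?I. coeff_at X a = 0" using X by simp
        then show "X = 0" using X poly_vectors_zero_iff by (auto simp: kernel_vectors_def)
      qed
    qed
  qed
  define Y where "Y = scale_vec (1 / coeff_at Z c) Z"
  have Y: "Y \<in> S0" "coeff_at Y c = 1"
    using Z Zc kernel_vectors_add_scale unfolding S(2) Y_def by (auto simp: coeff_at_scale)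
  have "\<forall>\<^sub>F \<tau> in at_top. weakly_normal (S \<tau>)"
    using unique[OF Y c] S(1)
    by eventually_elim (use weakly_normal_kernel[OF fin card] in metis)
  moreover have "normalized_solutions_conv n S S0"
    unfolding normalized_solutions_conv_def
  proof (intro ballI allI impI conjI)
    fix Y i k assume Y: "Y \<in> S0" "i \<in> {1..n}" "coeff (Y i) k = 1"
    have Yb: "coeff_at Y (i, k) = 1" using Y by (simp add: coeff_at_def)
    have b: "(i, k) \<in> ?I" using coeff_at_outside[of Y n m "(i, k)"] Y Yb unfolding S(2)
      by (auto simp: kernel_vectors_def)
    note u = unique[OF Y(1) Yb b]
    show "\<forall>\<^sub>F \<tau> in at_top. \<exists>!X. X \<in> S \<tau> \<and> coeff (X i) k = 1"
      using u S(1)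
    proof eventually_elim
      case (elim \<tau>)
      let ?K = "kernel_vectors n m R (M \<tau>)"
      obtain X where X: "X \<in> ?K" "X \<noteq> 0" using kernel_vectors_nontrivial[OF fin card] by blast
      then have nz: "coeff_at X (i, k) \<noteq> 0" using elim by auto
      define X1 where "X1 = scale_vec (1 / coeff_at X (i, k)) X"
      have X1: "X1 \<in> ?K" "coeff_at X1 (i, k) = 1"
        using X nz kernel_vectors_add_scale by (auto simp: X1_def coeff_at_scale)
      have "X2 = X1" if X2: "X2 \<in> ?K" "coeff_at X2 (i, k) = 1" for X2
      proof -
        have "X2 + scale_vec (-1) X1 \<in> ?K" using kernel_vectors_add_scale X1 X2 by blast
        moreover have "coeff_at (X2 + scale_vec (-1) X1) (i, k) = 0"
          using X1 X2 by (simp add: coeff_at_add coeff_at_scale)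
        ultimately have "X2 + scale_vec (-1) X1 = 0" using elim by blast
        then show ?thesis by (simp add: scale_vec_def fun_eq_iff)
      qed
      moreover have "X1 \<in> ?K \<and> coeff (X1 i) k = 1" using X1 by (simp add: coeff_at_def)
      ultimately show ?case unfolding elim(2) by (metis coeff_at_def fst_conv snd_conv)
    qed
    fix X assume X: "\<forall>\<^sub>F \<tau> in at_top. X \<tau> \<in> S \<tau> \<and> coeff (X \<tau> i) k = 1"
    obtain K where K: "\<forall>\<^sub>F \<tau> in at_top. \<forall>x. (\<forall>r\<in>R. (\<Sum>c\<in>?I. M \<tau> r c * x c) = 0) \<longrightarrow>
           (\<forall>a\<in>?I. \<bar>x a - x (i, k) * coeff_at Y a\<bar> \<le> K * \<bar>x (i, k)\<bar> * \<tau> powr (-1/2))"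
      using pert[OF Y(1) Yb b] by blast
    have conv: "\<forall>\<^sub>F \<tau> in at_top. \<forall>a. \<bar>coeff_at (X \<tau>) a - coeff_at Y a\<bar> \<le> \<bar>K\<bar> * \<tau> powr (-1/2)"
      using K X S(1)
    proof (eventually_elim, intro allI)
      fix \<tau> a
      assume E: "\<forall>x. (\<forall>r\<in>R. (\<Sum>c\<in>?I. M \<tau> r c * x c) = 0) \<longrightarrow>
           (\<forall>a\<in>?I. \<bar>x a - x (i, k) * coeff_at Y a\<bar> \<le> K * \<bar>x (i, k)\<bar> * \<tau> powr (-1/2))"
         "X \<tau> \<in> S \<tau> \<and> coeff (X \<tau> i) k = 1" "S \<tau> = kernel_vectors n m R (M \<tau>)"
      have X\<tau>: "X \<tau> \<in> kernel_vectors n m R (M \<tau>)" "coeff_at (X \<tau>) (i, k) = 1"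
        using E by (auto simp: coeff_at_def)
      show "\<bar>coeff_at (X \<tau>) a - coeff_at Y a\<bar> \<le> \<bar>K\<bar> * \<tau> powr (-1/2)"
      proof (cases "a \<in> ?I")
        case True
        then have "\<bar>coeff_at (X \<tau>) a - coeff_at Y a\<bar> \<le> K * \<tau> powr (-1/2)"
          using E(1)[rule_format, of "coeff_at (X \<tau>)" a] X\<tau> by (simp add: kernel_vectors_def)
        also have "\<dots> \<le> \<bar>K\<bar> * \<tau> powr (-1/2)" by (intro mult_right_mono) auto
        finally show ?thesis .
      next
        case False
        then have "coeff_at (X \<tau>) a = 0" "coeff_at Y a = 0"
          using coeff_at_outside[of _ n m a] X\<tau>(1) Y(1) unfolding S(2)
          by (simp_all add: kernel_vectors_def)
        then show ?thesis by simp
      qed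
    qed
    show "coefficientwise_conv n X Y"
      unfolding coefficientwise_conv_def
    proof (intro ballI allI conjI)
      fix i' k'
      have O: "(\<lambda>\<tau>. coeff (X \<tau> i') k' - coeff (Y i') k') \<in> O[at_top](\<lambda>\<tau>. \<tau> powr (- 1 / 2))"
      proof (rule bigoI[of _ "\<bar>K\<bar>"])
        show "\<forall>\<^sub>F \<tau> in at_top. norm (coeff (X \<tau> i') k' - coeff (Y i') k') \<le> \<bar>K\<bar> * norm (\<tau> powr (- 1 / 2))"
          using conv
        proof eventually_elim
          case (elim \<tau>)
          then show ?case using spec[OF elim, of "(i', k')"] by (simp add: coeff_at_def)
        qed
      qed
      then show "(\<lambda>\<tau>. coeff (X \<tau> i') k' - coeff (Y i') k') \<in> O[at_top](\<lambda>\<tau>. \<tau> powr (- 1 / 2))" .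
      have "((\<lambda>\<tau>. coeff (X \<tau> i') k' - coeff (Y i') k') \<longlongrightarrow> 0) at_top"
        using bigo_tendsto_0[OF O] \<epsilon>(1) by simp
      then show "((\<lambda>\<tau>. coeff (X \<tau> i') k') \<longlongrightarrow> coeff (Y i') k') at_top"
        by (simp add: LIM_zero_iff)
    qed
  qed
  ultimately show ?thesis using wnS0 by blast
qed

lemma poly_vector_integral:
  assumes X: "X \<in> poly_vectors n m"
    and int: "\<And>i v. i \<in> {1..n} \<Longrightarrow> set_integrable lborel S (\<lambda>t. t ^ v * (u t * V i t))"
  shows "(LBINT t:S. t ^ k * u t * (\<Sum>i=1..n. poly (X i) t * V i t)) =
    (\<Sum>c\<in>coeff_index n m. (LBINT t:S. t ^ (k + snd c) * (u t * V (fst c) t)) * coeff_at X c)"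
proof -
  have p: "poly (X i) t = (\<Sum>l<m i. coeff (X i) l * t ^ l)" if "i \<in> {1..n}" for i t
  proof (cases "X i = 0")
    case False
    then have "degree (X i) < m i" using X that by (auto simp: poly_vectors_def)
    then show ?thesis unfolding poly_altdef
      by (intro sum.mono_neutral_left) (auto simp: coeff_eq_0)
  qed simp
  have "t ^ k * u t * (\<Sum>i=1..n. poly (X i) t * V i t) =
      (\<Sum>c\<in>coeff_index n m. coeff_at X c * (t ^ (k + snd c) * (u t * V (fst c) t)))" for t
  proof -
    have "(\<Sum>i=1..n. t ^ k * u t * (poly (X i) t * V i t)) =
        (\<Sum>i=1..n. \<Sum>l<m i. coeff_at X (i, l) * (t ^ (k + l) * (u t * V i t)))"
      by (intro sum.cong) (auto simp: p sum_distrib_left sum_distrib_right coeff_at_def power_add mult_ac)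
    then show ?thesis unfolding coeff_index_def
      by (subst (asm) sum.Sigma) (auto simp: sum_distrib_left case_prod_unfold)
  qed
  then have "(LBINT t:S. t ^ k * u t * (\<Sum>i=1..n. poly (X i) t * V i t)) =
      (LBINT t:S. (\<Sum>c\<in>coeff_index n m. coeff_at X c * (t ^ (k + snd c) * (u t * V (fst c) t))))"
    by simp
  also have "\<dots> = (\<Sum>c\<in>coeff_index n m. LBINT t:S. coeff_at X c * (t ^ (k + snd c) * (u t * V (fst c) t)))"
    unfolding set_lebesgue_integral_def scaleR_sum_right
  proof (rule Bochner_Integration.integral_sum)
    fix c assume "c \<in> coeff_index n m"
    then have "set_integrable lborel S (\<lambda>t. t ^ (k + snd c) * (u t * V (fst c) t))"
      by (intro int) (auto simp: coeff_index_def)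
    then have "set_integrable lborel S (\<lambda>t. coeff_at X c * (t ^ (k + snd c) * (u t * V (fst c) t)))"
      by (intro set_integrable_mult_right)
    then show "integrable lborel (\<lambda>t. indicator S t *\<^sub>R (coeff_at X c * (t ^ (k + snd c) * (u t * V (fst c) t))))"
      by (simp add: set_integrable_def)
  qed
  also have "\<dots> = (\<Sum>c\<in>coeff_index n m. (LBINT t:S. t ^ (k + snd c) * (u t * V (fst c) t)) * coeff_at X c)"
    by (simp add: mult.commute)
  finally show ?thesis .
qed

text \<open>A condition is a pair of row and power, just as a coefficient is a pair of component and
  power. Hence \<open>coeff_index\<close> enumerates the equations as well, and the A- and
  B-problems read the same array of moments in transposed order.\<close>

lemma A_solutions_eq_kernel:
  assumes "\<And>j i v. j \<in> {1..q} \<Longrightarrow> i \<in> {1..p} \<Longrightarrow> set_integrable lborel S (\<lambda>t. t ^ v * U j t * V i t)"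
  shows "A_solutions S q p U V lam m = kernel_vectors p m (coeff_index q lam)
     (\<lambda>r c. LBINT t:S. t ^ (snd r + snd c) * U (fst r) t * V (fst c) t)"
proof -
  have "(LBINT t:S. t ^ k * U j t * (\<Sum>i=1..p. poly (A i) t * V i t)) =
     (\<Sum>c\<in>coeff_index p m. (LBINT t:S. t ^ (k + snd c) * U j t * V (fst c) t) * coeff_at A c)"
    if "A \<in> poly_vectors p m" "j \<in> {1..q}" for A j k
    using poly_vector_integral[OF that(1), of S "U j" V k] assms[OF that(2)] by (simp add: mult.assoc)
  then show ?thesis
    by (auto simp: A_solutions_def kernel_vectors_def coeff_index_def[of q])
qed

lemma B_solutions_eq_kernel:
  assumes "\<And>j i v. j \<in> {1..q} \<Longrightarrow> i \<in> {1..p} \<Longrightarrow> set_integrable lborel S (\<lambda>t. t ^ v * U j t * V i t)"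
  shows "B_solutions S q p U V lam m = kernel_vectors q lam (coeff_index p m)
     (\<lambda>r c. LBINT t:S. t ^ (snd r + snd c) * U (fst c) t * V (fst r) t)"
proof -
  have "(LBINT t:S. t ^ k * V i t * (\<Sum>j=1..q. poly (B j) t * U j t)) =
     (\<Sum>c\<in>coeff_index q lam. (LBINT t:S. t ^ (k + snd c) * U (fst c) t * V i t) * coeff_at B c)"
    if "B \<in> poly_vectors q lam" "i \<in> {1..p}" for B i k
    using poly_vector_integral[OF that(1), of S "V i" U k] assms[OF _ that(2)] by (simp add: mult_ac)
  then show ?thesis
    by (auto simp: B_solutions_def kernel_vectors_def coeff_index_def[of p])
qed

subsection \<open>Nonsingularity of the Hermite moment matrix\<close>

lemma sum_root_multiplicities_le_degree:
  fixes S :: "real poly"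
  assumes "finite K" "S \<noteq> 0" "inj_on x K" "\<And>a. a \<in> K \<Longrightarrow> [:- x a, 1:] ^ n a dvd S"
  shows "sum n K \<le> degree S"
  using assms
proof (induction K arbitrary: S rule: finite_induct)
  case (insert a K)
  obtain T where T: "S = [:- x a, 1:] ^ n a * T" using insert.prems(3)[of a] by (auto elim: dvdE)
  have T0: "T \<noteq> 0" using T insert.prems(1) by auto
  have "[:- x b, 1:] ^ n b dvd T" if b: "b \<in> K" for b
  proof -
    have "x b \<noteq> x a" using insert.prems(2) insert.hyps(2) b by (auto simp: inj_on_def)
    then have "order (x b) ([:- x a, 1:] ^ n a) = 0" by (intro order_0I) simp
    then have "order (x b) S = order (x b) T" using T insert.prems(1) by (simp add: order_mult)
    moreover have "n b \<le> order (x b) S"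
      using insert.prems(1) insert.prems(3)[of b] b by (simp add: order_divides)
    ultimately show ?thesis using T0 by (simp add: order_divides)
  qed
  then have "sum n K \<le> degree T" using insert.IH[OF T0] insert.prems(2) by auto
  moreover have "degree S = n a + degree T" using T T0 by (simp add: degree_mult_eq degree_power_eq)
  ultimately show ?case using insert.hyps by simp
qed auto

text \<open>If the order of \<open>S\<close> at \<open>x\<close> were \<open>k < n\<close>, the
  cofactor \<open>T\<close> would be nonzero at \<open>x\<close>. Taylor's formula with all terms up
  to \<open>k\<close> equal to zero bounds \<open>\<phi> 0\<close> by a multiple of
  \<open>\<bar>z - x\<bar> ^ Suc k\<close>, hence \<open>T\<close> by a multiple of
  \<open>\<bar>z - x\<bar>\<close> near \<open>x\<close>, a contradiction. The factor
  \<open>\<psi>\<close> enters only through its size, so continuity at \<open>x\<close> is all that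
  is asked of it.\<close>

lemma root_multiplicity_from_derivatives:
  fixes \<phi> :: "nat \<Rightarrow> real \<Rightarrow> real"
  assumes D: "open D" "x \<in> D"
    and deriv: "\<And>k z. z \<in> D \<Longrightarrow> (\<phi> k has_field_derivative \<phi> (Suc k) z) (at z)"
    and zero: "\<And>k. k < n \<Longrightarrow> \<phi> k x = 0"
    and S: "\<And>z. z \<in> D \<Longrightarrow> poly S z = \<phi> 0 z * \<psi> z" and cont: "isCont \<psi> x"
  shows "[:- x, 1:] ^ n dvd S"
proof (rule ccontr)
  assume nd: "\<not> ?thesis"
  then have S0: "S \<noteq> 0" by auto
  define k where "k = order x S"
  have k: "k < n" using nd S0 by (simp add: order_divides k_def)
  obtain T where T: "S = [:- x, 1:] ^ k * T" "\<not> [:- x, 1:] dvd T"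
    using order_decomp[OF S0, of x] unfolding k_def by auto
  have Tx: "poly T x \<noteq> 0" using T(2) by (simp add: poly_eq_0_iff_dvd)
  obtain \<delta> where \<delta>: "\<delta> > 0" "cball x \<delta> \<subseteq> D" using D open_contains_cball by blast
  have "continuous_on (cball x \<delta>) (\<phi> (Suc k))"
    by (intro continuous_at_imp_continuous_on ballI DERIV_isCont[OF deriv]) (use \<delta> in auto)
  then have "bounded (\<phi> (Suc k) ` cball x \<delta>)"
    by (intro compact_imp_bounded compact_continuous_image compact_cball)
  then obtain B where B: "\<And>z. z \<in> cball x \<delta> \<Longrightarrow> norm (\<phi> (Suc k) z) \<le> B"
    unfolding bounded_iff by blast
  have bound: "\<bar>\<phi> 0 z\<bar> \<le> B * \<bar>z - x\<bar> ^ Suc k" if z: "z \<in> cball x \<delta>" "z \<noteq> x" for z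
  proof -
    have "\<exists>t. (if z < x then z < t \<and> t < x else x < t \<and> t < z) \<and>
       \<phi> 0 z = (\<Sum>m<Suc k. \<phi> m x / fact m * (z - x) ^ m) + \<phi> (Suc k) t / fact (Suc k) * (z - x) ^ Suc k"
    proof (rule Taylor[where a = "x - \<delta>" and b = "x + \<delta>"])
      show "\<forall>m t. m < Suc k \<and> x - \<delta> \<le> t \<and> t \<le> x + \<delta> \<longrightarrow> (\<phi> m has_real_derivative \<phi> (Suc m) t) (at t)"
        using \<delta> by (intro allI impI deriv) (auto simp: subset_iff dist_real_def abs_le_iff)
    qed (use z \<delta> in \<open>auto simp: dist_real_def abs_le_iff\<close>)
    then obtain t where t: "if z < x then z < t \<and> t < x else x < t \<and> t < z"
       "\<phi> 0 z = (\<Sum>m<Suc k. \<phi> m x / fact m * (z - x) ^ m) + \<phi> (Suc k) t / fact (Suc k) * (z - x) ^ Suc k"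
      by blast
    have "(\<Sum>m<Suc k. \<phi> m x / fact m * (z - x) ^ m) = 0"
      using zero k by (intro sum.neutral) auto
    then have "\<bar>\<phi> 0 z\<bar> = \<bar>\<phi> (Suc k) t\<bar> / fact (Suc k) * \<bar>z - x\<bar> ^ Suc k"
      using t(2) by (simp add: abs_mult power_abs)
    also have "\<dots> \<le> B * \<bar>z - x\<bar> ^ Suc k"
    proof (rule mult_right_mono)
      have "t \<in> cball x \<delta>" using t(1) z by (auto simp: dist_real_def split: if_splits)
      then have "\<bar>\<phi> (Suc k) t\<bar> \<le> B" using B by auto
      moreover have "\<bar>\<phi> (Suc k) t\<bar> / fact (Suc k) \<le> \<bar>\<phi> (Suc k) t\<bar> / 1"
        by (intro divide_left_mono fact_ge_1) auto
      ultimately show "\<bar>\<phi> (Suc k) t\<bar> / fact (Suc k) \<le> B" by simp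
    qed auto
    finally show ?thesis .
  qed
  have ev: "\<forall>\<^sub>F z in at x. z \<in> cball x \<delta> \<and> z \<noteq> x"
    unfolding eventually_at using \<delta>(1) by (intro exI[of _ \<delta>]) (auto simp: dist_commute)
  have "\<forall>\<^sub>F z in at x. norm (poly T z) \<le> \<bar>B\<bar> * \<bar>z - x\<bar> * \<bar>\<psi> z\<bar>"
    using ev
  proof eventually_elim
    case (elim z)
    have "\<bar>z - x\<bar> ^ k * \<bar>poly T z\<bar> = \<bar>poly S z\<bar>"
      by (simp add: T(1) abs_mult power_abs)
    also have "\<dots> = \<bar>\<phi> 0 z\<bar> * \<bar>\<psi> z\<bar>" using S[of z] elim \<delta> by (auto simp: abs_mult)
    also have "\<dots> \<le> (\<bar>B\<bar> * \<bar>z - x\<bar> ^ Suc k) * \<bar>\<psi> z\<bar>"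
      using bound[of z] elim by (intro mult_right_mono) (auto intro: order.trans mult_right_mono)
    also have "\<dots> = \<bar>z - x\<bar> ^ k * (\<bar>B\<bar> * \<bar>z - x\<bar> * \<bar>\<psi> z\<bar>)" by simp
    finally show ?case using elim by (simp only: real_norm_def) (subst (asm) mult_le_cancel_left_pos, auto)
  qed
  moreover have "((\<lambda>z. \<bar>B\<bar> * \<bar>z - x\<bar> * \<bar>\<psi> z\<bar>) \<longlongrightarrow> \<bar>B\<bar> * \<bar>x - x\<bar> * \<bar>\<psi> x\<bar>) (at x)"
    using cont by (intro tendsto_intros) (auto simp: isCont_def)
  then have "((\<lambda>z. \<bar>B\<bar> * \<bar>z - x\<bar> * \<bar>\<psi> z\<bar>) \<longlongrightarrow> 0) (at x)" by simp
  ultimately have "(poly T \<longlongrightarrow> 0) (at x)" by (rule Lim_null_comparison)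
  moreover have "(poly T \<longlongrightarrow> poly T x) (at x)" using poly_isCont[of x T] by (simp add: isCont_def)
  ultimately show False using Tx tendsto_unique[OF at_neq_bot] by blast
qed

text \<open>\<open>G P / Q ^ (k + 1)\<close> with \<open>P = row_poly Q W P0 k\<close> is the \<open>k\<close>-th derivative of \<open>G P0 / Q\<close>
  when \<open>G' / G = W / Q\<close>.\<close>

primrec row_poly :: "real poly \<Rightarrow> real poly \<Rightarrow> real poly \<Rightarrow> nat \<Rightarrow> real poly" where
  "row_poly Q W P0 0 = P0"
| "row_poly Q W P0 (Suc k) =
     pderiv (row_poly Q W P0 k) * Q - smult (real (Suc k)) (row_poly Q W P0 k * pderiv Q) + row_poly Q W P0 k * W"

lemma row_poly_derivative:
  assumes "open D"
    and \<mu>: "\<And>k z. z \<in> D \<Longrightarrow> (\<mu> k has_field_derivative \<mu> (Suc k) z) (at z)"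
    and G: "\<And>z. z \<in> D \<Longrightarrow> (G has_field_derivative G z * (poly W z / poly Q z)) (at z)"
    and Q: "\<And>z. z \<in> D \<Longrightarrow> poly Q z \<noteq> 0"
    and \<mu>0: "\<And>z. z \<in> D \<Longrightarrow> \<mu> 0 z = G z * poly P0 z / poly Q z"
    and "z \<in> D"
  shows "\<mu> k z = G z * poly (row_poly Q W P0 k) z / poly Q z ^ Suc k"
  using \<open>z \<in> D\<close>
proof (induction k arbitrary: z)
  case (Suc k)
  let ?P = "row_poly Q W P0 k"
  have "((\<lambda>z. G z * poly ?P z / poly Q z ^ Suc k) has_field_derivative \<mu> (Suc k) z) (at z)"
    by (rule has_field_derivative_transform_within_open[OF \<mu>[OF Suc.prems] \<open>open D\<close> Suc.prems])
       (rule Suc.IH)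
  moreover have "((\<lambda>z. G z * poly ?P z / poly Q z ^ Suc k) has_field_derivative
     G z * poly (row_poly Q W P0 (Suc k)) z / poly Q z ^ Suc (Suc k)) (at z)"
    using Q[OF Suc.prems]
    by (auto intro!: derivative_eq_intros G Suc.prems simp: divide_simps simp del: of_nat_Suc)
       (simp add: algebra_simps power_add[symmetric], cases k, simp_all)
  ultimately show ?case by (rule DERIV_unique)
qed (simp add: \<mu>0)


text \<open>\<open>Q\<close> collects the rates indexed by \<open>H\<close>, and \<open>L h\<close>
  is \<open>Q\<close> without the factor of \<open>h\<close>. Division by \<open>Q\<close> turns
  \<open>W\<close> into \<open>a + z / 2\<close> minus the sum of the
  \<open>d h / (\<rho> h + z)\<close>, the logarithmic derivative of the Laplace transform of the
  last Hermite row when \<open>H\<close> contains every index. The index \<open>None\<close> of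
  \<open>P\<close> stands for the last row, with initial ratio 1, and \<open>Some h\<close> for row
  \<open>h\<close>, with initial ratio \<open>\<rho> h / (\<rho> h + z)\<close>.\<close>

context
  fixes H :: "nat set" and \<rho> d :: "nat \<Rightarrow> real" and a :: real and Q W :: "real poly" and L :: "nat \<Rightarrow> real poly"
    and P :: "nat option \<Rightarrow> nat \<Rightarrow> real poly"
  assumes fin: "finite H" and inj: "inj_on \<rho> H" and \<rho>: "\<And>h. h \<in> H \<Longrightarrow> \<rho> h > 0" and d: "\<And>h. h \<in> H \<Longrightarrow> d h > 0"
  defines "Q \<equiv> \<Prod>h\<in>H. [:\<rho> h, 1:]"
    and "L \<equiv> \<lambda>h. \<Prod>g\<in>H - {h}. [:\<rho> g, 1:]"
    and "W \<equiv> [:a, 1/2:] * Q - (\<Sum>h\<in>H. smult (d h) (L h))"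
    and "P \<equiv> \<lambda>j. row_poly Q W (case j of None \<Rightarrow> Q | Some h \<Rightarrow> smult (\<rho> h) (L h))"
begin

lemma degree_Q: "degree Q = card H"
  by (simp add: Q_def degree_prod_eq_sum_degree)

lemma lead_coeff_Q: "lead_coeff Q = 1"
  by (simp add: Q_def lead_coeff_prod)

lemma degree_L: "h \<in> H \<Longrightarrow> degree (L h) + 1 = card H"
  using fin card_Suc_Diff1[of H h] by (auto simp: L_def degree_prod_eq_sum_degree)

lemma Q_eq_L: "h \<in> H \<Longrightarrow> Q = [:\<rho> h, 1:] * L h"
  using fin by (simp add: Q_def L_def prod.remove)

lemma poly_L_nonzero: "h \<in> H \<Longrightarrow> poly (L h) (- \<rho> h) \<noteq> 0"
  using fin inj by (auto simp: L_def poly_prod inj_on_def)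

lemma poly_L_zero: "h \<in> H \<Longrightarrow> g \<in> H \<Longrightarrow> g \<noteq> h \<Longrightarrow> poly (L g) (- \<rho> h) = 0"
  using fin by (auto simp: L_def poly_prod)

text \<open>At \<open>- \<rho> h\<close> the polynomial \<open>Q\<close> vanishes, while
  \<open>pderiv Q\<close> and \<open>W\<close> reduce to 1 and \<open>- d h\<close> times
  \<open>poly (L h) (- \<rho> h)\<close>. The derivative term of the recursion drops out, and what
  is left is multiplication by a number, nonzero since \<open>d h > 0\<close> and the rates in
  \<open>H\<close> are distinct.\<close>

lemma row_poly_at_pole:
  assumes "h \<in> H"
  shows "poly (row_poly Q W P0 k) (- \<rho> h) = (\<Prod>i<k. - (real i + 1 + d h) * poly (L h) (- \<rho> h)) * poly P0 (- \<rho> h)"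
proof (induction k)
  case (Suc k)
  have Q0: "poly Q (- \<rho> h) = 0" using assms by (simp add: Q_eq_L)
  have Q1: "poly (pderiv Q) (- \<rho> h) = poly (L h) (- \<rho> h)"
    using assms by (simp add: Q_eq_L pderiv_mult pderiv_pCons del: mult_pCons_left)
  have "(\<Sum>g\<in>H. d g * poly (L g) (- \<rho> h)) = (\<Sum>g\<in>H. if g = h then d h * poly (L h) (- \<rho> h) else 0)"
    using assms by (intro sum.cong) (auto simp: poly_L_zero)
  then have "poly W (- \<rho> h) = - d h * poly (L h) (- \<rho> h)"
    using assms fin Q0 by (simp add: W_def poly_sum)
  then show ?case using Suc Q0 Q1 by (simp add: algebra_simps)
qed simp

text \<open>The initial polynomials of all rows but \<open>Some h\<close> contain the factor that
  vanishes at \<open>- \<rho> h\<close>, and the multiplicative recursion at this point keeps them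
  zero. Each pole therefore singles out its own row.\<close>

lemma poly_P_pole:
  assumes "h \<in> H"
  shows "poly (P (Some h) k) (- \<rho> h) \<noteq> 0"
    and "j \<in> insert None (Some ` H) \<Longrightarrow> j \<noteq> Some h \<Longrightarrow> poly (P j k) (- \<rho> h) = 0"
proof -
  have "(\<Prod>i<k. - (real i + 1 + d h) * poly (L h) (- \<rho> h)) \<noteq> 0"
    using d[OF assms] poly_L_nonzero[OF assms] by (auto simp: add_eq_0_iff)
  then show "poly (P (Some h) k) (- \<rho> h) \<noteq> 0"
    using \<rho>[OF assms] poly_L_nonzero[OF assms] by (simp add: P_def row_poly_at_pole[OF assms])
  show "j \<in> insert None (Some ` H) \<Longrightarrow> j \<noteq> Some h \<Longrightarrow> poly (P j k) (- \<rho> h) = 0"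
    using assms by (auto simp: P_def row_poly_at_pole[OF assms] poly_L_zero) (simp add: Q_eq_L)
qed

lemma W_degree: "degree W \<le> Suc (card H)" "coeff W (Suc (card H)) = 1/2"
proof -
  have s: "degree (\<Sum>h\<in>H. smult (d h) (L h)) \<le> card H"
    using degree_L by (intro degree_sum_le fin) (fastforce intro: order.trans[OF degree_smult_le])
  have q: "degree ([:a, 1/2:] * Q) \<le> Suc (card H)"
    using degree_mult_le[of "[:a, 1/2:]" Q] by (simp add: degree_Q)
  show "degree W \<le> Suc (card H)" unfolding W_def using s q by (intro degree_diff_le) auto
  have "coeff ([:a, 1/2:] * Q) (Suc (card H)) = 1/2"
    using lead_coeff_Q degree_Q by (simp add: coeff_eq_0)
  moreover have "coeff (\<Sum>h\<in>H. smult (d h) (L h)) (Suc (card H)) = 0" using s by (intro coeff_eq_0) simp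
  ultimately show "coeff W (Suc (card H)) = 1/2" unfolding W_def by simp
qed

text \<open>Only \<open>p * W\<close> can reach the degree \<open>n + Suc (card H)\<close>; the
  other two terms stay at least one lower. The factor 1/2 is the leading coefficient of
  \<open>W\<close>, which comes from the quadratic exponent of the Gaussian transform.\<close>

lemma row_poly_degree_step:
  assumes "degree p \<le> n"
  shows "degree (pderiv p * Q - smult c (p * pderiv Q) + p * W) \<le> n + Suc (card H)"
    and "coeff (pderiv p * Q - smult c (p * pderiv Q) + p * W) (n + Suc (card H)) = coeff p n / 2"
proof -
  have 1: "degree (pderiv p * Q - smult c (p * pderiv Q)) \<le> n + card H"
  proof (rule degree_diff_le)
    show "degree (pderiv p * Q) \<le> n + card H"
      using degree_mult_le[of "pderiv p" Q] degree_pderiv[of p] assms degree_Q by linarith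
    show "degree (smult c (p * pderiv Q)) \<le> n + card H"
      using degree_smult_le[of c "p * pderiv Q"] degree_mult_le[of p "pderiv Q"] degree_pderiv[of Q] assms degree_Q
      by linarith
  qed
  have 2: "degree (p * W) \<le> n + Suc (card H)"
    using degree_mult_le[of p W] W_degree(1) assms by linarith
  show "degree (pderiv p * Q - smult c (p * pderiv Q) + p * W) \<le> n + Suc (card H)"
    using 1 2 by (intro degree_add_le) auto
  have "coeff (pderiv p * Q - smult c (p * pderiv Q)) (n + Suc (card H)) = 0"
    using 1 by (intro coeff_eq_0) simp
  moreover have "coeff (p * W) (n + Suc (card H)) = coeff p n * coeff W (Suc (card H))"
  proof -
    have "coeff (p * W) (n + Suc (card H)) = (\<Sum>i\<le>n + Suc (card H). coeff p i * coeff W (n + Suc (card H) - i))"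
      by (simp add: coeff_mult)
    also have "\<dots> = (\<Sum>i\<in>{n}. coeff p i * coeff W (n + Suc (card H) - i))"
    proof (rule sum.mono_neutral_right, goal_cases)
      case 3
      have "coeff p i * coeff W (n + Suc (card H) - i) = 0" if "i \<noteq> n" for i
      proof (cases "i < n")
        case True
        then have "degree W < n + Suc (card H) - i" using W_degree(1) by linarith
        then show ?thesis by (simp add: coeff_eq_0)
      next
        case False
        then show ?thesis using that assms by (simp add: coeff_eq_0)
      qed
      then show ?case by simp
    qed auto
    finally show ?thesis by simp
  qed
  ultimately show "coeff (pderiv p * Q - smult c (p * pderiv Q) + p * W) (n + Suc (card H)) = coeff p n / 2"
    using W_degree(2) by simp
qed

text \<open>The last row starts from \<open>Q\<close> itself, one degree above the other rows. Every
  recursion step raises both bounds by \<open>card H + 1\<close>, so the gap of one persists, and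
  the nonzero leading coefficient shows that for \<open>None\<close> the degree is attained.\<close>

lemma degree_P_None:
  "degree (P None k) \<le> card H * Suc k + k \<and> coeff (P None k) (card H * Suc k + k) = (1/2) ^ k"
proof (induction k)
  case 0
  then show ?case using degree_Q lead_coeff_Q by (simp add: P_def)
next
  case (Suc k)
  have "card H * Suc (Suc k) + Suc k = (card H * Suc k + k) + Suc (card H)" by simp
  then show ?case using row_poly_degree_step[of "P None k"] Suc
    unfolding P_def by (simp only: row_poly.simps) (simp del: of_nat_Suc mult_Suc_right)
qed

lemma degree_P_Some:
  assumes "h \<in> H"
  shows "degree (P (Some h) k) + 1 \<le> card H * Suc k + k"
proof (induction k)
  case 0
  then show ?case using degree_L[OF assms] degree_smult_le[of "\<rho> h" "L h"] by (simp add: P_def)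
next
  case (Suc k)
  have "degree (P (Some h) (Suc k)) \<le> (card H * Suc k + k - 1) + Suc (card H)"
    using row_poly_degree_step(1)[of "P (Some h) k" "card H * Suc k + k - 1"] Suc
    unfolding P_def by (simp only: row_poly.simps)
  then show ?case using Suc by simp
qed

lemma degree_scaled_P:
  assumes "j \<in> insert None (Some ` H)" "k < M"
  shows "degree (Q ^ (M - Suc k) * P j k) + (if j = None then 0 else 1) \<le> card H * M + k"
proof -
  have "degree (Q ^ (M - Suc k) * P j k) \<le> card H * (M - Suc k) + degree (P j k)"
    using degree_mult_le[of "Q ^ (M - Suc k)" "P j k"] degree_power_le[of Q "M - Suc k"] degree_Q by simp
  moreover have "degree (P j k) + (if j = None then 0 else 1) \<le> card H * Suc k + k"
    using degree_P_None[of k] degree_P_Some[of _ k] assms(1) by auto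
  moreover have "card H * (M - Suc k) + card H * Suc k = card H * M"
    using assms(2) by (simp add: distrib_left[symmetric] del: mult_Suc_right)
  ultimately show ?thesis by linarith
qed

text \<open>The top order \<open>M\<close> is peeled off. At the pole \<open>- \<rho> h\<close>
  every term with a positive power of \<open>Q\<close> vanishes, and among the terms of order
  \<open>M\<close> only the row \<open>Some h\<close> survives; the top degree is reached by the row
  \<open>None\<close> alone. With these coefficients gone, one factor \<open>Q\<close> cancels and
  the induction applies.\<close>

lemma rows_independent:
  assumes "(\<Sum>j\<in>insert None (Some ` H). \<Sum>k<M. smult (b j k) (Q ^ (M - Suc k) * P j k)) = 0"
  shows "\<forall>j\<in>insert None (Some ` H). \<forall>k<M. b j k = 0"
  using assms
proof (induction M)
  case (Suc M)
  let ?J = "insert None (Some ` H)"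
  let ?t = "\<lambda>M j k. smult (b j k) (Q ^ (M - Suc k) * P j k)"
  have finJ: "finite ?J" using fin by simp
  have top_Some: "b (Some h) M = 0" if h: "h \<in> H" for h
  proof -
    have Q0: "poly Q (- \<rho> h) = 0" using h by (simp add: Q_eq_L)
    have "0 = poly (\<Sum>j\<in>?J. \<Sum>k<Suc M. ?t (Suc M) j k) (- \<rho> h)" using Suc.prems by simp
    also have "\<dots> = (\<Sum>j\<in>?J. b j M * poly (P j M) (- \<rho> h))"
    proof -
      have "(\<Sum>k<M. b j k * (0 ^ (M - k) * poly (P j k) (- \<rho> h))) = 0" for j
        by (intro sum.neutral) auto
      then show ?thesis using Q0 by (simp add: poly_sum)
    qed
    also have "\<dots> = (\<Sum>j\<in>?J. if j = Some h then b j M * poly (P j M) (- \<rho> h) else 0)"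
      using poly_P_pole(2)[OF h] by (intro sum.cong) auto
    also have "\<dots> = b (Some h) M * poly (P (Some h) M) (- \<rho> h)" using finJ h by simp
    finally show ?thesis using poly_P_pole(1)[OF h] by simp
  qed
  let ?n = "card H * Suc M + M"
  have "b None M = 0"
  proof -
    have z: "coeff (?t (Suc M) j k) ?n = 0" if "j \<in> ?J" "k < Suc M" "j \<noteq> None \<or> k \<noteq> M" for j k
    proof -
      have "degree (Q ^ (Suc M - Suc k) * P j k) < ?n" using degree_scaled_P[OF that(1,2)] that(2,3) by (auto split: if_splits)
      then show ?thesis by (simp add: coeff_eq_0 del: mult_Suc_right)
    qed
    have "0 = coeff (\<Sum>j\<in>?J. \<Sum>k<Suc M. ?t (Suc M) j k) ?n" using Suc.prems by simp
    also have "\<dots> = (\<Sum>j\<in>?J. \<Sum>k<Suc M. coeff (?t (Suc M) j k) ?n)" by (simp only: coeff_sum)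
    also have "\<dots> = (\<Sum>j\<in>?J. \<Sum>k<Suc M. if j = None \<and> k = M then b None M * (1/2) ^ M else 0)"
    proof (intro sum.cong refl)
      fix j k assume "j \<in> ?J" "k \<in> {..<Suc M}"
      then show "coeff (?t (Suc M) j k) ?n = (if j = None \<and> k = M then b None M * (1/2) ^ M else 0)"
        using z[of j k] degree_P_None[of M] by (cases "j = None \<and> k = M") auto
    qed
    also have "\<dots> = (\<Sum>j\<in>?J. if j = None then b None M * (1/2) ^ M else 0)"
      by (intro sum.cong) auto
    also have "\<dots> = b None M * (1/2) ^ M" using finJ by simp
    finally show ?thesis by simp
  qed
  with top_Some have top: "b j M = 0" if "j \<in> ?J" for j using that by auto
  have "0 = (\<Sum>j\<in>?J. \<Sum>k<Suc M. ?t (Suc M) j k)" using Suc.prems by simp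
  also have "\<dots> = (\<Sum>j\<in>?J. \<Sum>k<M. ?t (Suc M) j k)"
  proof (rule sum.cong[OF refl])
    fix j assume "j \<in> ?J"
    then show "(\<Sum>k<Suc M. ?t (Suc M) j k) = (\<Sum>k<M. ?t (Suc M) j k)" using top[of j] by simp
  qed
  also have "\<dots> = (\<Sum>j\<in>?J. \<Sum>k<M. Q * ?t M j k)"
  proof (intro sum.cong refl)
    fix j k assume "k \<in> {..<M}"
    then have "Suc M - Suc k = Suc (M - Suc k)" by auto
    then show "?t (Suc M) j k = Q * ?t M j k" by (simp add: mult.assoc)
  qed
  also have "\<dots> = Q * (\<Sum>j\<in>?J. \<Sum>k<M. ?t M j k)" by (simp only: sum_distrib_left)
  finally have "(\<Sum>j\<in>?J. \<Sum>k<M. ?t M j k) = 0" using lead_coeff_Q by auto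
  then have "\<forall>j\<in>?J. \<forall>k<M. b j k = 0" by (rule Suc.IH)
  then show ?case using top by (auto simp: less_Suc_eq)
qed simp

text \<open>Rows are relabelled as in \<open>P\<close>; rows with index zero contribute nothing, and
  padding every inner sum to length \<open>M\<close> prepares for the common denominator
  \<open>Q ^ M\<close>.\<close>

lemma sum_coeff_index_rows:
  assumes H: "H = {h \<in> {1..r}. lam h > 0}" and M: "\<And>j. j \<in> {1..Suc r} \<Longrightarrow> lam j \<le> M"
  defines "nm \<equiv> \<lambda>j. case j of None \<Rightarrow> Suc r | Some h \<Rightarrow> h"
  shows "(\<Sum>c\<in>coeff_index (Suc r) lam. f c) =
    (\<Sum>j\<in>insert None (Some ` H). \<Sum>k<M. if k < lam (nm j) then f (nm j, k) else (0::real))"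
proof -
  let ?J = "insert None (Some ` H)"
  have nm: "inj_on nm ?J" "nm ` ?J = insert (Suc r) H" using H by (auto simp: inj_on_def nm_def image_image)
  have "(\<Sum>c\<in>coeff_index (Suc r) lam. f c) = (\<Sum>i\<in>{1..Suc r}. \<Sum>k<lam i. f (i, k))"
    unfolding coeff_index_def by (subst sum.Sigma) auto
  also have "\<dots> = (\<Sum>i\<in>insert (Suc r) H. \<Sum>k<lam i. f (i, k))"
    by (rule sum.mono_neutral_right) (auto simp: H not_less_eq_eq intro!: gr0I)
  also have "\<dots> = (\<Sum>i\<in>nm ` ?J. \<Sum>k<lam i. f (i, k))" by (simp only: nm(2))
  also have "\<dots> = (\<Sum>j\<in>?J. \<Sum>k<lam (nm j). f (nm j, k))"
    using sum.reindex[OF nm(1), of "\<lambda>i. \<Sum>k<lam i. f (i, k)"] by (simp only: o_def)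
  also have "\<dots> = (\<Sum>j\<in>?J. \<Sum>k<M. if k < lam (nm j) then f (nm j, k) else 0)"
  proof (rule sum.cong[OF refl])
    fix j assume "j \<in> ?J"
    then have "lam (nm j) \<le> M" using H by (intro M) (auto simp: nm_def)
    then show "(\<Sum>k<lam (nm j). f (nm j, k)) = (\<Sum>k<M. if k < lam (nm j) then f (nm j, k) else 0)"
      by (intro sum.mono_neutral_cong_left) auto
  qed
  finally show ?thesis .
qed

text \<open>The count: the nodes contribute \<open>sum lam {1..Suc r}\<close> zeros, and each row of
  \<open>H\<close> with index \<open>M - 1\<close> contributes one more at
  \<open>- \<rho> h\<close>. This fills every such index up to \<open>M\<close>, which gives at
  least \<open>card H * M + lam (Suc r)\<close> zeros for a polynomial of degree less than that
  number.\<close>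

lemma square_system_trivial:
  fixes \<mu> :: "nat \<Rightarrow> nat \<Rightarrow> real \<Rightarrow> real" and b :: "nat \<times> nat \<Rightarrow> real" and p r :: nat
  assumes H: "H = {h \<in> {1..r}. lam h > 0}" and adm: "laguerre_admissible (Suc r) lam"
    and card: "sum m {1..p} = sum lam {1..Suc r}"
    and \<xi>: "inj_on \<xi> {1..p}" "\<And>i. i \<in> {1..p} \<Longrightarrow> \<xi> i \<in> D"
    and D: "open D" "\<And>h z. h \<in> {1..r} \<Longrightarrow> z \<in> D \<Longrightarrow> \<rho> h + z > 0"
    and \<mu>: "\<And>j k z. j \<in> {1..Suc r} \<Longrightarrow> z \<in> D \<Longrightarrow> (\<mu> j k has_field_derivative \<mu> j (Suc k) z) (at z)"
    and \<mu>0: "\<And>h z. h \<in> {1..r} \<Longrightarrow> z \<in> D \<Longrightarrow> \<mu> h 0 z = G z * (\<rho> h / (\<rho> h + z))"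
      "\<And>z. z \<in> D \<Longrightarrow> \<mu> (Suc r) 0 z = G z"
    and G: "\<And>z. z \<in> D \<Longrightarrow> G z \<noteq> 0"
      "\<And>z. z \<in> D \<Longrightarrow> (G has_field_derivative G z * (a + z / 2 - (\<Sum>h=1..r. d h / (\<rho> h + z)))) (at z)"
    and eq: "\<And>i l. i \<in> {1..p} \<Longrightarrow> l < m i \<Longrightarrow>
      (\<Sum>c\<in>coeff_index (Suc r) lam. b c * \<mu> (fst c) (snd c + l) (\<xi> i)) = 0"
  shows "\<forall>c\<in>coeff_index (Suc r) lam. b c = 0"
proof -
  let ?J = "insert None (Some ` H)"
  define nm where "nm j = (case j of None \<Rightarrow> Suc r | Some h \<Rightarrow> h)" for j
  define M where "M = Max (lam ` {1..Suc r})"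
  have lamM: "lam j \<le> M" "M \<le> lam j + 1" if "j \<in> {1..Suc r}" for j
  proof -
    show "lam j \<le> M" using that unfolding M_def by (intro Max_ge) auto
    have "M \<in> lam ` {1..Suc r}" unfolding M_def by (intro Max_in) auto
    then show "M \<le> lam j + 1" using adm that by (auto simp: laguerre_admissible_def)
  qed
  have nmJ: "nm j \<in> {1..Suc r}" if "j \<in> ?J" for j using that H by (auto simp: nm_def)
  define b' where "b' j k = (if k < lam (nm j) then b (nm j, k) else 0)" for j k
  define S where "S = (\<Sum>j\<in>?J. \<Sum>k<M. smult (b' j k) (Q ^ (M - Suc k) * P j k))"
  define \<Phi> where "\<Phi> l z = (\<Sum>c\<in>coeff_index (Suc r) lam. b c * \<mu> (fst c) (snd c + l) z)" for l z
  have Qz: "poly Q z \<noteq> 0" if "z \<in> D" for z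
    using D(2)[OF _ that] H by (force simp: Q_def poly_prod fin)
  have QL: "poly (L h) z = poly Q z / (\<rho> h + z)" if "z \<in> D" "h \<in> H" for z h
    using D(2)[of h z] that H by (simp add: Q_eq_L[OF that(2)] field_simps)
  have row: "\<mu> (nm j) k z = G z * poly (P j k) z / poly Q z ^ Suc k"
    if j: "j \<in> ?J" and k: "k < lam (nm j)" and z: "z \<in> D" for j k z
  \<comment> \<open>The quotient form of the \<open>k\<close>-th derivative requires the logarithmic
    derivative of \<open>G\<close> to have denominator \<open>Q\<close>, so all indices must lie in
    \<open>H\<close>. If some row index is zero, admissibility makes every row index at most one;
    then only \<open>k = 0\<close> occurs and no derivative is taken.\<close>
  proof (cases "H = {1..r}")
    case True
    show ?thesis unfolding P_def
    proof (rule row_poly_derivative[of D "\<mu> (nm j)"])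
      fix z assume z: "z \<in> D"
      have "poly W z / poly Q z = a + z / 2 - (\<Sum>h=1..r. d h / (\<rho> h + z))"
      proof -
        have "poly W z = (a + z / 2) * poly Q z - (\<Sum>h\<in>H. d h * (poly Q z / (\<rho> h + z)))"
          unfolding W_def using QL[OF z] by (simp add: poly_sum distrib_right)
        moreover have "(\<Sum>h\<in>H. d h * (poly Q z / (\<rho> h + z))) = (\<Sum>h\<in>H. d h / (\<rho> h + z)) * poly Q z"
          by (simp add: sum_distrib_right)
        ultimately have "poly W z = (a + z / 2 - (\<Sum>h\<in>H. d h / (\<rho> h + z))) * poly Q z"
          by (simp only: left_diff_distrib)
        then show ?thesis using Qz[OF z] True by simp
      qed
      then show "(G has_field_derivative G z * (poly W z / poly Q z)) (at z)" using G(2)[OF z] by simp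
      show "\<mu> (nm j) 0 z = G z * poly (case j of None \<Rightarrow> Q | Some h \<Rightarrow> smult (\<rho> h) (L h)) z / poly Q z"
        using j \<mu>0(1)[OF _ z] \<mu>0(2)[OF z] Qz[OF z] QL[OF z] True by (auto simp: nm_def)
    qed (use D \<mu>[OF nmJ[OF j]] z Qz in auto)
  next
    case False
    then have "\<exists>h\<in>{1..r}. \<not> lam h > 0" using H by blast
    then obtain h where "h \<in> {1..r}" "lam h = 0" by auto
    then have "k = 0" using lamM(2)[of h] lamM(1)[OF nmJ[OF j]] k by auto
    moreover have "\<mu> (nm j) 0 z = G z * poly (case j of None \<Rightarrow> Q | Some h \<Rightarrow> smult (\<rho> h) (L h)) z / poly Q z"
      using j \<mu>0(1)[OF _ z] \<mu>0(2)[OF z] Qz[OF z] QL[OF z] H by (auto simp: nm_def)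
    ultimately show ?thesis by (simp add: P_def)
  qed
  have S\<Phi>: "poly S z = \<Phi> 0 z * (poly Q z ^ M / G z)" if z: "z \<in> D" for z
  proof -
    have "\<Phi> 0 z = (\<Sum>j\<in>?J. \<Sum>k<M. if k < lam (nm j) then b (nm j, k) * \<mu> (nm j) k z else 0)"
      using sum_coeff_index_rows[OF H lamM(1), of "\<lambda>c. b c * \<mu> (fst c) (snd c + 0) z"]
      unfolding \<Phi>_def nm_def by (simp only: fst_conv snd_conv add_0_right cong: if_cong)
    then have "\<Phi> 0 z * (poly Q z ^ M / G z) =
      (\<Sum>j\<in>?J. \<Sum>k<M. (if k < lam (nm j) then b (nm j, k) * \<mu> (nm j) k z else 0) * (poly Q z ^ M / G z))"
      by (simp only: sum_distrib_right)
    also have "\<dots> = (\<Sum>j\<in>?J. \<Sum>k<M. b' j k * (poly Q z ^ (M - Suc k) * poly (P j k) z))"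
    proof (intro sum.cong refl)
      fix j k assume jk: "j \<in> ?J" "k \<in> {..<M}"
      have "poly Q z ^ M = poly Q z ^ (M - Suc k) * poly Q z ^ Suc k"
        using jk by (subst power_add[symmetric]) simp
      then show "(if k < lam (nm j) then b (nm j, k) * \<mu> (nm j) k z else 0) * (poly Q z ^ M / G z) =
          b' j k * (poly Q z ^ (M - Suc k) * poly (P j k) z)"
        using row[OF jk(1) _ z, of k] Qz[OF z] G(1)[OF z] by (simp add: b'_def del: power_Suc)
    qed
    finally show ?thesis by (simp add: S_def poly_sum)
  qed
  have root\<xi>: "[:- \<xi> i, 1:] ^ m i dvd S" if i: "i \<in> {1..p}" for i
  proof (rule root_multiplicity_from_derivatives[OF D(1) \<xi>(2)[OF i], of \<Phi>])
    show "(\<Phi> k has_field_derivative \<Phi> (Suc k) z) (at z)" if "z \<in> D" for k z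
      unfolding \<Phi>_def
    proof (rule DERIV_sum)
      fix c assume "c \<in> coeff_index (Suc r) lam"
      then have "fst c \<in> {1..Suc r}" by (auto simp: coeff_index_def)
      from DERIV_cmult[OF \<mu>[OF this that], of "b c" "snd c + k"]
      show "((\<lambda>z. b c * \<mu> (fst c) (snd c + k) z) has_field_derivative b c * \<mu> (fst c) (snd c + Suc k) z) (at z)"
        by simp
    qed
    show "\<Phi> k (\<xi> i) = 0" if "k < m i" for k using eq[OF i that] by (simp add: \<Phi>_def)
    show "poly S z = \<Phi> 0 z * (poly Q z ^ M / G z)" if "z \<in> D" for z by (rule S\<Phi>[OF that])
    show "isCont (\<lambda>z. poly Q z ^ M / G z) (\<xi> i)"
      using G(1)[OF \<xi>(2)[OF i]] DERIV_isCont[OF G(2)[OF \<xi>(2)[OF i]]] by (intro continuous_intros) auto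
  qed
  define H' where "H' = {h \<in> H. lam h < M}"
  \<comment> \<open>Terms with \<open>Suc k < M\<close> contain a power of \<open>Q\<close>. In the
    top order the row \<open>Some h\<close> is absent because \<open>lam h < M\<close>, and all
    other rows vanish at this pole.\<close>
  have root\<rho>: "[:\<rho> h, 1:] ^ 1 dvd S" if h: "h \<in> H'" for h
  proof -
    have hH: "h \<in> H" "lam h < M" using h by (auto simp: H'_def)
    have Q0: "poly Q (- \<rho> h) = 0" using hH by (simp add: Q_eq_L)
    have "b' j k * (poly Q (- \<rho> h) ^ (M - Suc k) * poly (P j k) (- \<rho> h)) = 0" if jk: "j \<in> ?J" "k < M" for j k
    proof (cases "Suc k = M \<and> j \<noteq> Some h")
      case True
      then show ?thesis using poly_P_pole(2)[OF hH(1) jk(1)] by simp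
    next
      case False
      then have "Suc k < M \<or> (j = Some h \<and> lam h \<le> k)" using jk hH by auto
      then show ?thesis using Q0 by (auto simp: b'_def nm_def)
    qed
    then have "poly S (- \<rho> h) = 0" unfolding S_def poly_sum poly_smult poly_mult poly_power
      by (intro sum.neutral ballI) auto
    then show ?thesis using poly_eq_0_iff_dvd[of S "- \<rho> h"] by simp
  qed
  have "S = 0"
  proof (rule ccontr)
    assume S0: "S \<noteq> 0"
    let ?x = "case_sum (\<lambda>h. - \<rho> h) \<xi>" and ?n = "case_sum (\<lambda>h. 1) m"
    have H': "finite H'" "H' \<subseteq> H" using fin by (auto simp: H'_def)
    have "sum ?n (H' <+> {1..p}) \<le> degree S"
    proof (rule sum_root_multiplicities_le_degree[OF _ S0])
      \<comment> \<open>The two families of zeros do not collide, because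
        \<open>\<rho> h + \<xi> i > 0\<close>; the disjoint sum of index sets then carries one
        family of distinct points.\<close>
      have ne: "- \<rho> h \<noteq> \<xi> i" "\<xi> i \<noteq> - \<rho> h" if "h \<in> H'" "i \<in> {1..p}" for h i
        using D(2)[OF _ \<xi>(2)[OF that(2)], of h] that H' H by auto
      show "inj_on ?x (H' <+> {1..p})"
      proof (rule inj_onI)
        fix u v assume "u \<in> H' <+> {1..p}" "v \<in> H' <+> {1..p}" "?x u = ?x v"
        then show "u = v"
          using ne inj_onD[OF \<xi>(1)] inj_onD[OF inj_on_subset[OF inj H'(2)]]
          by (elim PlusE) (simp_all del: atLeastAtMost_iff)
      qed
    qed (use H' root\<rho> root\<xi> in \<open>auto simp: Plus_def\<close>)
    then have "card H' + sum lam {1..Suc r} \<le> degree S"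
      using H' card by (simp add: sum.Plus o_def)
    moreover have "sum lam {1..Suc r} = sum lam H + lam (Suc r)"
    proof -
      have "sum lam {1..r} = sum lam H" by (rule sum.mono_neutral_right) (auto simp: H)
      then show ?thesis by simp
    qed
    moreover have "card H' + sum lam H = card H * M"
    proof -
      have "card H' = (\<Sum>h\<in>H. if lam h < M then 1 else 0)"
        using fin by (simp add: H'_def sum.If_cases Int_def)
      then have "card H' + sum lam H = (\<Sum>h\<in>H. (if lam h < M then 1 else 0) + lam h)"
        by (simp add: sum.distrib)
      also have "\<dots> = (\<Sum>h\<in>H. M)"
      proof (intro sum.cong refl)
        fix h assume "h \<in> H"
        then have "h \<in> {1..Suc r}" using H by auto
        then show "(if lam h < M then 1 else 0) + lam h = M" using lamM[of h] by auto
      qed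
      finally show ?thesis by simp
    qed
    ultimately have low: "card H * M + lam (Suc r) \<le> degree S" by linarith
    \<comment> \<open>This excludes truncated subtraction in the degree bound below: if the number
      were zero, all coefficients in \<open>S\<close> would vanish.\<close>
    have N0: "card H * M + lam (Suc r) > 0"
    proof (rule ccontr)
      assume "\<not> ?thesis"
      then have "M = 0 \<or> H = {}" "lam (Suc r) = 0" using fin by auto
      then have "b' j k = 0" if "j \<in> ?J" "k < M" for j k
        using that H by (auto simp: b'_def nm_def)
      then show False using S0 unfolding S_def by simp
    qed
    \<comment> \<open>For \<open>None\<close> the order satisfies \<open>k < lam (Suc r)\<close>.
      For the other rows only \<open>k \<le> lam (Suc r)\<close> is known, and the missing unit is
      the degree gap between them and \<open>None\<close>.\<close>
    have "degree S \<le> card H * M + lam (Suc r) - 1" unfolding S_def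
    proof (intro degree_sum_le finite_insert[THEN iffD2] finite_imageI fin finite_lessThan)
      fix j k assume jk: "j \<in> ?J" "k \<in> {..<M}"
      show "degree (smult (b' j k) (Q ^ (M - Suc k) * P j k)) \<le> card H * M + lam (Suc r) - 1"
      proof (cases "b' j k = 0")
        case False
        have "k \<le> lam (Suc r)" using jk(2) lamM(2)[of "Suc r"] by auto
        moreover have "k < lam (Suc r)" if "j = None" using False that by (auto simp: b'_def nm_def split: if_splits)
        ultimately show ?thesis
          using degree_scaled_P[OF jk(1), of k M] jk(2) degree_smult_le[of "b' j k" "Q ^ (M - Suc k) * P j k"]
          by (auto split: if_splits)
      qed simp
    qed
    then show False using low N0 by linarith
  qed
  then have "\<forall>j\<in>?J. \<forall>k<M. b' j k = 0" unfolding S_def by (rule rows_independent)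
  moreover have "(\<Sum>c\<in>coeff_index (Suc r) lam. \<bar>b c\<bar>) =
      (\<Sum>j\<in>?J. \<Sum>k<M. if k < lam (nm j) then \<bar>b (nm j, k)\<bar> else 0)"
    unfolding nm_def using lamM by (intro sum_coeff_index_rows H) auto
  ultimately have "(\<Sum>c\<in>coeff_index (Suc r) lam. \<bar>b c\<bar>) = 0"
    by (simp add: b'_def cong: if_cong) (auto intro!: sum.neutral split: if_splits)
  then show ?thesis by (subst (asm) sum_nonneg_eq_0_iff) auto
qed

end

subsection \<open>Exponential moments\<close>

lemma power_le_exp_abs:
  fixes t :: real
  assumes "\<delta> > 0"
  shows "\<bar>t\<bar> ^ v \<le> fact v / \<delta> ^ v * (exp (\<delta> * t) + exp (- \<delta> * t))"
proof -
  have "(\<Sum>n\<in>{v}. (\<delta> * \<bar>t\<bar>) ^ n /\<^sub>R fact n) \<le> (\<Sum>n. (\<delta> * \<bar>t\<bar>) ^ n /\<^sub>R fact n)"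
    using assms by (intro sum_le_suminf summable_exp_generic) auto
  then have "(\<delta> * \<bar>t\<bar>) ^ v / fact v \<le> exp (\<delta> * \<bar>t\<bar>)" by (simp add: exp_def divide_inverse mult.commute)
  also have "exp (\<delta> * \<bar>t\<bar>) \<le> exp (\<delta> * t) + exp (- \<delta> * t)" by (cases "t \<ge> 0") auto
  finally show ?thesis using assms by (simp add: power_mult_distrib field_simps)
qed

text \<open>The domain is open, so \<open>z\<close> can be moved by some \<delta> in both
  directions; the power of \<open>t\<close> is paid for by the two exponentials with exponents
  \<open>z + \<delta>\<close> and \<open>z - \<delta>\<close>.\<close>

lemma integrable_moments_exp:
  fixes U :: "real \<Rightarrow> real"
  assumes [measurable]: "U \<in> borel_measurable borel" and "open D" "z \<in> D"
    and int: "\<And>z. z \<in> D \<Longrightarrow> integrable lborel (\<lambda>t. U t * exp (z * t))"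
  shows "integrable lborel (\<lambda>t. t ^ v * U t * exp (z * t))"
proof -
  obtain \<delta> where \<delta>: "\<delta> > 0" "cball z \<delta> \<subseteq> D" using assms open_contains_cball by blast
  then have D: "z + \<delta> \<in> D" "z - \<delta> \<in> D" by (auto simp: dist_real_def)
  define C where "C = fact v / \<delta> ^ v"
  show ?thesis
  proof (rule Bochner_Integration.integrable_bound)
    show "integrable lborel (\<lambda>t. C * (U t * exp ((z + \<delta>) * t) + U t * exp ((z - \<delta>) * t)))"
      by (intro integrable_mult_right Bochner_Integration.integrable_add int D)
    show "AE t in lborel. norm (t ^ v * U t * exp (z * t)) \<le>
        norm (C * (U t * exp ((z + \<delta>) * t) + U t * exp ((z - \<delta>) * t)))"
    proof (intro AE_I2)
      fix t :: real
      have "norm (t ^ v * U t * exp (z * t)) = \<bar>t\<bar> ^ v * (\<bar>U t\<bar> * exp (z * t))"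
        by (simp add: abs_mult power_abs)
      also have "\<dots> \<le> (C * (exp (\<delta> * t) + exp (- \<delta> * t))) * (\<bar>U t\<bar> * exp (z * t))"
        unfolding C_def by (intro mult_right_mono power_le_exp_abs \<delta>) auto
      also have "\<dots> = C * \<bar>U t\<bar> * (exp ((z + \<delta>) * t) + exp ((z - \<delta>) * t))"
        by (simp add: algebra_simps exp_add[symmetric])
      also have "\<dots> = norm (C * (U t * exp ((z + \<delta>) * t) + U t * exp ((z - \<delta>) * t)))"
        using \<delta> by (simp add: abs_mult C_def distrib_left[symmetric])
      finally show "norm (t ^ v * U t * exp (z * t)) \<le> \<dots>" .
    qed
  qed measurable
qed

lemma exp_taylor2: "\<bar>exp (x::real) - 1 - x\<bar> \<le> x\<^sup>2 * exp \<bar>x\<bar>"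
proof -
  obtain s where s: "\<bar>s\<bar> \<le> \<bar>x\<bar>" "exp x = (\<Sum>m<2. x ^ m / fact m) + exp s / fact 2 * x ^ 2"
    using Maclaurin_exp_le[of x 2] by blast
  have "exp s \<le> exp \<bar>x\<bar>" using s(1) by simp
  then have "exp s / 2 \<le> exp \<bar>x\<bar>" using exp_gt_zero[of s] by linarith
  have "\<bar>exp x - 1 - x\<bar> = exp s / 2 * x ^ 2" using s(2) by (simp add: numeral_2_eq_2 abs_mult)
  also have "\<dots> \<le> exp \<bar>x\<bar> * x ^ 2" using \<open>exp s / 2 \<le> exp \<bar>x\<bar>\<close> by (rule mult_right_mono) simp
  finally show ?thesis by (simp add: mult.commute)
qed

text \<open>The increment is compared with its linear part by an explicit remainder
  \<open>K * h\<^sup>2\<close>, where \<open>K\<close> is the integral of a fixed function with two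
  additional powers of \<open>t\<close> and exponents \<open>z + \<delta>\<close> and
  \<open>z - \<delta>\<close>.\<close>

lemma exp_moment_derivative:
  fixes U :: "real \<Rightarrow> real"
  assumes [measurable]: "U \<in> borel_measurable borel" and "open D" "z \<in> D"
    and int: "\<And>z. z \<in> D \<Longrightarrow> integrable lborel (\<lambda>t. U t * exp (z * t))"
  shows "((\<lambda>z. LBINT t. t ^ v * U t * exp (z * t)) has_field_derivative
           (LBINT t. t ^ Suc v * U t * exp (z * t))) (at z)"
proof -
  note I = integrable_moments_exp[OF assms(1,2) _ int]
  obtain \<delta> where \<delta>: "\<delta> > 0" "cball z \<delta> \<subseteq> D" using assms open_contains_cball by blast
  have D: "z + h \<in> D" if "\<bar>h\<bar> \<le> \<delta>" for h using \<delta> that by (auto simp: dist_real_def subset_iff)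
  define m where "m v z = (LBINT t. t ^ v * U t * exp (z * t))" for v z
  define g where "g t = \<bar>t ^ (v + 2) * U t * exp ((z + \<delta>) * t)\<bar> + \<bar>t ^ (v + 2) * U t * exp ((z - \<delta>) * t)\<bar>" for t
  have gi: "integrable lborel g" unfolding g_def
    using D[of \<delta>] D[of "- \<delta>"] \<delta> by (intro Bochner_Integration.integrable_add integrable_abs I) auto
  define K where "K = (LBINT t. g t)"
  have key: "\<bar>m v (z + h) - m v z - h * m (Suc v) z\<bar> \<le> K * h\<^sup>2" if h: "\<bar>h\<bar> \<le> \<delta>" for h
  proof -
    let ?f = "\<lambda>t. t ^ v * U t * exp ((z + h) * t) - t ^ v * U t * exp (z * t) - h * (t ^ Suc v * U t * exp (z * t))"
    have fi: "integrable lborel ?f"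
      using D[OF h] assms(3) by (intro Bochner_Integration.integrable_diff integrable_mult_right I)
    have eq: "m v (z + h) - m v z - h * m (Suc v) z = (LBINT t. ?f t)"
      unfolding m_def using I[OF D[OF h], of v] I[OF assms(3), of v] I[OF assms(3), of "Suc v"]
      by (simp del: power_Suc)
    have "\<bar>m v (z + h) - m v z - h * m (Suc v) z\<bar> \<le> (LBINT t. norm (?f t))" unfolding eq using integral_norm_bound[of lborel ?f] by simp
    also have "\<dots> \<le> (LBINT t. h\<^sup>2 * g t)"
    proof (rule integral_mono)
      show "integrable lborel (\<lambda>t. norm (?f t))" by (rule integrable_norm[OF fi])
      show "integrable lborel (\<lambda>t. h\<^sup>2 * g t)" by (rule integrable_mult_right[OF gi])
      fix t :: real
      have "norm (?f t) = \<bar>t ^ v * U t\<bar> * exp (z * t) * \<bar>exp (h * t) - 1 - h * t\<bar>"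
      proof -
        have "?f t = t ^ v * U t * exp (z * t) * (exp (h * t) - 1 - h * t)"
          by (simp add: algebra_simps exp_add)
        then show ?thesis by (simp add: abs_mult)
      qed
      also have "\<dots> \<le> \<bar>t ^ v * U t\<bar> * exp (z * t) * ((h * t)\<^sup>2 * (exp (\<delta> * t) + exp (- \<delta> * t)))"
      proof (intro mult_left_mono)
        have "\<bar>h * t\<bar> \<le> \<delta> * \<bar>t\<bar>" using h by (simp add: abs_mult mult_right_mono)
        then have "exp \<bar>h * t\<bar> \<le> exp (\<delta> * \<bar>t\<bar>)" by simp
        also have "\<dots> \<le> exp (\<delta> * t) + exp (- \<delta> * t)" by (cases "t \<ge> 0") auto
        finally have "(h * t)\<^sup>2 * exp \<bar>h * t\<bar> \<le> (h * t)\<^sup>2 * (exp (\<delta> * t) + exp (- \<delta> * t))"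
          by (intro mult_left_mono) auto
        then show "\<bar>exp (h * t) - 1 - h * t\<bar> \<le> (h * t)\<^sup>2 * (exp (\<delta> * t) + exp (- \<delta> * t))"
          using exp_taylor2[of "h * t"] by linarith
      qed auto
      also have "\<dots> = h\<^sup>2 * g t"
      proof -
        have "exp ((z + \<delta>) * t) = exp (z * t) * exp (\<delta> * t)" "exp ((z - \<delta>) * t) = exp (z * t) * exp (- \<delta> * t)"
          by (simp_all add: exp_add[symmetric] algebra_simps)
        moreover have abs2: "\<bar>t\<bar> * (\<bar>t\<bar> * x) = t * (t * x)" for x by (simp add: mult.assoc[symmetric])
        ultimately show ?thesis by (simp add: abs2 g_def abs_mult power_add power_mult_distrib algebra_simps power2_eq_square)
      qed
      finally show "norm (?f t) \<le> h\<^sup>2 * g t" .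
    qed
    finally show ?thesis by (simp add: K_def mult.commute)
  qed
  have "(\<lambda>h. (m v (z + h) - m v z) / h - m (Suc v) z) \<midarrow>0\<rightarrow> 0"
  proof (rule Lim_null_comparison)
    have "\<forall>\<^sub>F h in at 0. \<bar>h\<bar> < \<delta> \<and> h \<noteq> 0"
      unfolding eventually_at using \<delta> by (intro exI[of _ \<delta>]) auto
    then show "\<forall>\<^sub>F h in at 0. norm ((m v (z + h) - m v z) / h - m (Suc v) z) \<le> K * \<bar>h\<bar>"
    proof eventually_elim
      case (elim h)
      have "norm ((m v (z + h) - m v z) / h - m (Suc v) z) = \<bar>m v (z + h) - m v z - h * m (Suc v) z\<bar> / \<bar>h\<bar>"
      proof -
        have "(m v (z + h) - m v z) / h - m (Suc v) z = (m v (z + h) - m v z - h * m (Suc v) z) / h"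
          using elim by (simp add: diff_divide_distrib)
        then show ?thesis by (simp only: real_norm_def abs_divide)
      qed
      also have "\<dots> \<le> K * h\<^sup>2 / \<bar>h\<bar>" using elim key[of h] by (intro divide_right_mono) auto
      also have "\<dots> = K * \<bar>h\<bar>" using elim by (simp add: power2_eq_square abs_if)
      finally show ?case .
    qed
    have "((\<lambda>h::real. K * \<bar>h\<bar>) \<longlongrightarrow> K * \<bar>0\<bar>) (at 0)" by (intro tendsto_intros)
    then show "((\<lambda>h::real. K * \<bar>h\<bar>) \<longlongrightarrow> 0) (at 0)" by simp
  qed
  then have "(m v has_field_derivative m (Suc v) z) (at z)" unfolding DERIV_def by (simp add: LIM_zero_iff)
  then show ?thesis unfolding m_def .
qed

subsection \<open>Difference quotients of rational families\<close>

text \<open>Functions of \<open>(e, y)\<close> that are polynomial in \<open>e\<close>, \<open>y\<close> and certain reciprocals.  The class is closed under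
  the difference quotient \<open>(f e (y + e) - f e y) / e\<close>, which degenerates to \<open>\<partial>f/\<partial>y\<close> at \<open>e = 0\<close>.\<close>

inductive tame :: "real set \<Rightarrow> (real \<Rightarrow> real \<Rightarrow> real) \<Rightarrow> bool" for R where
  const: "tame R (\<lambda>e y. c)"
| eps: "tame R (\<lambda>e y. e)"
| var: "tame R (\<lambda>e y. y)"
| recip_rate: "\<rho> \<in> R \<Longrightarrow> k \<ge> 0 \<Longrightarrow> tame R (\<lambda>e y. 1 / (\<rho> + y + k * e))"
| recip_two: "k \<ge> 0 \<Longrightarrow> tame R (\<lambda>e y. 1 / (2 + y * e + k * e\<^sup>2))"
| add: "tame R f \<Longrightarrow> tame R g \<Longrightarrow> tame R (\<lambda>e y. f e y + g e y)"
| mult: "tame R f \<Longrightarrow> tame R g \<Longrightarrow> tame R (\<lambda>e y. f e y * g e y)"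

text \<open>In both families of reciprocals the shift replaces \<open>k\<close> by
  \<open>k + 1\<close>; in the second one \<open>y * e\<close> gains a square of \<open>e\<close>.
  The offset \<open>k\<close> is present in the generators for this reason.\<close>

lemma tame_shift: "tame R f \<Longrightarrow> tame R (\<lambda>e y. f e (y + e))"
proof (induction rule: tame.induct)
  case (recip_rate \<rho> k)
  then show ?case using tame.recip_rate[of \<rho> R "k + 1"] by (simp add: algebra_simps)
next
  case (recip_two k)
  then show ?case using tame.recip_two[of "k + 1" R] by (simp add: algebra_simps power2_eq_square)
qed (auto intro: tame.intros)

lemma tame_difference_quotient:
  assumes "tame R f"
  shows "\<exists>g. tame R g \<and>
    (\<forall>e y. e > 0 \<and> (\<forall>\<rho>\<in>R. \<rho> + y > 0) \<and> 2 + y * e > 0 \<longrightarrow> f e (y + e) = f e y + e * g e y) \<and>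
    (\<forall>y. (\<forall>\<rho>\<in>R. \<rho> + y > 0) \<longrightarrow> (f 0 has_field_derivative g 0 y) (at y))"
  using assms
proof (induction rule: tame.induct)
  case (const c)
  show ?case by (intro exI[of _ "\<lambda>e y. 0"]) (auto intro: tame.intros)
next
  case eps
  show ?case by (intro exI[of _ "\<lambda>e y. 0"]) (auto intro: tame.intros)
next
  case var
  show ?case by (intro exI[of _ "\<lambda>e y. 1"]) (auto intro: tame.intros)
next
  case (recip_rate \<rho> k)
  let ?g = "\<lambda>e y. (-1) * (1 / (\<rho> + y + k * e) * (1 / (\<rho> + y + (k + 1) * e)))"
  have "tame R ?g" using recip_rate by (intro tame.intros) auto
  moreover have "1 / (\<rho> + (y + e) + k * e) = 1 / (\<rho> + y + k * e) + e * ?g e y"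
    if "e > 0" "\<forall>\<rho>\<in>R. \<rho> + y > 0" for e y
  proof -
    define A where "A = \<rho> + y + k * e"
    have "\<rho> + y > 0" "k * e \<ge> 0" using recip_rate that by auto
    then have "A > 0" unfolding A_def by linarith
    then have "1 / (A + e) = 1 / A + e * ((-1) * (1 / A * (1 / (A + e))))"
      using that(1) add_pos_pos[of A e] by (simp add: divide_simps)
    then show ?thesis unfolding A_def by (simp add: algebra_simps)
  qed
  moreover have "((\<lambda>y. 1 / (\<rho> + y + k * 0)) has_field_derivative ?g 0 y) (at y)" if "\<forall>\<rho>\<in>R. \<rho> + y > 0" for y
    using that recip_rate(1) by (auto intro!: derivative_eq_intros simp: power2_eq_square)
  ultimately show ?case by (intro exI[of _ ?g]) blast
next
  case (recip_two k)
  let ?g = "\<lambda>e y. (-1) * (e * (1 / (2 + y * e + k * e\<^sup>2) * (1 / (2 + y * e + (k + 1) * e\<^sup>2))))"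
  have "tame R ?g" using recip_two by (intro tame.intros) auto
  moreover have "1 / (2 + (y + e) * e + k * e\<^sup>2) = 1 / (2 + y * e + k * e\<^sup>2) + e * ?g e y"
    if "e > 0" "2 + y * e > 0" for e y
  proof -
    define B where "B = 2 + y * e + k * e\<^sup>2"
    have "k * e\<^sup>2 \<ge> 0" using recip_two by simp
    then have "B > 0" unfolding B_def using that by linarith
    moreover have "B + e\<^sup>2 > 0" using calculation by (simp add: add_pos_nonneg)
    ultimately have "1 / (B + e\<^sup>2) = 1 / B + e * ((-1) * (e * (1 / B * (1 / (B + e\<^sup>2)))))"
      by (simp add: divide_simps power2_eq_square)
    then show ?thesis unfolding B_def by (simp add: algebra_simps power2_eq_square)
  qed
  moreover have "((\<lambda>y. 1 / (2 + y * 0 + k * 0\<^sup>2)) has_field_derivative ?g 0 y) (at y)" for y by simp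
  ultimately show ?case by (intro exI[of _ ?g]) blast
next
  case (add f1 f2)
  from add.IH(1) obtain g1 where g1: "tame R g1"
    "\<And>e y. e > 0 \<and> (\<forall>\<rho>\<in>R. \<rho> + y > 0) \<and> 2 + y * e > 0 \<Longrightarrow> f1 e (y + e) = f1 e y + e * g1 e y"
    "\<And>y. (\<forall>\<rho>\<in>R. \<rho> + y > 0) \<Longrightarrow> (f1 0 has_field_derivative g1 0 y) (at y)" by blast
  from add.IH(2) obtain g2 where g2: "tame R g2"
    "\<And>e y. e > 0 \<and> (\<forall>\<rho>\<in>R. \<rho> + y > 0) \<and> 2 + y * e > 0 \<Longrightarrow> f2 e (y + e) = f2 e y + e * g2 e y"
    "\<And>y. (\<forall>\<rho>\<in>R. \<rho> + y > 0) \<Longrightarrow> (f2 0 has_field_derivative g2 0 y) (at y)" by blast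
  show ?case
  proof (intro exI[of _ "\<lambda>e y. g1 e y + g2 e y"] conjI allI impI)
    fix e y assume ok: "e > 0 \<and> (\<forall>\<rho>\<in>R. \<rho> + y > 0) \<and> 2 + y * e > 0"
    show "f1 e (y + e) + f2 e (y + e) = f1 e y + f2 e y + e * (g1 e y + g2 e y)"
      unfolding g1(2)[OF ok] g2(2)[OF ok] by (simp add: algebra_simps)
  qed (auto intro!: tame.add g1 g2 DERIV_add)
next
  case (mult f1 f2)
  from mult.IH(1) obtain g1 where g1: "tame R g1"
    "\<And>e y. e > 0 \<and> (\<forall>\<rho>\<in>R. \<rho> + y > 0) \<and> 2 + y * e > 0 \<Longrightarrow> f1 e (y + e) = f1 e y + e * g1 e y"
    "\<And>y. (\<forall>\<rho>\<in>R. \<rho> + y > 0) \<Longrightarrow> (f1 0 has_field_derivative g1 0 y) (at y)" by blast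
  from mult.IH(2) obtain g2 where g2: "tame R g2"
    "\<And>e y. e > 0 \<and> (\<forall>\<rho>\<in>R. \<rho> + y > 0) \<and> 2 + y * e > 0 \<Longrightarrow> f2 e (y + e) = f2 e y + e * g2 e y"
    "\<And>y. (\<forall>\<rho>\<in>R. \<rho> + y > 0) \<Longrightarrow> (f2 0 has_field_derivative g2 0 y) (at y)" by blast
  show ?case
  \<comment> \<open>Discrete Leibniz rule: one factor has to be taken at the shifted argument, so
    closure under \<open>tame_shift\<close> is used here.\<close>
  proof (intro exI[of _ "\<lambda>e y. g1 e y * f2 e (y + e) + f1 e y * g2 e y"] conjI allI impI)
    fix e y assume ok: "e > 0 \<and> (\<forall>\<rho>\<in>R. \<rho> + y > 0) \<and> 2 + y * e > 0"
    show "f1 e (y + e) * f2 e (y + e) = f1 e y * f2 e y + e * (g1 e y * f2 e (y + e) + f1 e y * g2 e y)"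
      unfolding g1(2)[OF ok] g2(2)[OF ok] by (simp add: algebra_simps)
  next
    fix y assume "\<forall>\<rho>\<in>R. \<rho> + y > 0"
    then show "((\<lambda>y. f1 0 y * f2 0 y) has_field_derivative g1 0 y * f2 0 (y + 0) + f1 0 y * g2 0 y) (at y)"
      using DERIV_mult[OF g1(3) g2(3)] by (simp add: mult.commute)
  qed (intro tame.add tame.mult g1 g2 tame_shift mult.hyps)
qed

text \<open>At \<open>e = 0\<close> the denominators are \<open>\<rho> + y\<close> and 2, both
  nonzero, so a tame function is differentiable in \<open>e\<close> there.\<close>

lemma tame_bigo:
  fixes \<epsilon> :: "'a \<Rightarrow> real"
  assumes "tame R f" "\<forall>\<rho>\<in>R. \<rho> + y > 0" and \<epsilon>: "(\<epsilon> \<longlongrightarrow> 0) F" "\<forall>\<^sub>F x in F. \<epsilon> x > 0"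
  shows "(\<lambda>x. f (\<epsilon> x) y - f 0 y) \<in> O[F](\<epsilon>)"
proof -
  have "(\<lambda>e. f e y) differentiable at 0"
    using assms(1,2)
  proof (induction rule: tame.induct)
    case (recip_rate \<rho> k)
    then have "\<rho> + y \<noteq> 0" by force
    then show ?case by (intro derivative_intros) auto
  qed (auto intro!: derivative_intros)
  then obtain D where "((\<lambda>e. f e y) has_field_derivative D) (at 0)"
    by (auto simp: real_differentiable_def)
  then have "((\<lambda>e. (f e y - f 0 y) / e) \<longlongrightarrow> D) (at 0)" by (simp add: has_field_derivative_iff)
  moreover have "filterlim \<epsilon> (at 0) F" using \<epsilon> by (auto simp: filterlim_at elim: eventually_mono)
  ultimately have "((\<lambda>x. (f (\<epsilon> x) y - f 0 y) / \<epsilon> x) \<longlongrightarrow> D) F" by (rule filterlim_compose)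
  then show ?thesis using \<epsilon>(2) by (intro bigoI_tendsto) (auto elim: eventually_mono)
qed

text \<open>Both towers of moments obey one recursion, with difference quotients on one side and
  derivatives on the other; a single tame function serves both, at \<open>e = \<epsilon> x\<close>
  and at \<open>e = 0\<close>. The predicate \<open>ok\<close> collects the arguments at which the
  finite identities hold and has to be closed under the shift, since the recursion looks at
  \<open>y + \<epsilon> x\<close>.\<close>

lemma moment_tower_conv:
  fixes J :: "'a \<Rightarrow> nat \<Rightarrow> real \<Rightarrow> real" and \<mu> :: "nat \<Rightarrow> real \<Rightarrow> real" and \<epsilon> :: "'a \<Rightarrow> real"
  assumes P: "tame R P"
    and ok: "\<And>x y. ok x y \<Longrightarrow> ok x (y + \<epsilon> x)"
      "\<And>x y. ok x y \<Longrightarrow> \<epsilon> x > 0 \<and> (\<forall>\<rho>\<in>R. \<rho> + y > 0) \<and> 2 + y * \<epsilon> x > 0"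
      "\<And>y. \<forall>\<rho>\<in>R. \<rho> + y > 0 \<Longrightarrow> \<forall>\<^sub>F x in F. ok x y"
    and J: "\<And>x y v. ok x y \<Longrightarrow> J x v (y + \<epsilon> x) = J x v y + \<epsilon> x * J x (Suc v) y"
    and J0: "\<And>x y. ok x y \<Longrightarrow> J x 0 (y + \<epsilon> x) = (1 + \<epsilon> x * P (\<epsilon> x) y) * J x 0 y"
    and \<mu>: "\<And>v y. \<forall>\<rho>\<in>R. \<rho> + y > 0 \<Longrightarrow> (\<mu> v has_field_derivative \<mu> (Suc v) y) (at y)"
      "\<And>y. \<forall>\<rho>\<in>R. \<rho> + y > 0 \<Longrightarrow> (\<mu> 0 has_field_derivative P 0 y * \<mu> 0 y) (at y)"
    and "finite R" and \<epsilon>: "(\<epsilon> \<longlongrightarrow> 0) F" "\<forall>\<^sub>F x in F. \<epsilon> x > 0"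
    and y: "\<forall>\<rho>\<in>R. \<rho> + y > 0" and base: "(\<lambda>x. J x 0 y - \<mu> 0 y) \<in> O[F](\<epsilon>)"
  shows "(\<lambda>x. J x v y - \<mu> v y) \<in> O[F](\<epsilon>)"
proof -
  have "\<exists>f. tame R f \<and> (\<forall>x y. ok x y \<longrightarrow> J x v y = f (\<epsilon> x) y * J x 0 y) \<and>
     (\<forall>y. (\<forall>\<rho>\<in>R. \<rho> + y > 0) \<longrightarrow> \<mu> v y = f 0 y * \<mu> 0 y)"
  proof (induction v)
    case 0
    show ?case by (intro exI[of _ "\<lambda>e y. 1"]) (auto intro: tame.intros)
  next
    case (Suc v)
    then obtain f where f: "tame R f" "\<And>x y. ok x y \<Longrightarrow> J x v y = f (\<epsilon> x) y * J x 0 y"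
      "\<And>y. \<forall>\<rho>\<in>R. \<rho> + y > 0 \<Longrightarrow> \<mu> v y = f 0 y * \<mu> 0 y" by blast
    obtain g where g: "tame R g"
      "\<And>e y. e > 0 \<and> (\<forall>\<rho>\<in>R. \<rho> + y > 0) \<and> 2 + y * e > 0 \<Longrightarrow> f e (y + e) = f e y + e * g e y"
      "\<And>y. \<forall>\<rho>\<in>R. \<rho> + y > 0 \<Longrightarrow> (f 0 has_field_derivative g 0 y) (at y)"
      using tame_difference_quotient[OF f(1)] by blast
    \<comment> \<open>From the product rule applied to \<open>f\<close> times \<open>J x 0\<close>:
      the difference quotient of \<open>f\<close>, plus the shifted \<open>f\<close> times the
      relative increment \<open>P\<close> of \<open>J x 0\<close>.\<close>
    let ?h = "\<lambda>e y. g e y + f e (y + e) * P e y"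
    have "tame R ?h" by (intro tame.intros tame_shift P f g)
    moreover have "J x (Suc v) y = ?h (\<epsilon> x) y * J x 0 y" if "ok x y" for x y
    proof -
      have e: "\<epsilon> x > 0" using ok(2)[OF that] by simp
      have "\<epsilon> x * J x (Suc v) y = J x v (y + \<epsilon> x) - J x v y" using J[OF that] by simp
      also have "\<dots> = f (\<epsilon> x) (y + \<epsilon> x) * ((1 + \<epsilon> x * P (\<epsilon> x) y) * J x 0 y) - f (\<epsilon> x) y * J x 0 y"
        using f(2)[OF that] f(2)[OF ok(1)[OF that]] J0[OF that] by simp
      also have "\<dots> = \<epsilon> x * (?h (\<epsilon> x) y * J x 0 y)"
        using g(2)[OF ok(2)[OF that]] by (simp add: algebra_simps)
      finally show ?thesis using e by simp
    qed
    moreover have "\<mu> (Suc v) y = ?h 0 y * \<mu> 0 y" if y: "\<forall>\<rho>\<in>R. \<rho> + y > 0" for y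
    proof -
      have "open {y. \<forall>\<rho>\<in>R. \<rho> + y > 0}"
      proof -
        have "{y. \<forall>\<rho>\<in>R. \<rho> + y > 0} = (\<Inter>\<rho>\<in>R. {y. \<rho> + y > 0})" by auto
        moreover have "open (\<Inter>\<rho>\<in>R. {y::real. \<rho> + y > 0})"
          using \<open>finite R\<close> by (intro open_INT ballI open_Collect_less continuous_intros)
        ultimately show ?thesis by simp
      qed
      then have "((\<lambda>y. f 0 y * \<mu> 0 y) has_field_derivative \<mu> (Suc v) y) (at y)"
        using f(3) y by (intro has_field_derivative_transform_within_open[OF \<mu>(1)[OF y]]) auto
      moreover have "((\<lambda>y. f 0 y * \<mu> 0 y) has_field_derivative g 0 y * \<mu> 0 y + f 0 y * (P 0 y * \<mu> 0 y)) (at y)"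
        using g(3)[OF y] \<mu>(2)[OF y] by (auto intro!: derivative_eq_intros)
      ultimately show ?thesis by (auto dest: DERIV_unique simp: algebra_simps)
    qed
    ultimately show ?case by (intro exI[of _ ?h]) blast
  qed
  then obtain f where f: "tame R f" "\<And>x y. ok x y \<Longrightarrow> J x v y = f (\<epsilon> x) y * J x 0 y"
      "\<mu> v y = f 0 y * \<mu> 0 y" using y by blast
  have b: "(\<lambda>x. f (\<epsilon> x) y - f 0 y) \<in> O[F](\<epsilon>)" by (rule tame_bigo[OF f(1) y \<epsilon>])
  have "((\<lambda>x. J x 0 y - \<mu> 0 y + \<mu> 0 y) \<longlongrightarrow> 0 + \<mu> 0 y) F"
  proof (intro tendsto_intros)
    obtain c where "\<forall>\<^sub>F x in F. norm (J x 0 y - \<mu> 0 y) \<le> c * norm (\<epsilon> x)" using base by (elim landau_o.bigE)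
    then show "((\<lambda>x. J x 0 y - \<mu> 0 y) \<longlongrightarrow> 0) F"
      by (rule Lim_null_comparison) (intro tendsto_mult_right_zero tendsto_norm_zero \<epsilon>)
  qed
  then have "(\<lambda>x. J x 0 y) \<in> O[F](\<lambda>_. 1)" by (intro bigoI_tendsto[of _ _ "\<mu> 0 y"]) auto
  from landau_o.big.mult[OF b this] have "(\<lambda>x. (f (\<epsilon> x) y - f 0 y) * J x 0 y) \<in> O[F](\<epsilon>)" by simp
  moreover have "(\<lambda>x. f 0 y * (J x 0 y - \<mu> 0 y)) \<in> O[F](\<epsilon>)" using base by simp
  ultimately have "(\<lambda>x. (f (\<epsilon> x) y - f 0 y) * J x 0 y + f 0 y * (J x 0 y - \<mu> 0 y)) \<in> O[F](\<epsilon>)"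
    by (rule sum_in_bigo)
  moreover have E: "\<forall>\<^sub>F x in F. (f (\<epsilon> x) y - f 0 y) * J x 0 y + f 0 y * (J x 0 y - \<mu> 0 y) = J x v y - \<mu> v y"
    using ok(3)[OF y] by eventually_elim (simp add: f(2,3) algebra_simps)
  ultimately show ?thesis using landau_o.big.in_cong[OF E] by simp
qed

subsection \<open>Method of moments\<close>

text \<open>Up to the factor \<open>\<i> ^ k\<close> this is the \<open>k\<close>-th derivative of
  the characteristic function of the density \<open>f\<close>, without a normalization of the total
  mass.\<close>

definition fourier_moment :: "(real \<Rightarrow> real) \<Rightarrow> nat \<Rightarrow> real \<Rightarrow> complex" where
  "fourier_moment f k y = (LBINT t. (t ^ k * f t) *\<^sub>R iexp (y * t))"

lemma integrable_moment_iexp: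
  assumes "integrable lborel (\<lambda>t. t ^ k * f t)"
  shows "integrable lborel (\<lambda>t. (t ^ k * f t) *\<^sub>R iexp (y * t))"
proof (rule Bochner_Integration.integrable_bound[OF assms])
  have [measurable]: "(\<lambda>t. t ^ k * f t) \<in> borel_measurable lborel" using assms by auto
  show "(\<lambda>t. (t ^ k * f t) *\<^sub>R iexp (y * t)) \<in> borel_measurable lborel" by measurable
qed (simp add: norm_mult)

text \<open>The remainder of the exponential series is bounded by a multiple of
  \<open>\<bar>t\<bar> ^ (k + Suc m)\<close>. Parity makes this a moment without absolute value, and
  moments are what is known to converge.\<close>

lemma fourier_moment_taylor:
  assumes f: "\<And>t. f t \<ge> 0" "\<And>k. integrable lborel (\<lambda>t. t ^ k * f t)" and even: "even (k + Suc m)"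
  shows "norm (fourier_moment f k (y + h) - (\<Sum>l\<le>m. (\<i> * h) ^ l / fact l * fourier_moment f (k + l) y))
     \<le> \<bar>h\<bar> ^ Suc m / fact (Suc m) * (LBINT t. t ^ (k + Suc m) * f t)"
proof -
  note I = integrable_moment_iexp[OF f(2)]
  let ?d = "\<lambda>t. (t ^ k * f t) *\<^sub>R iexp ((y + h) * t) -
      (\<Sum>l\<le>m. (\<i> * h) ^ l / fact l * ((t ^ (k + l) * f t) *\<^sub>R iexp (y * t)))"
  have di: "integrable lborel ?d"
    by (intro Bochner_Integration.integrable_diff Bochner_Integration.integrable_sum integrable_mult_right I)
  have eq: "fourier_moment f k (y + h) - (\<Sum>l\<le>m. (\<i> * h) ^ l / fact l * fourier_moment f (k + l) y) =
      (LBINT t. ?d t)"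
  proof -
    let ?s = "\<lambda>l t. (\<i> * h) ^ l / fact l * ((t ^ (k + l) * f t) *\<^sub>R iexp (y * t))"
    have "(LBINT t. ?d t) = (LBINT t. (t ^ k * f t) *\<^sub>R iexp ((y + h) * t)) - (LBINT t. \<Sum>l\<le>m. ?s l t)"
      by (rule Bochner_Integration.integral_diff[OF I])
        (intro Bochner_Integration.integrable_sum integrable_mult_right I)
    also have "(LBINT t. \<Sum>l\<le>m. ?s l t) = (\<Sum>l\<le>m. LBINT t. ?s l t)"
      by (rule Bochner_Integration.integral_sum) (intro integrable_mult_right I)
    finally show ?thesis by (simp only: fourier_moment_def integral_mult_right_zero)
  qed
  have "norm (LBINT t. ?d t) \<le> (LBINT t. norm (?d t))" by (rule integral_norm_bound)
  also have "\<dots> \<le> (LBINT t. \<bar>h\<bar> ^ Suc m / fact (Suc m) * (t ^ (k + Suc m) * f t))"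
  proof (rule integral_mono)
    show "integrable lborel (\<lambda>t. norm (?d t))" by (rule integrable_norm[OF di])
    show "integrable lborel (\<lambda>t. \<bar>h\<bar> ^ Suc m / fact (Suc m) * (t ^ (k + Suc m) * f t))"
      by (rule integrable_mult_right[OF f(2)])
    fix t :: real
    have "?d t = of_real (t ^ k * f t) * (iexp (y * t) * (iexp (h * t) - (\<Sum>l\<le>m. (\<i> * (h * t)) ^ l / fact l)))"
    proof -
      have "iexp ((y + h) * t) = iexp (y * t) * iexp (h * t)"
        by (simp add: distrib_right distrib_left exp_add[symmetric])
      then show ?thesis
        by (simp add: scaleR_conv_of_real right_diff_distrib sum_distrib_left power_add power_mult_distrib mult_ac)
    qed
    then have "norm (?d t) = \<bar>t ^ k\<bar> * f t * norm (iexp (h * t) - (\<Sum>l\<le>m. (\<i> * (h * t)) ^ l / fact l))"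
      using f(1)[of t] by (simp add: norm_mult abs_mult norm_power power_abs)
    also have "\<dots> \<le> \<bar>t ^ k\<bar> * f t * (\<bar>h * t\<bar> ^ Suc m / fact (Suc m))"
      using f(1)[of t] iexp_approx1[of "h * t" m] by (intro mult_left_mono) auto
    also have "\<dots> = \<bar>h\<bar> ^ Suc m / fact (Suc m) * (\<bar>t\<bar> ^ (k + Suc m) * f t)"
      by (simp add: abs_mult power_mult_distrib power_abs power_add del: fact_Suc)
    also have "\<bar>t\<bar> ^ (k + Suc m) = t ^ (k + Suc m)" using even by (rule power_even_abs)
    finally show "norm (?d t) \<le> \<bar>h\<bar> ^ Suc m / fact (Suc m) * (t ^ (k + Suc m) * f t)" .
  qed
  finally show ?thesis unfolding eq by simp
qed

text \<open>Convergence of all moments propagates from frequency \<open>y\<close> to \<open>y + h\<close> by Taylor expansion, with step size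
  bounded by the exponential decay rate of the limit.\<close>

lemma fourier_moment_step:
  fixes f :: "nat \<Rightarrow> real \<Rightarrow> real"
  assumes f: "\<And>n t. f n t \<ge> 0" "\<And>n k. integrable lborel (\<lambda>t. t ^ k * f n t)"
    and g: "\<And>t. g t \<ge> 0" "\<And>k. integrable lborel (\<lambda>t. t ^ k * g t)"
    and \<delta>: "\<delta> > 0" "\<And>k. integrable lborel (\<lambda>t. t ^ k * (exp (\<delta> * \<bar>t\<bar>) * g t))"
    and mom: "\<And>k. (\<lambda>n. LBINT t. t ^ k * f n t) \<longlonglongrightarrow> (LBINT t. t ^ k * g t)"
    and y: "\<And>k. (\<lambda>n. fourier_moment (f n) k y) \<longlonglongrightarrow> fourier_moment g k y" and h: "\<bar>h\<bar> \<le> \<delta> / 2"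
  shows "(\<lambda>n. fourier_moment (f n) k (y + h)) \<longlonglongrightarrow> fourier_moment g k (y + h)"
proof (rule tendstoI)
  fix e :: real assume "e > 0"
  define K where "K = (LBINT t. \<bar>t ^ k * (exp (\<delta> * \<bar>t\<bar>) * g t)\<bar>)"
  have "(\<lambda>m. (1/2::real) ^ Suc m * K) \<longlonglongrightarrow> 0 * K"
    by (intro tendsto_mult tendsto_const LIMSEQ_Suc LIMSEQ_power_zero) auto
  then have "\<forall>\<^sub>F m in sequentially. (1/2::real) ^ Suc m * K < e / 3"
    by (rule order_tendstoD) (use \<open>e > 0\<close> in auto)
  then obtain m0 where m0: "\<And>m. m \<ge> m0 \<Longrightarrow> (1/2::real) ^ Suc m * K < e / 3"
    by (auto simp: eventually_sequentially)
  \<comment> \<open>Either \<open>m0\<close> or its successor has the parity required by the Taylor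
    estimate.\<close>
  define m where "m = (if even (k + Suc m0) then m0 else Suc m0)"
  have m: "even (k + Suc m)" "m \<ge> m0" by (auto simp: m_def)
  define c where "c = \<bar>h\<bar> ^ Suc m / fact (Suc m)"
  \<comment> \<open>The remainder is compared with one term of the exponential series at
    \<open>\<delta> * \<bar>t\<bar>\<close>; a step length of at most \<open>\<delta> / 2\<close>
    leaves the geometric factor. Only the limit density needs exponential moments for this.\<close>
  have bg: "c * (LBINT t. t ^ (k + Suc m) * g t) < e / 3"
  proof -
    have "c * (LBINT t. t ^ (k + Suc m) * g t) = (LBINT t. c * (t ^ (k + Suc m) * g t))" by simp
    also have "\<dots> \<le> (LBINT t. (1/2) ^ Suc m * \<bar>t ^ k * (exp (\<delta> * \<bar>t\<bar>) * g t)\<bar>)"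
    proof (rule integral_mono)
      show "integrable lborel (\<lambda>t. c * (t ^ (k + Suc m) * g t))" by (rule integrable_mult_right[OF g(2)])
      show "integrable lborel (\<lambda>t. (1/2) ^ Suc m * \<bar>t ^ k * (exp (\<delta> * \<bar>t\<bar>) * g t)\<bar>)"
        by (intro integrable_mult_right integrable_abs \<delta>(2))
      fix t :: real
      have "(\<Sum>n\<in>{Suc m}. (\<delta> * \<bar>t\<bar>) ^ n /\<^sub>R fact n) \<le> (\<Sum>n. (\<delta> * \<bar>t\<bar>) ^ n /\<^sub>R fact n)"
        using \<delta>(1) by (intro sum_le_suminf summable_exp_generic) auto
      then have 1: "(\<delta> * \<bar>t\<bar>) ^ Suc m / fact (Suc m) \<le> exp (\<delta> * \<bar>t\<bar>)"
        by (simp add: exp_def divide_inverse mult.commute del: power_Suc fact_Suc)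
      have "c * \<bar>t\<bar> ^ Suc m \<le> (\<delta> / 2) ^ Suc m / fact (Suc m) * \<bar>t\<bar> ^ Suc m"
        unfolding c_def using h by (intro mult_right_mono divide_right_mono power_mono) auto
      also have "\<dots> = (1/2) ^ Suc m * ((\<delta> * \<bar>t\<bar>) ^ Suc m / fact (Suc m))"
        by (simp add: power_mult_distrib power_divide del: fact_Suc power_Suc)
      also have "\<dots> \<le> (1/2) ^ Suc m * exp (\<delta> * \<bar>t\<bar>)" using 1 by (intro mult_left_mono) auto
      finally have 2: "c * \<bar>t\<bar> ^ Suc m \<le> (1/2) ^ Suc m * exp (\<delta> * \<bar>t\<bar>)" .
      have "c * (t ^ (k + Suc m) * g t) \<le> \<bar>c * (t ^ (k + Suc m) * g t)\<bar>" by simp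
      also have "\<dots> = (c * \<bar>t\<bar> ^ Suc m) * (\<bar>t\<bar> ^ k * g t)"
        using g(1)[of t] by (simp add: c_def abs_mult power_add power_abs del: power_Suc fact_Suc add_Suc_right)
      also have "\<dots> \<le> ((1/2) ^ Suc m * exp (\<delta> * \<bar>t\<bar>)) * (\<bar>t\<bar> ^ k * g t)"
        using 2 g(1)[of t] by (intro mult_right_mono) auto
      also have "\<dots> = (1/2) ^ Suc m * \<bar>t ^ k * (exp (\<delta> * \<bar>t\<bar>) * g t)\<bar>"
        using g(1)[of t] by (simp add: abs_mult power_abs del: power_Suc)
      finally show "c * (t ^ (k + Suc m) * g t) \<le> (1/2) ^ Suc m * \<bar>t ^ k * (exp (\<delta> * \<bar>t\<bar>) * g t)\<bar>" .
    qed
    also have "\<dots> = (1/2) ^ Suc m * K" by (simp add: K_def)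
    finally show ?thesis using m0[OF m(2)] by linarith
  qed
  define S where "S f = (\<Sum>l\<le>m. (\<i> * h) ^ l / fact l * fourier_moment f (k + l) y)" for f
  \<comment> \<open>The remainder for \<open>f n\<close> is controlled through its limit: it is a
    constant times a single moment, and that moment converges to the one bounded in
    \<open>bg\<close>.\<close>
  have "(\<lambda>n. c * (LBINT t. t ^ (k + Suc m) * f n t)) \<longlonglongrightarrow> c * (LBINT t. t ^ (k + Suc m) * g t)"
    by (intro tendsto_intros mom)
  then have "\<forall>\<^sub>F n in sequentially. c * (LBINT t. t ^ (k + Suc m) * f n t) < e / 3"
    by (rule order_tendstoD) (rule bg)
  moreover have "(\<lambda>n. S (f n)) \<longlonglongrightarrow> S g" unfolding S_def by (intro tendsto_intros y)
  then have "\<forall>\<^sub>F n in sequentially. dist (S (f n)) (S g) < e / 3" using \<open>e > 0\<close> by (intro tendstoD) auto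
  ultimately show "\<forall>\<^sub>F n in sequentially. dist (fourier_moment (f n) k (y + h)) (fourier_moment g k (y + h)) < e"
  proof eventually_elim
    case (elim n)
    have "norm (fourier_moment (f n) k (y + h) - S (f n)) \<le> c * (LBINT t. t ^ (k + Suc m) * f n t)"
      unfolding S_def c_def by (rule fourier_moment_taylor[OF f m(1)])
    moreover have "norm (fourier_moment g k (y + h) - S g) \<le> c * (LBINT t. t ^ (k + Suc m) * g t)"
      unfolding S_def c_def by (rule fourier_moment_taylor[OF g m(1)])
    moreover have tri: "dist a b \<le> norm (a - s) + dist s s' + norm (b - s')" for a b s s' :: complex
      using dist_triangle[of a b s] dist_triangle[of s b s'] by (simp add: dist_norm norm_minus_commute)
    note tri[of "fourier_moment (f n) k (y + h)" "fourier_moment g k (y + h)" "S (f n)" "S g"]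
    ultimately show ?case using elim bg by linarith
  qed
qed

text \<open>The point \<open>y\<close> is reached from 0 in \<open>N\<close> steps of length at most
  \<open>\<delta> / 2\<close>. At 0 the claim is the convergence of moments, and the induction
  carries all orders \<open>k\<close> along because each step uses higher orders at the previous
  point.\<close>

lemma fourier_moment_conv:
  fixes f :: "nat \<Rightarrow> real \<Rightarrow> real"
  assumes f: "\<And>n t. f n t \<ge> 0" "\<And>n k. integrable lborel (\<lambda>t. t ^ k * f n t)"
    and g: "\<And>t. g t \<ge> 0" "\<And>k. integrable lborel (\<lambda>t. t ^ k * g t)"
    and \<delta>: "\<delta> > 0" "\<And>k. integrable lborel (\<lambda>t. t ^ k * (exp (\<delta> * \<bar>t\<bar>) * g t))"
    and mom: "\<And>k. (\<lambda>n. LBINT t. t ^ k * f n t) \<longlonglongrightarrow> (LBINT t. t ^ k * g t)"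
  shows "(\<lambda>n. fourier_moment (f n) k y) \<longlonglongrightarrow> fourier_moment g k y"
proof -
  obtain N where N: "real N > \<bar>y\<bar> / (\<delta> / 2)" using reals_Archimedean2 by blast
  have N0: "N > 0" using N \<delta>(1) by (cases N) (auto simp: divide_less_0_iff)
  define h where "h = y / real N"
  have h: "\<bar>h\<bar> \<le> \<delta> / 2" using N \<delta>(1) N0 by (simp add: h_def field_simps)
  have "(\<lambda>n. fourier_moment (f n) k (real j * h)) \<longlonglongrightarrow> fourier_moment g k (real j * h)" for j k
  proof (induction j arbitrary: k)
    case 0
    have "fourier_moment f k 0 = of_real (LBINT t. t ^ k * f t)" for f
      by (simp add: fourier_moment_def scaleR_conv_of_real flip: of_real_mult of_real_power)
    then show ?case using mom by (simp add: tendsto_of_real)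
  next
    case (Suc j)
    from fourier_moment_step[OF f g \<delta> mom Suc h, of k] show ?case by (simp add: distrib_right add.commute)
  qed
  from this[of k N] show ?thesis using N0 by (simp add: h_def)
qed

section \<open>From characteristic functions to weak convergence\<close>

lemma real_distribution_density:
  assumes "\<And>t. f t \<ge> 0" "integrable lborel f" "(LBINT t. f t) = 1"
  shows "real_distribution (density lborel (\<lambda>t. ennreal (f t)))"
proof -
  have "emeasure (density lborel (\<lambda>t. ennreal (f t))) UNIV = (\<integral>\<^sup>+ t. f t \<partial>lborel)"
    using assms(2) by (subst emeasure_density) auto
  also have "\<dots> = 1" using assms by (subst nn_integral_eq_integral) auto
  finally have "prob_space (density lborel (\<lambda>t. ennreal (f t)))" by (intro prob_spaceI) simp
  then show ?thesis by (simp add: real_distribution_def real_distribution_axioms_def)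
qed

lemma moments_imp_weak_conv:
  fixes f :: "nat \<Rightarrow> real \<Rightarrow> real"
  assumes f: "\<And>n t. f n t \<ge> 0" "\<And>n k. integrable lborel (\<lambda>t. t ^ k * f n t)" "\<And>n. (LBINT t. f n t) = 1"
    and g: "\<And>t. g t \<ge> 0" "\<And>k. integrable lborel (\<lambda>t. t ^ k * g t)" "(LBINT t. g t) = 1"
    and \<delta>: "\<delta> > 0" "\<And>k. integrable lborel (\<lambda>t. t ^ k * (exp (\<delta> * \<bar>t\<bar>) * g t))"
    and mom: "\<And>k. (\<lambda>n. LBINT t. t ^ k * f n t) \<longlonglongrightarrow> (LBINT t. t ^ k * g t)"
    and \<phi>: "continuous_on UNIV \<phi>" "\<And>t. \<bar>\<phi> t\<bar> \<le> B"
  shows "(\<lambda>n. LBINT t. f n t * \<phi> t) \<longlonglongrightarrow> (LBINT t. g t * \<phi> t)"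
proof -
  define D where "D f = density lborel (\<lambda>t. ennreal (f t))" for f :: "real \<Rightarrow> real"
  have fi: "integrable lborel (f n)" for n using f(2)[where k=0] by simp
  have gi: "integrable lborel g" using g(2)[where k=0] by simp
  have rd: "real_distribution (D (f n))" "real_distribution (D g)" for n
    unfolding D_def by (intro real_distribution_density f g fi gi)+
  have char: "char (D f) y = fourier_moment f 0 y" if "\<And>t. f t \<ge> 0" "integrable lborel f" for f y
    unfolding char_def D_def fourier_moment_def using that by (subst integral_density) auto
  have wc: "weak_conv_m (\<lambda>n. D (f n)) (D g)"
  proof (rule levy_continuity[OF rd])
    show "(\<lambda>n. char (D (f n)) t) \<longlonglongrightarrow> char (D g) t" for t
      unfolding char[OF f(1) fi] char[OF g(1) gi]
      by (rule fourier_moment_conv[OF f(1,2) g(1,2) \<delta> mom])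
  qed
  have [measurable]: "\<phi> \<in> borel_measurable borel" using \<phi>(1) by (rule borel_measurable_continuous_onI)
  have int: "integral\<^sup>L (D f) \<phi> = (LBINT t. f t * \<phi> t)" if "\<And>t. f t \<ge> 0" "integrable lborel f" for f
    unfolding D_def using that by (subst integral_density) auto
  have "(\<lambda>n. integral\<^sup>L (D (f n)) \<phi>) \<longlonglongrightarrow> integral\<^sup>L (D g) \<phi>"
    using weak_conv_imp_integral_bdd_continuous_conv[OF rd wc, of \<phi> B] \<phi>
    by (auto simp: continuous_on_eq_continuous_at)
  then show ?thesis by (simp add: int f g fi gi)
qed

text \<open>The continuity theorem speaks of sequences of probability distributions, so the limit at
  infinity is tested along sequences and the masses are normalized; they are eventually positive
  since the limit mass is.\<close>

lemma moments_imp_weak_conv_at_top: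
  fixes f :: "real \<Rightarrow> real \<Rightarrow> real"
  assumes f: "\<forall>\<^sub>F \<tau> in at_top. (\<forall>t. f \<tau> t \<ge> 0) \<and> (\<forall>k. integrable lborel (\<lambda>t. t ^ k * f \<tau> t))"
    and g: "\<And>t. g t \<ge> 0" "\<And>k. integrable lborel (\<lambda>t. t ^ k * g t)" "(LBINT t. g t) > 0"
    and \<delta>: "\<delta> > 0" "\<And>k. integrable lborel (\<lambda>t. t ^ k * (exp (\<delta> * \<bar>t\<bar>) * g t))"
    and mom: "\<And>k. ((\<lambda>\<tau>. LBINT t. t ^ k * f \<tau> t) \<longlongrightarrow> (LBINT t. t ^ k * g t)) at_top"
    and \<phi>: "continuous_on UNIV \<phi>" "\<And>t. \<bar>\<phi> t\<bar> \<le> B"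
  shows "((\<lambda>\<tau>. LBINT t. f \<tau> t * \<phi> t) \<longlongrightarrow> (LBINT t. g t * \<phi> t)) at_top"
proof (rule tendsto_at_topI_sequentially)
  fix X :: "nat \<Rightarrow> real" assume X: "filterlim X at_top sequentially"
  define c where "c = (LBINT t. g t)"
  define cn where "cn n = (LBINT t. f (X n) t)" for n
  define good where "good n \<longleftrightarrow> (\<forall>t. f (X n) t \<ge> 0) \<and> (\<forall>k. integrable lborel (\<lambda>t. t ^ k * f (X n) t)) \<and> cn n > 0" for n
  have cn: "cn \<longlonglongrightarrow> c" using filterlim_compose[OF mom[of 0] X] by (simp add: cn_def[abs_def] c_def)
  have c0: "c > 0" using g by (simp add: c_def)
  have "\<forall>\<^sub>F n in sequentially. cn n > 0" using cn c0 by (rule order_tendstoD)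
  with filterlim_iff[THEN iffD1, OF X, rule_format, OF f]
  have ev: "\<forall>\<^sub>F n in sequentially. good n" by eventually_elim (auto simp: good_def)
  \<comment> \<open>The finitely many indices where positivity or integrability may fail are filled
    with the normalized limit density, so that the hypotheses hold for every
    \<open>n\<close>.\<close>
  define F where "F n t = (if good n then f (X n) t / cn n else g t / c)" for n t
  have Fint: "(LBINT t. t ^ k * F n t) = (if good n then (LBINT t. t ^ k * f (X n) t) / cn n else (LBINT t. t ^ k * g t) / c)" for n k
    unfolding F_def by simp
  have "(\<lambda>n. LBINT t. F n t * \<phi> t) \<longlonglongrightarrow> (LBINT t. (g t / c) * \<phi> t)"
  proof (rule moments_imp_weak_conv[where B = B])
    show "F n t \<ge> 0" for n t using g(1) c0 by (auto simp: F_def good_def)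
    show "integrable lborel (\<lambda>t. t ^ k * F n t)" for n k using g(2) by (cases "good n") (simp_all add: F_def, simp add: good_def)
    show "(LBINT t. F n t) = 1" for n using Fint[of 0 n] c0 by (auto simp: cn_def[symmetric] c_def[symmetric] good_def)
    show "g t / c \<ge> 0" for t using g(1) c0 by simp
    show "integrable lborel (\<lambda>t. t ^ k * (g t / c))" for k using g(2) by simp
    show "(LBINT t. g t / c) = 1" using c0 by (simp add: c_def[symmetric])
    show "integrable lborel (\<lambda>t. t ^ k * (exp (\<delta> * \<bar>t\<bar>) * (g t / c)))" for k
      using \<delta>(2)[of k] by (simp add: mult.assoc)
    show "(\<lambda>n. LBINT t. t ^ k * F n t) \<longlonglongrightarrow> (LBINT t. t ^ k * (g t / c))" for k
    proof -
      have "(\<lambda>n. (LBINT t. t ^ k * f (X n) t) / cn n) \<longlonglongrightarrow> (LBINT t. t ^ k * g t) / c"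
        using c0 by (intro tendsto_divide filterlim_compose[OF mom X] cn) auto
      moreover have "\<forall>\<^sub>F n in sequentially. (LBINT t. t ^ k * f (X n) t) / cn n = (LBINT t. t ^ k * F n t)"
        using ev by eventually_elim (simp add: Fint)
      ultimately show ?thesis using tendsto_cong by fastforce
    qed
  qed (use \<delta> \<phi> in auto)
  from tendsto_mult[OF cn this]
  have "(\<lambda>n. cn n * (LBINT t. F n t * \<phi> t)) \<longlonglongrightarrow> (LBINT t. g t * \<phi> t)" using c0 by simp
  moreover have "\<forall>\<^sub>F n in sequentially. cn n * (LBINT t. F n t * \<phi> t) = (LBINT t. f (X n) t * \<phi> t)"
    using ev by eventually_elim (simp add: F_def good_def)
  ultimately show "(\<lambda>n. LBINT t. f (X n) t * \<phi> t) \<longlonglongrightarrow> (LBINT t. g t * \<phi> t)"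
    using tendsto_cong by fastforce
qed

subsection \<open>Mellin and Laplace transforms of the weights\<close>

text \<open>Fubini for nonnegative integrands: absolute integrability follows from the inner
  integrals \<open>\<kappa> u\<close>. Both convolutions are such mixtures over \<open>u\<close>,
  the multiplicative one for the Mellin transform and the additive one for the Laplace
  transform.\<close>

lemma has_bochner_integral_mixture:
  fixes Q :: "real \<Rightarrow> real \<Rightarrow> real"
  assumes [measurable]: "case_prod Q \<in> borel_measurable (lborel \<Otimes>\<^sub>M lborel)" "w \<in> borel_measurable lborel"
    and nonneg: "\<And>t u. Q t u \<ge> 0" "\<And>t. w t \<ge> 0"
    and inner: "\<And>u. has_bochner_integral lborel (\<lambda>t. w t * Q t u) (\<kappa> u)"
    and outer: "has_bochner_integral lborel \<kappa> c"
  shows "has_bochner_integral lborel (\<lambda>t. w t * (LBINT u. Q t u)) c"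
proof -
  let ?f = "\<lambda>u t. w t * Q t u"
  have [measurable]: "(\<lambda>p. Q (snd p) (fst p)) \<in> borel_measurable (lborel \<Otimes>\<^sub>M lborel)"
    using measurable_compose[OF measurable_pair_swap' assms(1)] by (simp add: case_prod_unfold)
  have "integrable (lborel \<Otimes>\<^sub>M lborel) (case_prod ?f)"
  proof (rule lborel_pair.Fubini_integrable)
    show "case_prod ?f \<in> borel_measurable (lborel \<Otimes>\<^sub>M lborel)" by (simp add: case_prod_unfold)
    have "(\<lambda>u. LBINT t. norm (case_prod ?f (u, t))) = \<kappa>"
      using inner nonneg by (auto simp: has_bochner_integral_iff fun_eq_iff)
    then show "integrable lborel (\<lambda>u. LBINT t. norm (case_prod ?f (u, t)))"
      using outer by (simp add: has_bochner_integral_iff)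
    show "AE u in lborel. integrable lborel (\<lambda>t. case_prod ?f (u, t))"
      using inner by (simp add: has_bochner_integral_iff)
  qed
  from lborel_pair.integrable_snd[OF this] lborel_pair.Fubini_integral[OF this]
  show ?thesis using inner outer by (simp add: has_bochner_integral_iff)
qed

text \<open>This carries the Beta and Gamma integrals from gauge to Lebesgue integration;
  nonnegativity makes the two notions agree.\<close>

lemma has_bochner_integral_lborel_nonneg:
  fixes f :: "real \<Rightarrow> real"
  assumes "f \<in> borel_measurable borel" "\<And>x. x \<in> A \<Longrightarrow> 0 \<le> f x" "(f has_integral I) A" "A \<in> sets borel"
  shows "has_bochner_integral lborel (\<lambda>x. indicator A x * f x) I"
proof (rule has_bochner_integral_nn_integral)
  have m [measurable]: "(\<lambda>x. indicator A x * f x) \<in> borel_measurable borel" using assms(1,4) by measurable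
  then show "(\<lambda>x. indicator A x * f x) \<in> borel_measurable lborel" by simp
  have nn: "0 \<le> indicator A x * f x" for x using assms(2) by (auto simp: indicator_def)
  then show "AE x in lborel. 0 \<le> indicator A x * f x" by simp
  show "0 \<le> I" using assms(2,3) by (rule has_integral_nonneg[rotated])
  have "((\<lambda>x. indicator A x * f x) has_integral I) UNIV"
  proof -
    have "(\<lambda>x. indicator A x * f x) = (\<lambda>x. if x \<in> A then f x else 0)" by auto
    then show ?thesis using assms(3) has_integral_restrict_UNIV[of A f I] by simp
  qed
  then show "(\<integral>\<^sup>+x. indicator A x * f x \<partial>lborel) = ennreal I"
    by (rule nn_integral_has_integral_lborel[OF m nn])
qed

text \<open>Support in the unit interval is recorded because the convolutions inherit it and because
  the weights must vanish outside \<open>I_jacobi\<close> after the change of variable.\<close>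

definition unit_weight :: "(real \<Rightarrow> real) \<Rightarrow> bool" where
  "unit_weight f \<longleftrightarrow> f \<in> borel_measurable borel \<and> (\<forall>x. f x \<ge> 0) \<and> (\<forall>x. x \<le> 0 \<or> x \<ge> 1 \<longrightarrow> f x = 0)"

lemma unit_weight_beta: "b > a \<Longrightarrow> unit_weight (beta_weight a b)"
  unfolding unit_weight_def beta_weight_def by (auto intro!: divide_nonneg_pos Gamma_real_pos)

lemma mellin_beta:
  assumes "b > a" "a + 1 + s > 0"
  shows "has_bochner_integral lborel (\<lambda>x. x powr s * beta_weight a b x) (Gamma (a + 1 + s) / Gamma (b + 1 + s))"
proof -
  let ?f = "\<lambda>x. x powr (a + 1 + s - 1) * (1 - x) powr (b - a - 1)"
  have "has_bochner_integral lborel (\<lambda>x. indicator {0..1} x * ?f x) (Beta (a + 1 + s) (b - a))"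
    using assms by (intro has_bochner_integral_lborel_nonneg has_integral_Beta_real) auto
  then have "has_bochner_integral lborel (\<lambda>x. (1 / Gamma (b - a)) * (indicator {0..1} x * ?f x))
      ((1 / Gamma (b - a)) * Beta (a + 1 + s) (b - a))" by (intro has_bochner_integral_mult_right)
  also have "(1 / Gamma (b - a)) * Beta (a + 1 + s) (b - a) = Gamma (a + 1 + s) / Gamma (b + 1 + s)"
  proof -
    have "0 < Gamma (b - a)" using assms(1) by (intro Gamma_real_pos) simp
    then have "Gamma (b - a) \<noteq> 0" by linarith
    moreover have "a + 1 + s + (b - a) = b + 1 + s" by simp
    ultimately show ?thesis by (simp only: Beta_def) simp
  qed
  finally show ?thesis
  proof (rule has_bochner_integral_cong_AE[THEN iffD1, rotated 3])
    have "AE x in lborel. x \<noteq> (0::real) \<and> x \<noteq> 1" by (auto intro!: AE_conjI AE_lborel_singleton)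
    then show "AE x in lborel. (1 / Gamma (b - a)) * (indicator {0..1} x * ?f x) = x powr s * beta_weight a b x"
    proof eventually_elim
      case (elim x)
      have "x powr (a + s) = x powr s * x powr a" by (simp add: powr_add)
      then show ?case using elim by (auto simp: beta_weight_def indicator_def)
    qed
    have [measurable]: "beta_weight a b \<in> borel_measurable borel"
      using unit_weight_beta[OF assms(1)] by (simp add: unit_weight_def)
    show "(\<lambda>x. x powr s * beta_weight a b x) \<in> borel_measurable lborel" by measurable
  qed measurable
qed

lemma unit_weight_mellin_conv:
  assumes f: "unit_weight f" and g: "unit_weight g"
  shows "unit_weight (mellin_conv f g)"
proof -
  have [measurable]: "f \<in> borel_measurable borel" "g \<in> borel_measurable borel"
    using f g by (auto simp: unit_weight_def)
  have "mellin_conv f g \<in> borel_measurable borel"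
    unfolding mellin_conv_def[abs_def] set_lebesgue_integral_def by measurable
  moreover have "mellin_conv f g x \<ge> 0" for x
    unfolding mellin_conv_def set_lebesgue_integral_def using f g
    by (intro Bochner_Integration.integral_nonneg) (auto simp: unit_weight_def indicator_def)
  moreover have "mellin_conv f g x = 0" if "x \<le> 0 \<or> x \<ge> 1" for x
  proof -
    have "f u * g (x / u) = 0" if "u > 0" for u
    proof (cases "u < 1 \<and> x > 0")
      case True
      then have "x / u \<ge> 1" using \<open>x \<le> 0 \<or> x \<ge> 1\<close> that by (simp add: field_simps)
      then show ?thesis using g by (simp add: unit_weight_def)
    next
      case False
      then have "u \<ge> 1 \<or> x / u \<le> 0" using that by (auto simp: divide_nonpos_pos)
      then show ?thesis using f g by (auto simp: unit_weight_def)
    qed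
    then have "(\<lambda>u. indicator {0<..} u *\<^sub>R (f u * g (x / u) / u)) = (\<lambda>u. 0)" by (auto simp: indicator_def fun_eq_iff)
    then show ?thesis by (simp add: mellin_conv_def set_lebesgue_integral_def)
  qed
  ultimately show ?thesis by (auto simp: unit_weight_def)
qed

text \<open>For fixed positive \<open>u\<close> the substitution \<open>x = u * y\<close> makes the
  inner integral equal to \<open>u powr s * f u * Mg\<close>: the Jacobian cancels the
  \<open>1 / u\<close> of the convolution.\<close>

lemma mellin_mellin_conv:
  assumes f: "unit_weight f" and g: "unit_weight g"
    and Mf: "has_bochner_integral lborel (\<lambda>x. x powr s * f x) Mf"
    and Mg: "has_bochner_integral lborel (\<lambda>x. x powr s * g x) Mg"
  shows "has_bochner_integral lborel (\<lambda>x. x powr s * mellin_conv f g x) (Mf * Mg)"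
proof -
  have [measurable]: "f \<in> borel_measurable borel" "g \<in> borel_measurable borel"
    using f g by (auto simp: unit_weight_def)
  have "has_bochner_integral lborel
    (\<lambda>x. x powr s * (LBINT u. indicator {0<..} u * (f u * g (x / u) / u))) (Mf * Mg)"
  proof (rule has_bochner_integral_mixture[where \<kappa> = "\<lambda>u. u powr s * f u * Mg"])
    show "has_bochner_integral lborel (\<lambda>x. x powr s * (indicator {0<..} u * (f u * g (x / u) / u))) (u powr s * f u * Mg)" for u
    proof (cases "u > 0")
      case True
      let ?F = "\<lambda>x. x powr s * (indicator {0<..} u * (f u * g (x / u) / u))"
      have eq: "(\<lambda>y. (f u / u * u powr s) * (y powr s * g y)) = (\<lambda>y. ?F (0 + u * y))"
      proof
        fix y
        show "(f u / u * u powr s) * (y powr s * g y) = ?F (0 + u * y)"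
          using True g by (cases "y \<ge> 0") (auto simp: powr_mult unit_weight_def)
      qed
      have v: "(f u / u * u powr s) * Mg = (u powr s * f u * Mg) /\<^sub>R \<bar>u\<bar>" using True by (simp add: field_simps)
      have "has_bochner_integral lborel (\<lambda>y. ?F (0 + u * y)) ((u powr s * f u * Mg) /\<^sub>R \<bar>u\<bar>)"
        using has_bochner_integral_mult_right[OF Mg, of "f u / u * u powr s"] unfolding eq v .
      then show ?thesis
        using True lborel_has_bochner_integral_real_affine_iff[of u ?F "u powr s * f u * Mg" 0] by simp
    next
      case False
      then show ?thesis using f by (auto simp: unit_weight_def has_bochner_integral_zero)
    qed
    show "has_bochner_integral lborel (\<lambda>u. u powr s * f u * Mg) (Mf * Mg)"
      by (rule has_bochner_integral_mult_left[OF Mf])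
    show "indicator {0<..} u * (f u * g (x / u) / u) \<ge> 0" for x u
      using f g by (auto simp: unit_weight_def indicator_def)
  qed (auto simp: case_prod_unfold)
  then show ?thesis by (simp add: mellin_conv_def set_lebesgue_integral_def)
qed

lemma mellin_foldl:
  assumes "unit_weight f" "has_bochner_integral lborel (\<lambda>x. x powr s * f x) (M f)"
    and "\<And>g. g \<in> set gs \<Longrightarrow> unit_weight g \<and> has_bochner_integral lborel (\<lambda>x. x powr s * g x) (M g)"
  shows "unit_weight (foldl mellin_conv f gs) \<and>
    has_bochner_integral lborel (\<lambda>x. x powr s * foldl mellin_conv f gs x) (M f * prod_list (map M gs))"
  using assms(3)
proof (induction gs rule: rev_induct)
  case Nil
  then show ?case using assms by simp
next
  case (snoc g gs)
  then have IH: "unit_weight (foldl mellin_conv f gs)"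
    "has_bochner_integral lborel (\<lambda>x. x powr s * foldl mellin_conv f gs x) (M f * prod_list (map M gs))" by auto
  have g: "unit_weight g" "has_bochner_integral lborel (\<lambda>x. x powr s * g x) (M g)" using snoc.prems by auto
  show ?case using unit_weight_mellin_conv[OF IH(1) g(1)] mellin_mellin_conv[OF IH(1) g(1) IH(2) g(2)]
    by (simp add: mult.assoc)
qed

lemma mellin_jacobi_weight:
  fixes a b :: "nat \<Rightarrow> real"
  defines "b' \<equiv> \<lambda>j h. b h + (if h = j then 1 else 0)"
  assumes "q \<ge> 1" and ab: "\<And>h. h \<in> {1..q} \<Longrightarrow> b h > a h" and s: "\<And>h. h \<in> {1..q} \<Longrightarrow> a h + 1 + s > 0"
  shows "unit_weight (jacobi_weight q a b j)"
    and "has_bochner_integral lborel (\<lambda>x. x powr s * jacobi_weight q a b j x)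
      (\<Prod>h=1..q. Gamma (a h + 1 + s) / Gamma (b' j h + 1 + s))"
proof -
  define \<beta> where "\<beta> h = beta_weight (a h) (b' j h)" for h
  \<comment> \<open>The transform has to be a function of the weight itself, not of its index, to
    fit the product over a list of weights; its value is inserted afterwards.\<close>
  define M where "M g = integral\<^sup>L lborel (\<lambda>x. x powr s * g x)" for g :: "real \<Rightarrow> real"
  have \<beta>: "unit_weight (\<beta> h)" "has_bochner_integral lborel (\<lambda>x. x powr s * \<beta> h x) (Gamma (a h + 1 + s) / Gamma (b' j h + 1 + s))"
    if "h \<in> {1..q}" for h
  proof -
    have "b' j h > a h" using ab[OF that] by (auto simp: b'_def)
    then show "unit_weight (\<beta> h)" "has_bochner_integral lborel (\<lambda>x. x powr s * \<beta> h x) (Gamma (a h + 1 + s) / Gamma (b' j h + 1 + s))"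
      unfolding \<beta>_def using s[OF that] by (auto intro: unit_weight_beta mellin_beta)
  qed
  then have M: "M (\<beta> h) = Gamma (a h + 1 + s) / Gamma (b' j h + 1 + s)" if "h \<in> {1..q}" for h
    using that by (simp add: M_def has_bochner_integral_iff)
  have w: "jacobi_weight q a b j = foldl mellin_conv (\<beta> 1) (map \<beta> [2..<q + 1])"
    by (simp add: jacobi_weight_def \<beta>_def[abs_def] b'_def)
  have "unit_weight (jacobi_weight q a b j) \<and> has_bochner_integral lborel (\<lambda>x. x powr s * jacobi_weight q a b j x)
      (M (\<beta> 1) * prod_list (map M (map \<beta> [2..<q + 1])))"
    unfolding w using \<beta> M \<open>q \<ge> 1\<close> by (intro mellin_foldl) auto
  moreover have "M (\<beta> 1) * prod_list (map M (map \<beta> [2..<q + 1])) = (\<Prod>h=1..q. M (\<beta> h))"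
  proof -
    have "prod_list (map M (map \<beta> [2..<q + 1])) = (\<Prod>h\<in>{2..<q + 1}. M (\<beta> h))"
      using prod.distinct_set_conv_list[of "[2..<q + 1]" "\<lambda>h. M (\<beta> h)"] by (simp add: o_def del: upt_Suc)
    moreover have "{1..q} = insert 1 {2..<q + 1}" using \<open>q \<ge> 1\<close> by auto
    ultimately show ?thesis by simp
  qed
  moreover have "(\<Prod>h=1..q. M (\<beta> h)) = (\<Prod>h=1..q. Gamma (a h + 1 + s) / Gamma (b' j h + 1 + s))"
    using M by (intro prod.cong) auto
  ultimately show "unit_weight (jacobi_weight q a b j)"
    and "has_bochner_integral lborel (\<lambda>x. x powr s * jacobi_weight q a b j x)
      (\<Prod>h=1..q. Gamma (a h + 1 + s) / Gamma (b' j h + 1 + s))" by simp_all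
qed

section \<open>Laplace transforms of the Hermite rows\<close>

lemma gamma_kernel_laplace:
  assumes "d > 0" "\<rho> > 0" "\<rho> + z > (0::real)"
  shows "has_bochner_integral lborel
    (\<lambda>u. indicator {0<..} u * (\<rho> powr d / Gamma d * u powr (d - 1) * exp (- \<rho> * u)) * exp (- z * u))
    ((\<rho> / (\<rho> + z)) powr d)"
proof -
  define c where "c = \<rho> + z"
  have c: "c > 0" using assms by (simp add: c_def)
  have "has_bochner_integral lborel (\<lambda>t. indicator {0..} t * (t powr (d - 1) / exp t)) (Gamma d)"
    using assms by (intro has_bochner_integral_lborel_nonneg Gamma_integral_real) auto
  then have "has_bochner_integral lborel (\<lambda>u. indicator {0..} (0 + c * u) * ((0 + c * u) powr (d - 1) / exp (0 + c * u)))
      (Gamma d /\<^sub>R \<bar>c\<bar>)"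
    using c by (subst (asm) lborel_has_bochner_integral_real_affine_iff[of c _ _ 0]) auto
  then have "has_bochner_integral lborel
     (\<lambda>u. (\<rho> powr d / Gamma d * c powr (1 - d)) * (indicator {0..} (c * u) * ((c * u) powr (d - 1) / exp (c * u))))
     ((\<rho> powr d / Gamma d * c powr (1 - d)) * (Gamma d / c))"
    using c by (intro has_bochner_integral_mult_right) (simp add: divide_inverse mult.commute)
  also have "(\<rho> powr d / Gamma d * c powr (1 - d)) * (Gamma d / c) = (\<rho> / (\<rho> + z)) powr d"
    using assms c less_imp_neq[OF Gamma_real_pos[OF assms(1)]]
    by (simp add: powr_divide powr_diff c_def[symmetric])
  finally show ?thesis
  proof (rule has_bochner_integral_cong_AE[THEN iffD1, rotated 3])
    have "AE u in lborel. u \<noteq> (0::real)" by (rule AE_lborel_singleton)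
    then show "AE u in lborel. (\<rho> powr d / Gamma d * c powr (1 - d)) * (indicator {0..} (c * u) * ((c * u) powr (d - 1) / exp (c * u)))
      = indicator {0<..} u * (\<rho> powr d / Gamma d * u powr (d - 1) * exp (- \<rho> * u)) * exp (- z * u)"
    proof eventually_elim
      case (elim u)
      show ?case
      proof (cases "u > 0")
        case True
        have "c powr (1 - d) * (c * u) powr (d - 1) = u powr (d - 1)"
          using True c by (simp add: powr_mult powr_add[symmetric] mult.assoc[symmetric])
        moreover have "1 / exp (c * u) = exp (- \<rho> * u) * exp (- z * u)"
          by (simp add: c_def exp_minus[symmetric] exp_add[symmetric] algebra_simps inverse_eq_divide[symmetric])
        moreover have "(\<rho> powr d / Gamma d * c powr (1 - d)) * (indicator {0..} (c * u) * ((c * u) powr (d - 1) / exp (c * u)))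
           = \<rho> powr d / Gamma d * (c powr (1 - d) * (c * u) powr (d - 1)) * (1 / exp (c * u))"
          using True c by (simp add: indicator_def)
        ultimately show ?thesis using True by (simp add: indicator_def)
      next
        case False
        then have "u < 0" using elim by auto
        then show ?thesis using c by (simp add: indicator_def zero_le_mult_iff not_le)
      qed
    qed
  qed measurable
qed

definition line_weight :: "(real \<Rightarrow> real) \<Rightarrow> bool" where
  "line_weight f \<longleftrightarrow> f \<in> borel_measurable borel \<and> (\<forall>x. f x \<ge> 0)"

lemma line_weight_gamma_op:
  assumes "d > 0" "line_weight f"
  shows "line_weight (gamma_op \<rho> d f)"
proof -
  have [measurable]: "f \<in> borel_measurable borel" using assms by (simp add: line_weight_def)
  have "gamma_op \<rho> d f \<in> borel_measurable borel"
    unfolding gamma_op_def[abs_def] set_lebesgue_integral_def by measurable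
  moreover have "gamma_op \<rho> d f t \<ge> 0" for t
    unfolding gamma_op_def set_lebesgue_integral_def using assms Gamma_real_pos[of d]
    by (intro Bochner_Integration.integral_nonneg) (auto simp: line_weight_def indicator_def)
  ultimately show ?thesis by (simp add: line_weight_def)
qed

text \<open>The exponential splits as \<open>exp (z * (t + u)) * exp (- z * u)\<close>. Translation
  leaves the transform of \<open>f\<close>, and the kernel is integrated against
  \<open>exp (- z * u)\<close>, which is why \<open>\<rho> + z\<close> appears in the
  denominator.\<close>

lemma laplace_gamma_op:
  assumes "d > 0" "\<rho> > 0" "\<rho> + z > 0" and f: "line_weight f"
    and Lf: "has_bochner_integral lborel (\<lambda>t. f t * exp (z * t)) c"
  shows "has_bochner_integral lborel (\<lambda>t. gamma_op \<rho> d f t * exp (z * t)) ((\<rho> / (\<rho> + z)) powr d * c)"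
proof -
  have [measurable]: "f \<in> borel_measurable borel" using assms by (simp add: line_weight_def)
  define k where "k u = indicator {0<..} u * (\<rho> powr d / Gamma d * u powr (d - 1) * exp (- \<rho> * u))" for u :: real
  have k0: "k u \<ge> 0" for u using assms Gamma_real_pos[of d] by (simp add: k_def indicator_def)
  have [measurable]: "k \<in> borel_measurable borel" unfolding k_def by measurable
  have "has_bochner_integral lborel (\<lambda>t. exp (z * t) * (LBINT u. k u * f (t + u))) ((\<rho> / (\<rho> + z)) powr d * c)"
  proof (rule has_bochner_integral_mixture[where \<kappa> = "\<lambda>u. k u * exp (- z * u) * c"])
    show "has_bochner_integral lborel (\<lambda>t. exp (z * t) * (k u * f (t + u))) (k u * exp (- z * u) * c)" for u
    proof -
      have "has_bochner_integral lborel (\<lambda>t. f (u + 1 * t) * exp (z * (u + 1 * t))) (c /\<^sub>R \<bar>1\<bar>)"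
        using Lf by (subst (asm) lborel_has_bochner_integral_real_affine_iff[of 1 _ _ u]) auto
      then have "has_bochner_integral lborel (\<lambda>t. (k u * exp (- z * u)) * (f (u + 1 * t) * exp (z * (u + 1 * t))))
          ((k u * exp (- z * u)) * (c /\<^sub>R \<bar>1\<bar>))" by (rule has_bochner_integral_mult_right)
      moreover have eq: "(k u * exp (- z * u)) * (f (u + 1 * t) * exp (z * (u + 1 * t))) = exp (z * t) * (k u * f (t + u))" for t
      proof -
        have "exp (z * (u + t)) = exp (z * u) * exp (z * t)" by (simp add: distrib_left exp_add)
        moreover have "exp (- z * u) * exp (z * u) = 1" by (simp add: exp_add[symmetric])
        ultimately show ?thesis by (simp add: add.commute mult_ac)
      qed
      ultimately show ?thesis unfolding eq by simp
    qed
    show "has_bochner_integral lborel (\<lambda>u. k u * exp (- z * u) * c) ((\<rho> / (\<rho> + z)) powr d * c)"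
      unfolding k_def by (intro has_bochner_integral_mult_left gamma_kernel_laplace assms)
    show "k u * f (t + u) \<ge> 0" for t u using k0 f by (simp add: line_weight_def)
  qed (auto simp: case_prod_unfold)
  moreover have "gamma_op \<rho> d f t = (LBINT u. k u * f (t + u))" for t
    unfolding gamma_op_def set_lebesgue_integral_def k_def by (simp only: real_scaleR_def mult.assoc)
  ultimately show ?thesis by (simp add: mult.commute)
qed

lemma laplace_gauss:
  "line_weight (gauss a)" "has_bochner_integral lborel (\<lambda>t. gauss a t * exp (z * t)) (exp (a * z + z\<^sup>2 / 4))"
proof -
  show "line_weight (gauss a)" by (auto simp: line_weight_def gauss_def[abs_def])
  \<comment> \<open>Completing the square gives a normal density with mean \<open>a + z / 2\<close>
    and variance 1/2.\<close>
  let ?n = "normal_density (a + z / 2) (sqrt (1 / 2))"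
  have "gauss a t * exp (z * t) = exp (a * z + z\<^sup>2 / 4) * ?n t" for t
  proof -
    have "- ((t - a)\<^sup>2) + z * t = a * z + z\<^sup>2 / 4 + (- (t - (a + z / 2))\<^sup>2)"
      by (simp add: power2_eq_square algebra_simps)
    then have e: "exp (- ((t - a)\<^sup>2)) * exp (z * t) = exp (a * z + z\<^sup>2 / 4) * exp (- (t - (a + z / 2))\<^sup>2)"
      by (simp only: exp_add[symmetric])
    have p: "pi powr (- 1 / 2) = 1 / sqrt pi"
    proof -
      have "pi powr (- 1 / 2) = inverse (pi powr (1 / 2))" by (simp only: powr_minus[symmetric] minus_divide_left)
      also have "\<dots> = 1 / sqrt pi" by (simp only: powr_half_sqrt[OF pi_ge_zero] inverse_eq_divide)
      finally show ?thesis .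
    qed
    have n: "?n t = 1 / sqrt pi * exp (- (t - (a + z / 2))\<^sup>2)" by (simp add: normal_density_def)
    show ?thesis unfolding n gauss_def p using e by simp
  qed
  moreover have "has_bochner_integral lborel (\<lambda>t. exp (a * z + z\<^sup>2 / 4) * ?n t) (exp (a * z + z\<^sup>2 / 4) * 1)"
    by (intro has_bochner_integral_mult_right) (simp add: has_bochner_integral_iff)
  ultimately show "has_bochner_integral lborel (\<lambda>t. gauss a t * exp (z * t)) (exp (a * z + z\<^sup>2 / 4))" by simp
qed

lemma laplace_F_hermite:
  assumes "\<And>h. h \<in> {1..r} \<Longrightarrow> d h > 0" "\<And>h. h \<in> {1..r} \<Longrightarrow> \<rho> h > 0"
  shows "line_weight (F_hermite r \<rho> d a)"
    and "(\<And>h. h \<in> {1..r} \<Longrightarrow> \<rho> h + z > 0) \<Longrightarrow> has_bochner_integral lborel (\<lambda>t. F_hermite r \<rho> d a t * exp (z * t))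
      ((\<Prod>h=1..r. (\<rho> h / (\<rho> h + z)) powr d h) * exp (a * z + z\<^sup>2 / 4))"
proof -
  have A: "line_weight (foldr (\<lambda>h. gamma_op (\<rho> h) (d h)) hs (gauss a))" if "set hs \<subseteq> {1..r}" for hs
    using that by (induction hs) (auto intro!: laplace_gauss line_weight_gamma_op assms)
  show "line_weight (F_hermite r \<rho> d a)" unfolding F_hermite_def by (intro A) auto
  assume z: "\<And>h. h \<in> {1..r} \<Longrightarrow> \<rho> h + z > 0"
  have "has_bochner_integral lborel (\<lambda>t. foldr (\<lambda>h. gamma_op (\<rho> h) (d h)) hs (gauss a) t * exp (z * t))
      (prod_list (map (\<lambda>h. (\<rho> h / (\<rho> h + z)) powr d h) hs) * exp (a * z + z\<^sup>2 / 4))" if "set hs \<subseteq> {1..r}" for hs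
    using that
  proof (induction hs)
    case (Cons h hs)
    then have h: "h \<in> {1..r}" "set hs \<subseteq> {1..r}" by auto
    from laplace_gamma_op[OF assms(1)[OF h(1)] assms(2)[OF h(1)] z[OF h(1)] A[OF h(2)] Cons.IH[OF h(2)]]
    show ?case by (simp add: mult.assoc)
  qed (simp add: laplace_gauss)
  from this[of "[1..<r + 1]"]
  show "has_bochner_integral lborel (\<lambda>t. F_hermite r \<rho> d a t * exp (z * t))
      ((\<Prod>h=1..r. (\<rho> h / (\<rho> h + z)) powr d h) * exp (a * z + z\<^sup>2 / 4))"
    using prod.distinct_set_conv_list[of "[1..<r + 1]" "\<lambda>h. (\<rho> h / (\<rho> h + z)) powr d h"]
    by (simp add: F_hermite_def atLeastLessThanSuc_atLeastAtMost del: upt_Suc)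
qed

subsection \<open>Gamma ratios\<close>

lemma powr_minus_half: "x > 0 \<Longrightarrow> (x::real) powr (- 1 / 2) = 1 / sqrt x"
proof -
  assume "x > 0"
  have "x powr (- 1 / 2) = inverse (x powr (1 / 2))" by (simp only: powr_minus[symmetric] minus_divide_left)
  also have "\<dots> = 1 / sqrt x" using \<open>x > 0\<close> by (simp only: powr_half_sqrt[OF less_imp_le] inverse_eq_divide)
  finally show ?thesis .
qed

lemma ln_Gamma_mvt:
  fixes x y :: real
  assumes "0 < x" "x < y"
  obtains z where "x < z" "z < y" "ln_Gamma y - ln_Gamma x = (y - x) * Digamma z"
  using MVT2[OF assms(2), of ln_Gamma Digamma] assms(1) has_field_derivative_ln_Gamma_real by fastforce

text \<open>By the mean value theorem on the interval from \<open>x\<close> to \<open>x + 1\<close>,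
  \<open>ln x\<close> is a value of \<open>Digamma\<close> in between. Monotonicity and the step
  \<open>1 / x\<close> of the functional equation then enclose it from both sides.\<close>

lemma Digamma_ln_bounds:
  fixes x :: real
  assumes "x > 0"
  shows "Digamma x \<le> ln x" "ln x - 1 / x \<le> Digamma x"
proof -
  obtain z where z: "x < z" "z < x + 1" "ln_Gamma (x + 1) - ln_Gamma x = (x + 1 - x) * Digamma z"
    using ln_Gamma_mvt[of x "x + 1"] assms by auto
  have "Gamma (x + 1) = x * Gamma x" using assms by (intro Gamma_plus1) auto
  then have "ln_Gamma (x + 1) - ln_Gamma x = ln x"
  proof -
    have "0 < Gamma x" using assms by (rule Gamma_real_pos)
    then have "ln (x * Gamma x) = ln x + ln (Gamma x)" using assms by (intro ln_mult_pos)
    then show ?thesis using assms \<open>Gamma (x + 1) = x * Gamma x\<close> by (simp add: ln_Gamma_real_pos)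
  qed
  then have "ln x = Digamma z" using z by simp
  moreover have "Digamma x \<le> Digamma z" "Digamma z \<le> Digamma (x + 1)"
    using z assms by (auto intro!: Digamma_real_mono)
  moreover have "Digamma (x + 1) = Digamma x + 1 / x" using assms by (intro Digamma_plus1) auto
  ultimately show "Digamma x \<le> ln x" "ln x - 1 / x \<le> Digamma x" by auto
qed

text \<open>The increment is \<open>d\<close> times an intermediate value of \<open>Digamma\<close>,
  which lies at most \<open>1 / x\<close> below and at most \<open>d / x\<close> above
  \<open>ln x\<close>.\<close>

lemma ln_Gamma_shift:
  fixes x d :: real
  assumes "x > 0" "d > 0"
  shows "\<bar>ln_Gamma (x + d) - ln_Gamma x - d * ln x\<bar> \<le> d * (1 + d) / x"
proof -
  obtain z where z: "x < z" "z < x + d" "ln_Gamma (x + d) - ln_Gamma x = (x + d - x) * Digamma z"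
    using ln_Gamma_mvt[of x "x + d"] assms by auto
  have "ln x - 1 / x \<le> Digamma z"
    using Digamma_ln_bounds(2)[of x] Digamma_real_mono[of x z] z assms by linarith
  moreover have "Digamma z \<le> ln z" using Digamma_ln_bounds(1)[of z] z assms by simp
  moreover have "ln z \<le> ln x + d / x"
  proof -
    have "ln (z / x) \<le> z / x - 1" using z assms by (intro ln_le_minus_one) auto
    also have "\<dots> = (z - x) / x" using assms by (simp add: diff_divide_distrib)
    also have "\<dots> \<le> d / x" using z assms by (intro divide_right_mono) auto
    finally show ?thesis using z assms by (simp add: ln_div)
  qed
  moreover have "1 / x \<ge> 0" "d / x \<ge> 0" "(1 + d) / x = 1 / x + d / x"
    using assms by (auto simp: add_divide_distrib)
  ultimately have "\<bar>Digamma z - ln x\<bar> \<le> (1 + d) / x" by linarith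
  then have "d * \<bar>Digamma z - ln x\<bar> \<le> d * ((1 + d) / x)" using assms by (intro mult_left_mono) auto
  moreover have "ln_Gamma (x + d) - ln_Gamma x - d * ln x = d * (Digamma z - ln x)"
    using z by (simp add: algebra_simps)
  ultimately show ?thesis using assms by (simp add: abs_mult)
qed

text \<open>Each logarithmic increment equals \<open>d\<close> times the logarithm of its argument
  up to \<open>O(1 / sqrt \<tau>)\<close>, and the common \<open>sqrt \<tau>\<close>
  cancels.\<close>

lemma gamma_factor_log_conv:
  fixes c \<rho> d :: real
  assumes "c > 0" "\<rho> > 0" "d > 0"
  shows "(\<lambda>\<tau>. (ln_Gamma (c * sqrt \<tau>) - ln_Gamma (c * sqrt \<tau> + d)) - (ln_Gamma (\<rho> * sqrt \<tau>) - ln_Gamma (\<rho> * sqrt \<tau> + d))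
      - d * ln (\<rho> / c)) \<in> O[at_top](\<lambda>\<tau>. \<tau> powr (-1/2))"
proof (rule bigoI)
  show "\<forall>\<^sub>F \<tau> in at_top. norm ((ln_Gamma (c * sqrt \<tau>) - ln_Gamma (c * sqrt \<tau> + d)) - (ln_Gamma (\<rho> * sqrt \<tau>) - ln_Gamma (\<rho> * sqrt \<tau> + d))
      - d * ln (\<rho> / c)) \<le> (d * (1 + d) / c + d * (1 + d) / \<rho>) * norm (\<tau> powr (-1/2))"
    using eventually_gt_at_top[of 0]
  proof eventually_elim
    case (elim \<tau>)
    have s: "sqrt \<tau> > 0" "\<tau> powr (-1/2) = 1 / sqrt \<tau>"
      using elim powr_minus_half by auto
    have "\<bar>ln_Gamma (c * sqrt \<tau> + d) - ln_Gamma (c * sqrt \<tau>) - d * ln (c * sqrt \<tau>)\<bar> \<le> d * (1 + d) / (c * sqrt \<tau>)"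
      using assms s by (intro ln_Gamma_shift) auto
    moreover have "\<bar>ln_Gamma (\<rho> * sqrt \<tau> + d) - ln_Gamma (\<rho> * sqrt \<tau>) - d * ln (\<rho> * sqrt \<tau>)\<bar> \<le> d * (1 + d) / (\<rho> * sqrt \<tau>)"
      using assms s by (intro ln_Gamma_shift) auto
    moreover have "d * ln (\<rho> / c) = d * ln (\<rho> * sqrt \<tau>) - d * ln (c * sqrt \<tau>)"
      using assms s by (simp add: ln_mult ln_div right_diff_distrib distrib_left)
    moreover have "(d * (1 + d) / c + d * (1 + d) / \<rho>) * norm (\<tau> powr (-1/2)) = d * (1 + d) / (c * sqrt \<tau>) + d * (1 + d) / (\<rho> * sqrt \<tau>)"
      unfolding s using s by (simp add: add_divide_distrib)
    ultimately show ?case unfolding real_norm_def by linarith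
  qed
qed

text \<open>Here the shift \<open>y * sqrt \<tau>\<close> is unbounded, so a bound for a fixed shift
  does not apply. The expression is regarded as a function \<open>g\<close> of the shift parameter,
  with the predicted limit subtracted; it suffices that its derivative is \<open>O(e)\<close>
  uniformly between \<open>- \<bar>y\<bar>\<close> and \<open>\<bar>y\<bar>\<close>. The summand
  with \<open>ln 2\<close> comes from centring the original variable at 1/2.\<close>

lemma last_gamma_factor_log_conv:
  fixes a y \<delta> :: real
  assumes "0 \<le> \<delta>" "\<delta> \<le> 1"
  shows "(\<lambda>\<tau>. y * sqrt \<tau> * ln 2 + (ln_Gamma (\<tau> + (a + y) * sqrt \<tau>) - ln_Gamma (2 * \<tau> + y * sqrt \<tau> + \<delta>))
      - (ln_Gamma (\<tau> + a * sqrt \<tau>) - ln_Gamma (2 * \<tau> + \<delta>)) - (a * y + y\<^sup>2 / 4)) \<in> O[at_top](\<lambda>\<tau>. \<tau> powr (-1/2))"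
proof (rule bigoI)
  \<comment> \<open>\<open>K * e\<close> bounds the relative deviations \<open>x1\<close> and
    \<open>x2\<close> below for all \<eta> in range; the summand 1 takes care of \<delta>. Requiring
    it to be less than 1/2 keeps the logarithms in the range of the quadratic bound.\<close>
  define K where "K = \<bar>a\<bar> + \<bar>y\<bar> + 1"
  have "((\<lambda>\<tau>::real. K * \<tau> powr (-1/2)) \<longlongrightarrow> K * 0) at_top" by (intro tendsto_intros) real_asymp
  then have "\<forall>\<^sub>F \<tau> in at_top. K * \<tau> powr (-1/2) < 1/2" by (rule order_tendstoD) simp
  then show "\<forall>\<^sub>F \<tau> in at_top. norm (y * sqrt \<tau> * ln 2 + (ln_Gamma (\<tau> + (a + y) * sqrt \<tau>) - ln_Gamma (2 * \<tau> + y * sqrt \<tau> + \<delta>))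
      - (ln_Gamma (\<tau> + a * sqrt \<tau>) - ln_Gamma (2 * \<tau> + \<delta>)) - (a * y + y\<^sup>2 / 4)) \<le> (\<bar>y\<bar> * (4 * K\<^sup>2 + 5)) * norm (\<tau> powr (-1/2))"
    using eventually_gt_at_top[of 0]
  proof eventually_elim
    case (elim \<tau>)
    define e where "e = \<tau> powr (-1/2)"
    have e: "e > 0" "sqrt \<tau> = 1 / e" "\<tau> = 1 / e\<^sup>2"
    proof -
      show "e > 0" using elim by (simp add: e_def)
      show s: "sqrt \<tau> = 1 / e" using elim unfolding e_def by (subst powr_minus_half) auto
      show "\<tau> = 1 / e\<^sup>2" using elim s by (metis less_imp_le power_one_over real_sqrt_pow2)
    qed
    have Ke: "K * e < 1/2" using elim by (simp add: e_def)
    have K1: "K \<ge> 1" by (simp add: K_def)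
    have e1: "e \<le> 1" using Ke K1 e(1) mult_right_mono[of 1 K e] by linarith
    define g where "g \<eta> = \<eta> * sqrt \<tau> * ln 2 + (ln_Gamma (\<tau> + (a + \<eta>) * sqrt \<tau>) - ln_Gamma (2 * \<tau> + \<eta> * sqrt \<tau> + \<delta>)) - (a * \<eta> + \<eta>\<^sup>2 / 4)" for \<eta>
    define g' where "g' \<eta> = sqrt \<tau> * ln 2 + (Digamma (\<tau> + (a + \<eta>) * sqrt \<tau>) * sqrt \<tau> - Digamma (2 * \<tau> + \<eta> * sqrt \<tau> + \<delta>) * sqrt \<tau>) - (a + \<eta> / 2)" for \<eta>
    have bound: "(g has_field_derivative g' \<eta>) (at \<eta>) \<and> norm (g' \<eta>) \<le> (4 * K\<^sup>2 + 5) * e" if \<eta>: "\<bar>\<eta>\<bar> \<le> \<bar>y\<bar>" for \<eta>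
    proof -
      define x1 where "x1 = (a + \<eta>) * e"
      define x2 where "x2 = (\<eta> * e + \<delta> * e\<^sup>2) / 2"
      have x1: "\<bar>x1\<bar> \<le> K * e" unfolding x1_def K_def using e(1) \<eta> by (simp add: abs_mult mult_right_mono)
      have x2: "\<bar>x2\<bar> \<le> K * e"
      proof -
        have "\<bar>\<eta> * e\<bar> \<le> \<bar>y\<bar> * e" using e(1) \<eta> by (simp add: abs_mult mult_right_mono)
        moreover have "\<bar>\<delta> * e\<^sup>2\<bar> \<le> 1 * e"
          unfolding abs_mult power2_eq_square using assms e(1) e1 by (intro mult_mono) (auto simp: mult_left_le_one_le)
        ultimately have "\<bar>\<eta> * e + \<delta> * e\<^sup>2\<bar> \<le> \<bar>y\<bar> * e + e"
          using abs_triangle_ineq[of "\<eta> * e" "\<delta> * e\<^sup>2"] by linarith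
        also have "\<dots> \<le> K * e" using e(1) by (simp add: K_def algebra_simps)
        finally show ?thesis unfolding x2_def by simp
      qed
      have X1: "\<tau> + (a + \<eta>) * sqrt \<tau> = \<tau> * (1 + x1)" and X2: "2 * \<tau> + \<eta> * sqrt \<tau> + \<delta> = 2 * \<tau> * (1 + x2)"
        using e(1) unfolding e(2) x1_def x2_def unfolding e(3) by (simp_all add: field_simps power2_eq_square)
      have pos: "1 + x1 \<ge> 1/2" "1 + x2 \<ge> 1/2" using x1 x2 Ke by linarith+
      have P1: "\<tau> * (1 + x1) \<ge> \<tau> / 2" and P2: "2 * \<tau> * (1 + x2) \<ge> \<tau>"
        using mult_left_mono[OF pos(1), of \<tau>] mult_left_mono[OF pos(2), of "2 * \<tau>"] elim by auto
      have P: "\<tau> * (1 + x1) > 0" "2 * \<tau> * (1 + x2) > 0" using P1 P2 elim by linarith+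
      have der: "(g has_field_derivative g' \<eta>) (at \<eta>)"
        unfolding g_def g'_def using P X1 X2 by (auto intro!: derivative_eq_intros simp: algebra_simps)
      have "\<bar>Digamma (\<tau> * (1 + x1)) - ln (\<tau> * (1 + x1))\<bar> \<le> 1 / (\<tau> * (1 + x1))"
        using Digamma_ln_bounds[OF P(1)] P(1) by auto
      also have "\<dots> \<le> 1 / (\<tau> / 2)" using P1 elim by (intro divide_left_mono) auto
      also have "\<dots> = 2 * e\<^sup>2" unfolding e(3) using e(1) by simp
      finally have D1: "\<bar>Digamma (\<tau> * (1 + x1)) - ln (\<tau> * (1 + x1))\<bar> \<le> 2 * e\<^sup>2" .
      have "\<bar>Digamma (2 * \<tau> * (1 + x2)) - ln (2 * \<tau> * (1 + x2))\<bar> \<le> 1 / (2 * \<tau> * (1 + x2))"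
        using Digamma_ln_bounds[OF P(2)] P(2) by auto
      also have "\<dots> \<le> 1 / \<tau>" using P2 elim by (intro divide_left_mono) auto
      also have "\<dots> = e\<^sup>2" unfolding e(3) using e(1) by simp
      finally have D2: "\<bar>Digamma (2 * \<tau> * (1 + x2)) - ln (2 * \<tau> * (1 + x2))\<bar> \<le> e\<^sup>2" .
      have sq: "2 * x\<^sup>2 \<le> 2 * K\<^sup>2 * e\<^sup>2" if "\<bar>x\<bar> \<le> K * e" for x
        using power_mono[OF that, of 2] by (simp add: power_mult_distrib)
      have L1: "\<bar>ln (1 + x1) - x1\<bar> \<le> 2 * K\<^sup>2 * e\<^sup>2"
        using abs_ln_one_plus_x_minus_x_bound[of x1] sq[OF x1] x1 Ke by linarith
      have L2: "\<bar>ln (1 + x2) - x2\<bar> \<le> 2 * K\<^sup>2 * e\<^sup>2"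
        using abs_ln_one_plus_x_minus_x_bound[of x2] sq[OF x2] x2 Ke by linarith
      have ln: "ln (\<tau> * (1 + x1)) = ln \<tau> + ln (1 + x1)" "ln (2 * \<tau> * (1 + x2)) = ln 2 + ln \<tau> + ln (1 + x2)"
        using pos elim by (simp_all add: ln_mult)
      define E where "E = (Digamma (\<tau> * (1 + x1)) - ln (\<tau> * (1 + x1))) - (Digamma (2 * \<tau> * (1 + x2)) - ln (2 * \<tau> * (1 + x2)))
         + (ln (1 + x1) - x1) - (ln (1 + x2) - x2)"
      have E: "\<bar>E\<bar> \<le> (4 * K\<^sup>2 + 3) * e\<^sup>2" unfolding E_def distrib_right using D1 D2 L1 L2 by linarith
      have "g' \<eta> = (ln 2 + Digamma (\<tau> * (1 + x1)) - Digamma (2 * \<tau> * (1 + x2))) / e - (a + \<eta> / 2)"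
        unfolding g'_def X1 X2 unfolding e(2) by (simp add: diff_divide_distrib add_divide_distrib)
      also have "ln 2 + Digamma (\<tau> * (1 + x1)) - Digamma (2 * \<tau> * (1 + x2)) = E + (x1 - x2)"
        unfolding E_def ln by simp
      \<comment> \<open>Here the limit emerges: \<open>(x1 - x2) / e\<close> is
        \<open>a + \<eta> / 2 - \<delta> * e / 2\<close>, and its main part is exactly the
        subtracted derivative.\<close>
      also have "(E + (x1 - x2)) / e - (a + \<eta> / 2) = E / e - \<delta> * e / 2"
        using e(1) by (simp add: x1_def x2_def field_simps power2_eq_square)
      finally have g'E: "g' \<eta> = E / e - \<delta> * e / 2" .
      have "norm (g' \<eta>) \<le> \<bar>E / e\<bar> + \<bar>\<delta> * e / 2\<bar>" unfolding g'E real_norm_def by (rule abs_triangle_ineq4)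
      then have "norm (g' \<eta>) \<le> \<bar>E\<bar> / e + \<delta> * e / 2" using e(1) assms by (simp add: abs_divide abs_mult)
      also have "\<bar>E\<bar> / e \<le> (4 * K\<^sup>2 + 3) * e\<^sup>2 / e" using E e(1) by (intro divide_right_mono) auto
      also have "\<dots> = (4 * K\<^sup>2 + 3) * e" using e(1) by (simp add: power2_eq_square)
      finally have "norm (g' \<eta>) \<le> (4 * K\<^sup>2 + 3) * e + \<delta> * e / 2" by simp
      moreover have "\<delta> * e \<le> e" using assms e(1) by (simp add: mult_left_le_one_le)
      ultimately have "norm (g' \<eta>) \<le> (4 * K\<^sup>2 + 5) * e" unfolding distrib_right using e(1) by linarith
      then show ?thesis using der by blast
    qed
    \<comment> \<open>\<open>g 0\<close> is the logarithm of the normalizing ratio, so this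
      difference is the quantity to be estimated.\<close>
    have "norm (g y - g 0) \<le> (4 * K\<^sup>2 + 5) * e * norm (y - 0)"
    proof (rule field_differentiable_bound[where S = "{- \<bar>y\<bar>..\<bar>y\<bar>}" and f' = g'])
      fix z assume "z \<in> {- \<bar>y\<bar>..\<bar>y\<bar>}"
      then have "\<bar>z\<bar> \<le> \<bar>y\<bar>" by auto
      from bound[OF this] show "(g has_field_derivative g' z) (at z within {- \<bar>y\<bar>..\<bar>y\<bar>})" "norm (g' z) \<le> (4 * K\<^sup>2 + 5) * e"
        by (auto intro: has_field_derivative_at_within)
    qed auto
    then show ?case using e(1) unfolding e_def[symmetric] by (simp add: g_def algebra_simps)
  qed
qed

lemma exp_bigo:
  fixes u :: "'a \<Rightarrow> real"
  assumes "(\<lambda>x. u x - l) \<in> O[F](\<epsilon>)" "(\<epsilon> \<longlongrightarrow> 0) F"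
  shows "(\<lambda>x. exp (u x) - exp l) \<in> O[F](\<epsilon>)"
proof -
  have "((\<lambda>x. u x - l) \<longlongrightarrow> 0) F" using assms by (rule bigo_tendsto_0)
  then have "\<forall>\<^sub>F x in F. dist (u x - l) 0 < 1" by (rule tendstoD) simp
  then have "(\<lambda>x. exp (u x) - exp l) \<in> O[F](\<lambda>x. u x - l)"
  proof (intro bigoI[of _ "exp l * (1 + exp 1)"], eventually_elim)
    case (elim x)
    define v where "v = u x - l"
    have v: "\<bar>v\<bar> < 1" using elim by (simp add: v_def)
    have "\<bar>exp v - 1\<bar> \<le> \<bar>v\<bar> + v\<^sup>2 * exp \<bar>v\<bar>" using exp_taylor2[of v] by linarith
    also have "v\<^sup>2 * exp \<bar>v\<bar> \<le> \<bar>v\<bar> * exp 1"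
    proof (rule mult_mono)
      have "\<bar>v\<bar> * \<bar>v\<bar> \<le> \<bar>v\<bar> * 1" using v by (intro mult_left_mono) auto
      then show "v\<^sup>2 \<le> \<bar>v\<bar>" by (simp add: power2_eq_square)
    qed (use v in auto)
    finally have "\<bar>exp v - 1\<bar> \<le> (1 + exp 1) * \<bar>v\<bar>" by (simp add: algebra_simps)
    then have "exp l * \<bar>exp v - 1\<bar> \<le> exp l * ((1 + exp 1) * \<bar>v\<bar>)" by (intro mult_left_mono) auto
    moreover have "exp (u x) - exp l = exp l * (exp v - 1)" by (simp add: v_def right_diff_distrib exp_add[symmetric])
    ultimately show ?case by (simp add: abs_mult v_def mult.assoc)
  qed
  then show ?thesis using assms(1) by (rule landau_o.big_trans)
qed

lemma gamma_ratio_conv: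
  fixes a y \<delta> :: real and \<rho> d :: "nat \<Rightarrow> real"
  assumes \<delta>: "0 \<le> \<delta>" "\<delta> \<le> 1"
    and h: "\<And>h. h \<in> {1..r} \<Longrightarrow> d h > 0" "\<And>h. h \<in> {1..r} \<Longrightarrow> \<rho> h > 0" "\<And>h. h \<in> {1..r} \<Longrightarrow> \<rho> h + y > 0"
  shows "(\<lambda>\<tau>. 2 powr (y * sqrt \<tau>)
      * (\<Prod>h=1..r. (Gamma ((\<rho> h + y) * sqrt \<tau>) / Gamma ((\<rho> h + y) * sqrt \<tau> + d h)) / (Gamma (\<rho> h * sqrt \<tau>) / Gamma (\<rho> h * sqrt \<tau> + d h)))
      * ((Gamma (\<tau> + (a + y) * sqrt \<tau>) / Gamma (2 * \<tau> + y * sqrt \<tau> + \<delta>)) / (Gamma (\<tau> + a * sqrt \<tau>) / Gamma (2 * \<tau> + \<delta>)))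
      - (\<Prod>h=1..r. (\<rho> h / (\<rho> h + y)) powr d h) * exp (a * y + y\<^sup>2 / 4)) \<in> O[at_top](\<lambda>\<tau>. \<tau> powr (-1/2))"
proof -
  define A where "A h \<tau> = (ln_Gamma ((\<rho> h + y) * sqrt \<tau>) - ln_Gamma ((\<rho> h + y) * sqrt \<tau> + d h)) - (ln_Gamma (\<rho> h * sqrt \<tau>) - ln_Gamma (\<rho> h * sqrt \<tau> + d h))" for h \<tau>
  define B where "B \<tau> = (ln_Gamma (\<tau> + (a + y) * sqrt \<tau>) - ln_Gamma (2 * \<tau> + y * sqrt \<tau> + \<delta>)) - (ln_Gamma (\<tau> + a * sqrt \<tau>) - ln_Gamma (2 * \<tau> + \<delta>))" for \<tau>
  define u where "u \<tau> = (\<Sum>h=1..r. A h \<tau>) + (y * sqrt \<tau> * ln 2 + B \<tau>)" for \<tau>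
  define l where "l = (\<Sum>h=1..r. d h * ln (\<rho> h / (\<rho> h + y))) + (a * y + y\<^sup>2 / 4)"
  have "(\<lambda>\<tau>. (\<Sum>h=1..r. A h \<tau> - d h * ln (\<rho> h / (\<rho> h + y))) + (y * sqrt \<tau> * ln 2 + B \<tau> - (a * y + y\<^sup>2 / 4))) \<in> O[at_top](\<lambda>\<tau>. \<tau> powr (-1/2))"
  proof (rule sum_in_bigo)
    show "(\<lambda>\<tau>. \<Sum>h=1..r. A h \<tau> - d h * ln (\<rho> h / (\<rho> h + y))) \<in> O[at_top](\<lambda>\<tau>. \<tau> powr (-1/2))"
      unfolding A_def by (intro big_sum_in_bigo gamma_factor_log_conv h)
    show "(\<lambda>\<tau>. y * sqrt \<tau> * ln 2 + B \<tau> - (a * y + y\<^sup>2 / 4)) \<in> O[at_top](\<lambda>\<tau>. \<tau> powr (-1/2))"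
      using last_gamma_factor_log_conv[OF \<delta>, of y a] by (simp add: B_def algebra_simps)
  qed
  then have "(\<lambda>\<tau>. u \<tau> - l) \<in> O[at_top](\<lambda>\<tau>. \<tau> powr (-1/2))"
    by (simp add: u_def l_def sum_subtractf algebra_simps)
  moreover have "((\<lambda>\<tau>::real. \<tau> powr (-1/2)) \<longlongrightarrow> 0) at_top" by real_asymp
  ultimately have E: "(\<lambda>\<tau>. exp (u \<tau>) - exp l) \<in> O[at_top](\<lambda>\<tau>. \<tau> powr (-1/2))" by (rule exp_bigo)
  have l: "exp l = (\<Prod>h=1..r. (\<rho> h / (\<rho> h + y)) powr d h) * exp (a * y + y\<^sup>2 / 4)"
  proof -
    have "exp (d h * ln (\<rho> h / (\<rho> h + y))) = (\<rho> h / (\<rho> h + y)) powr d h" if "h \<in> {1..r}" for h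
      using h(2,3)[OF that] by (simp add: powr_def)
    then show ?thesis by (simp add: l_def exp_add exp_sum)
  qed
  have eG: "exp (ln_Gamma x) = Gamma x" if "x > 0" for x :: real
    using that by (simp add: ln_Gamma_real_pos Gamma_real_pos)
  have "\<forall>\<^sub>F \<tau>::real in at_top. \<tau> > 0 \<and> sqrt \<tau> > \<bar>a\<bar> + \<bar>y\<bar> + 1"
    by (intro eventually_conj eventually_gt_at_top) real_asymp
  then have ev: "\<forall>\<^sub>F \<tau> in at_top. exp (u \<tau>) - exp l = 2 powr (y * sqrt \<tau>)
      * (\<Prod>h=1..r. (Gamma ((\<rho> h + y) * sqrt \<tau>) / Gamma ((\<rho> h + y) * sqrt \<tau> + d h)) / (Gamma (\<rho> h * sqrt \<tau>) / Gamma (\<rho> h * sqrt \<tau> + d h)))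
      * ((Gamma (\<tau> + (a + y) * sqrt \<tau>) / Gamma (2 * \<tau> + y * sqrt \<tau> + \<delta>)) / (Gamma (\<tau> + a * sqrt \<tau>) / Gamma (2 * \<tau> + \<delta>))) - exp l"
  proof eventually_elim
    case (elim \<tau>)
    have s: "sqrt \<tau> > 0" using elim by simp
    have pos: "\<tau> + c * sqrt \<tau> > 0" if "\<bar>c\<bar> < sqrt \<tau>" for c
    proof -
      have "\<tau> + c * sqrt \<tau> = (sqrt \<tau> + c) * sqrt \<tau>" using elim by (simp add: algebra_simps)
      also have "\<dots> > 0" using that s by (intro mult_pos_pos) auto
      finally show ?thesis .
    qed
    have p: "\<tau> + (a + y) * sqrt \<tau> > 0" "\<tau> + a * sqrt \<tau> > 0" "\<tau> + y * sqrt \<tau> > 0" using elim by (auto intro!: pos)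
    then have p': "2 * \<tau> + y * sqrt \<tau> + \<delta> > 0" "2 * \<tau> + \<delta> > 0" using elim \<delta> by linarith+
    have "exp (A h \<tau>) = (Gamma ((\<rho> h + y) * sqrt \<tau>) / Gamma ((\<rho> h + y) * sqrt \<tau> + d h)) / (Gamma (\<rho> h * sqrt \<tau>) / Gamma (\<rho> h * sqrt \<tau> + d h))"
      if "h \<in> {1..r}" for h
    proof -
      have "(\<rho> h + y) * sqrt \<tau> > 0" "\<rho> h * sqrt \<tau> > 0" using h(2,3)[OF that] s by auto
      then show ?thesis using h(1)[OF that] unfolding A_def exp_diff by (subst eG, simp)+ simp
    qed
    moreover have "exp (B \<tau>) = (Gamma (\<tau> + (a + y) * sqrt \<tau>) / Gamma (2 * \<tau> + y * sqrt \<tau> + \<delta>)) / (Gamma (\<tau> + a * sqrt \<tau>) / Gamma (2 * \<tau> + \<delta>))"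
      unfolding B_def exp_diff using p p' by (simp add: eG)
    moreover have "exp (y * sqrt \<tau> * ln 2) = 2 powr (y * sqrt \<tau>)" by (simp add: powr_def)
    ultimately show ?case unfolding u_def exp_add by (simp add: exp_sum mult_ac)
  qed
  show ?thesis using E unfolding landau_o.big.in_cong[OF ev] unfolding l .
qed

subsection \<open>Convergence of the Jacobi moments\<close>

definition laplace_limit :: "nat \<Rightarrow> (nat \<Rightarrow> real) \<Rightarrow> (nat \<Rightarrow> real) \<Rightarrow> real \<Rightarrow> real \<Rightarrow> real" where
  "laplace_limit r \<rho> d a z = (\<Prod>h=1..r. (\<rho> h / (\<rho> h + z)) powr d h) * exp (a * z + z\<^sup>2 / 4)"

text \<open>Row \<open>j \<le> r\<close> differs from row \<open>r + 1\<close> by raising the shape parameter \<open>d j\<close> by one.\<close>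

definition row_shape :: "(nat \<Rightarrow> real) \<Rightarrow> nat \<Rightarrow> nat \<Rightarrow> real" where
  "row_shape d j h = d h + (if h = j then 1 else 0)"

lemma laplace_limit_pos:
  assumes "\<And>h. h \<in> {1..r} \<Longrightarrow> \<rho> h > 0" "\<And>h. h \<in> {1..r} \<Longrightarrow> \<rho> h + z > 0"
  shows "laplace_limit r \<rho> d a z > 0"
  unfolding laplace_limit_def using assms less_imp_neq
  by (intro mult_pos_pos prod_pos) (fastforce simp: powr_gt_zero)+

text \<open>On the domain the product of powers is the exponential of a sum of logarithms, so its
  logarithmic derivative can be read off.\<close>

lemma laplace_limit_derivative:
  assumes \<rho>: "\<And>h. h \<in> {1..r} \<Longrightarrow> \<rho> h > 0" and z: "\<And>h. h \<in> {1..r} \<Longrightarrow> \<rho> h + z > 0"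
  shows "(laplace_limit r \<rho> d a has_field_derivative
     laplace_limit r \<rho> d a z * (a + z / 2 - (\<Sum>h=1..r. d h / (\<rho> h + z)))) (at z)"
proof -
  define E where "E z = exp ((\<Sum>h=1..r. d h * (ln (\<rho> h) - ln (\<rho> h + z))) + (a * z + z\<^sup>2 / 4))" for z
  let ?D = "{z. \<forall>h\<in>{1..r}. \<rho> h + z > 0}"
  have eq: "laplace_limit r \<rho> d a z = E z" if "z \<in> ?D" for z
  proof -
    have "(\<rho> h / (\<rho> h + z)) powr d h = exp (d h * (ln (\<rho> h) - ln (\<rho> h + z)))" if "h \<in> {1..r}" for h
    proof -
      have "\<rho> h > 0" "\<rho> h + z > 0" using \<rho>[OF that] \<open>z \<in> ?D\<close> that by auto
      then show ?thesis by (simp add: powr_def ln_div)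
    qed
    then show ?thesis by (simp add: laplace_limit_def E_def exp_add exp_sum)
  qed
  have "?D = (\<Inter>h\<in>{1..r}. {z. \<rho> h + z > 0})" by auto
  moreover have "open (\<Inter>h\<in>{1..r}. {z. \<rho> h + z > 0})"
    by (intro open_INT ballI open_Collect_less continuous_intros) auto
  ultimately have "open ?D" by simp
  have "(E has_field_derivative E z * ((\<Sum>h=1..r. d h * (0 - 1 / (\<rho> h + z))) + (a + z / 2))) (at z)"
    unfolding E_def
    by (rule derivative_eq_intros DERIV_sum refl z | simp)+
  also have "E z * ((\<Sum>h=1..r. d h * (0 - 1 / (\<rho> h + z))) + (a + z / 2)) =
      laplace_limit r \<rho> d a z * (a + z / 2 - (\<Sum>h=1..r. d h / (\<rho> h + z)))"
    using z by (simp add: eq sum_negf)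
  finally show ?thesis
    by (rule has_field_derivative_transform_within_open[OF _ \<open>open ?D\<close>]) (use z eq in auto)
qed

lemma laplace_limit_row_shape:
  assumes "j \<in> {1..Suc r}" "j \<le> r \<Longrightarrow> \<rho> j > 0 \<and> \<rho> j + z > 0"
  shows "laplace_limit r \<rho> (row_shape d j) a z = laplace_limit r \<rho> d a z * (if j \<le> r then \<rho> j / (\<rho> j + z) else 1)"
proof -
  have "(\<Prod>h=1..r. (\<rho> h / (\<rho> h + z)) powr row_shape d j h) =
     (\<Prod>h=1..r. (\<rho> h / (\<rho> h + z)) powr d h * (if h = j then \<rho> h / (\<rho> h + z) else 1))"
    using assms by (intro prod.cong) (auto simp: row_shape_def powr_add)
  also have "\<dots> = (\<Prod>h=1..r. (\<rho> h / (\<rho> h + z)) powr d h) * (if j \<le> r then \<rho> j / (\<rho> j + z) else 1)"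
    using assms(1) by (simp add: prod.distrib)
  finally show ?thesis by (simp add: laplace_limit_def)
qed

lemma laplace_U_hermite:
  assumes d: "\<And>h. h \<in> {1..r} \<Longrightarrow> d h > 0" and \<rho>: "\<And>h. h \<in> {1..r} \<Longrightarrow> \<rho> h > 0" and j: "j \<in> {1..Suc r}"
  shows "line_weight (U_hermite r \<rho> d a j)"
    and "(\<And>h. h \<in> {1..r} \<Longrightarrow> \<rho> h + z > 0) \<Longrightarrow>
      has_bochner_integral lborel (\<lambda>t. U_hermite r \<rho> d a j t * exp (z * t)) (laplace_limit r \<rho> (row_shape d j) a z)"
proof -
  note F = laplace_F_hermite[of r d \<rho>, OF d \<rho>]
  show "line_weight (U_hermite r \<rho> d a j)"
    using F(1) by (cases "j \<le> r") (auto simp: U_hermite_def[abs_def] intro!: line_weight_gamma_op)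
  assume z: "\<And>h. h \<in> {1..r} \<Longrightarrow> \<rho> h + z > 0"
  have "has_bochner_integral lborel (\<lambda>t. F_hermite r \<rho> d a t * exp (z * t)) (laplace_limit r \<rho> d a z)"
    using F(2)[OF _ _ z] unfolding laplace_limit_def by simp
  moreover from laplace_gamma_op[OF zero_less_one \<rho> z F(1) this, of j]
  have "has_bochner_integral lborel (\<lambda>t. gamma_op (\<rho> j) 1 (F_hermite r \<rho> d a) t * exp (z * t))
      (\<rho> j / (\<rho> j + z) * laplace_limit r \<rho> d a z)" if "j \<le> r"
    using that j \<rho>[of j] z[of j] by simp
  moreover have "laplace_limit r \<rho> (row_shape d j) a z = laplace_limit r \<rho> d a z * (if j \<le> r then \<rho> j / (\<rho> j + z) else 1)"
    using j \<rho> z by (intro laplace_limit_row_shape) auto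
  ultimately show "has_bochner_integral lborel (\<lambda>t. U_hermite r \<rho> d a j t * exp (z * t)) (laplace_limit r \<rho> (row_shape d j) a z)"
    by (cases "j \<le> r") (auto simp: U_hermite_def mult.commute)
qed

section \<open>Exact moment identities at finite \<tau>\<close>

lemma scale_facts:
  fixes \<tau> :: real
  assumes "\<tau> > 0"
  shows "\<tau> powr (-1/2) > 0" "sqrt \<tau> = 1 / \<tau> powr (-1/2)" "\<tau> powr (-1/2) * sqrt \<tau> = 1"
    "\<tau> * \<tau> powr (-1/2) = sqrt \<tau>" "\<tau> = sqrt \<tau> * sqrt \<tau>"
proof -
  show e: "\<tau> powr (-1/2) > 0" using assms by simp
  show "sqrt \<tau> = 1 / \<tau> powr (-1/2)" unfolding powr_minus_half[OF assms] by simp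
  show "\<tau> powr (-1/2) * sqrt \<tau> = 1" unfolding powr_minus_half[OF assms] using assms by simp
  show "\<tau> = sqrt \<tau> * sqrt \<tau>" using assms by simp
  then show "\<tau> * \<tau> powr (-1/2) = sqrt \<tau>" unfolding powr_minus_half[OF assms]
    using assms by (metis div_by_1 nonzero_mult_div_cancel_right real_sqrt_eq_zero_cancel_iff less_irrefl times_divide_eq_right mult_1_right)
qed

lemma scaled_argument_pos:
  fixes \<tau> :: real
  assumes "\<tau> > 0" "1 + c * \<tau> powr (-1/2) > 0"
  shows "\<tau> + c * sqrt \<tau> > 0"
proof -
  have "0 < \<tau> * (1 + c * \<tau> powr (-1/2))" using assms by (intro mult_pos_pos)
  also have "\<dots> = \<tau> + c * (\<tau> * \<tau> powr (-1/2))" by (simp add: algebra_simps)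
  finally show ?thesis unfolding scale_facts(4)[OF assms(1)] .
qed

text \<open>Together with positive rates this makes every Gamma argument positive, at
  \<open>y\<close> and at the normalizing value 0, in a form stable under the shift of
  \<open>y\<close>. The condition with \<open>1 - a * \<tau> powr (-1/2)\<close> is
  \<open>b > a\<close> for the last beta weight; added to the one with \<open>a + y\<close> it
  yields \<open>2 + y * \<tau> powr (-1/2) > 0\<close>.\<close>

definition jacobi_ok :: "nat \<Rightarrow> (nat \<Rightarrow> real) \<Rightarrow> real \<Rightarrow> real \<Rightarrow> real \<Rightarrow> bool" where
  "jacobi_ok r \<rho> a \<tau> y \<longleftrightarrow> \<tau> > 0 \<and> (\<forall>h\<in>{1..r}. \<rho> h + y > 0) \<and> 1 + (a + y) * \<tau> powr (-1/2) > 0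
     \<and> 1 + a * \<tau> powr (-1/2) > 0 \<and> 1 - a * \<tau> powr (-1/2) > 0"

text \<open>This is the Mellin transform of the weight in row \<open>j\<close> at
  \<open>y * sqrt \<tau>\<close>; at \<open>y = 0\<close> it is the normalization
  \<open>Z_jacobi\<close>.\<close>

definition mellin_ratio :: "nat \<Rightarrow> (nat \<Rightarrow> real) \<Rightarrow> (nat \<Rightarrow> real) \<Rightarrow> real \<Rightarrow> nat \<Rightarrow> real \<Rightarrow> real \<Rightarrow> real" where
  "mellin_ratio r \<rho> d a j \<tau> y =
     (\<Prod>h=1..r. Gamma ((\<rho> h + y) * sqrt \<tau>) / Gamma ((\<rho> h + y) * sqrt \<tau> + row_shape d j h))
     * (Gamma (\<tau> + (a + y) * sqrt \<tau>) / Gamma (2 * \<tau> + y * sqrt \<tau> + (if j = Suc r then 1 else 0)))"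

lemma mellin_w_jacobi:
  assumes d: "\<And>h. h \<in> {1..r} \<Longrightarrow> d h > 0" and \<rho>: "\<And>h. h \<in> {1..r} \<Longrightarrow> \<rho> h > 0" and ok: "jacobi_ok r \<rho> a \<tau> y"
  shows "unit_weight (w_jacobi r \<rho> d a \<tau> j)"
    and "has_bochner_integral lborel (\<lambda>x. x powr (y * sqrt \<tau>) * w_jacobi r \<rho> d a \<tau> j x) (mellin_ratio r \<rho> d a j \<tau> y)"
proof -
  let ?a = "param_a r \<rho> a \<tau>" and ?b = "param_b r \<rho> d a \<tau>"
  have \<tau>: "\<tau> > 0" using ok by (simp add: jacobi_ok_def)
  note pos = scaled_argument_pos[OF \<tau>]
  have ab: "?b h > ?a h" if "h \<in> {1..r + 1}" for h
    using d[of h] that pos[of "- a"] ok by (auto simp: param_a_def param_b_def jacobi_ok_def)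
  have s: "?a h + 1 + y * sqrt \<tau> > 0" if "h \<in> {1..r + 1}" for h
  proof (cases "h \<le> r")
    case True
    then have "(\<rho> h + y) * sqrt \<tau> > 0" using ok that \<tau> by (auto simp: jacobi_ok_def)
    then show ?thesis using True by (simp add: param_a_def algebra_simps)
  next
    case False
    then show ?thesis using pos[of "a + y"] ok by (simp add: param_a_def jacobi_ok_def algebra_simps)
  qed
  have v: "(\<Prod>h=1..r + 1. Gamma (?a h + 1 + y * sqrt \<tau>) / Gamma ((?b h + (if h = j then 1 else 0)) + 1 + y * sqrt \<tau>))
      = mellin_ratio r \<rho> d a j \<tau> y"
  proof -
    have "Gamma (?a h + 1 + y * sqrt \<tau>) / Gamma ((?b h + (if h = j then 1 else 0)) + 1 + y * sqrt \<tau>) =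
      Gamma ((\<rho> h + y) * sqrt \<tau>) / Gamma ((\<rho> h + y) * sqrt \<tau> + row_shape d j h)" if "h \<in> {1..r}" for h
    proof -
      have "?a h + 1 + y * sqrt \<tau> = (\<rho> h + y) * sqrt \<tau>"
        "(?b h + (if h = j then 1 else 0)) + 1 + y * sqrt \<tau> = (\<rho> h + y) * sqrt \<tau> + row_shape d j h"
        using that by (simp_all add: param_a_def param_b_def row_shape_def algebra_simps)
      then show ?thesis by (simp only:)
    qed
    moreover have "Gamma (?a (r + 1) + 1 + y * sqrt \<tau>) / Gamma ((?b (r + 1) + (if r + 1 = j then 1 else 0)) + 1 + y * sqrt \<tau>) =
       Gamma (\<tau> + (a + y) * sqrt \<tau>) / Gamma (2 * \<tau> + y * sqrt \<tau> + (if j = Suc r then 1 else 0))"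
    proof -
      have "?a (r + 1) + 1 + y * sqrt \<tau> = \<tau> + (a + y) * sqrt \<tau>"
        "(?b (r + 1) + (if r + 1 = j then 1 else 0)) + 1 + y * sqrt \<tau> = 2 * \<tau> + y * sqrt \<tau> + (if j = Suc r then 1 else 0)"
        by (auto simp: param_a_def param_b_def algebra_simps)
      then show ?thesis by (simp only:)
    qed
    ultimately show ?thesis by (simp add: mellin_ratio_def)
  qed
  show "unit_weight (w_jacobi r \<rho> d a \<tau> j)"
    unfolding w_jacobi_def by (rule mellin_jacobi_weight(1)[where s = "y * sqrt \<tau>"]) (use ab s in auto)
  show "has_bochner_integral lborel (\<lambda>x. x powr (y * sqrt \<tau>) * w_jacobi r \<rho> d a \<tau> j x) (mellin_ratio r \<rho> d a j \<tau> y)"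
    unfolding v[symmetric] w_jacobi_def by (rule mellin_jacobi_weight(2)) (use ab s in auto)
qed

lemma mellin_ratio_pos:
  assumes d: "\<And>h. h \<in> {1..r} \<Longrightarrow> d h > 0" and ok: "jacobi_ok r \<rho> a \<tau> y"
  shows "mellin_ratio r \<rho> d a j \<tau> y > 0"
proof -
  have \<tau>: "\<tau> > 0" using ok by (simp add: jacobi_ok_def)
  note pos = scaled_argument_pos[OF \<tau>]
  have p: "\<tau> + (a + y) * sqrt \<tau> > 0" "\<tau> + - a * sqrt \<tau> > 0" using ok by (intro pos; simp add: jacobi_ok_def)+
  then have p2: "2 * \<tau> + y * sqrt \<tau> > 0" by (simp add: algebra_simps)
  have "Gamma ((\<rho> h + y) * sqrt \<tau>) / Gamma ((\<rho> h + y) * sqrt \<tau> + row_shape d j h) > 0" if "h \<in> {1..r}" for h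
  proof -
    have "(\<rho> h + y) * sqrt \<tau> > 0" "row_shape d j h > 0"
      using ok d[OF that] that \<tau> by (auto simp: jacobi_ok_def row_shape_def)
    then show ?thesis by (intro divide_pos_pos Gamma_real_pos add_pos_pos)
  qed
  moreover have "Gamma (\<tau> + (a + y) * sqrt \<tau>) / Gamma (2 * \<tau> + y * sqrt \<tau> + (if j = Suc r then 1 else 0)) > 0"
  proof -
    have "2 * \<tau> + y * sqrt \<tau> + (if j = Suc r then 1 else 0) > 0" using p2 by simp
    then show ?thesis using p(1) by (intro divide_pos_pos Gamma_real_pos)
  qed
  ultimately show ?thesis unfolding mellin_ratio_def by (intro mult_pos_pos prod_pos) auto
qed

text \<open>Since \<open>e * sqrt \<tau> = 1\<close>, the shift by \<open>e\<close> raises each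
  Gamma argument by exactly one, and the functional equation leaves rational factors, each written
  as 1 plus \<open>e\<close> times a tame function. The 2 on the left stems from
  \<open>2 powr (y * sqrt \<tau>)\<close> and brings the last factor, close to 1/2, into this form
  too.\<close>

lemma mellin_ratio_shift:
  fixes j :: nat
  assumes d: "\<And>h. h \<in> {1..r} \<Longrightarrow> d h > 0" and ok: "jacobi_ok r \<rho> a \<tau> y"
  defines "e \<equiv> \<tau> powr (-1/2)" and "\<delta> \<equiv> (if j = Suc r then 1 else 0)"
  shows "2 * mellin_ratio r \<rho> d a j \<tau> (y + e) =
    (\<Prod>h=1..r. 1 + e * ((- row_shape d j h) * (1 / (\<rho> h + y + row_shape d j h * e))))
     * (1 + e * ((2 * a + y + (- \<delta>) * e) * (1 / (2 + y * e + \<delta> * e\<^sup>2)))) * mellin_ratio r \<rho> d a j \<tau> y"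
proof -
  have \<tau>: "\<tau> > 0" using ok by (simp add: jacobi_ok_def)
  have e: "e > 0" "sqrt \<tau> = 1 / e" "e * sqrt \<tau> = 1" "\<tau> = 1 / e\<^sup>2"
    using scale_facts[OF \<tau>] unfolding e_def by (auto simp: power2_eq_square)
  have \<delta>: "\<delta> \<ge> 0" by (simp add: \<delta>_def)
  have okn: "1 + (a + y) * e > 0" "1 - a * e > 0" "\<And>h. h \<in> {1..r} \<Longrightarrow> \<rho> h + y > 0"
    using ok by (auto simp: jacobi_ok_def e_def)
  have Gr: "Gamma (x + 1) / Gamma (z + 1) = x / z * (Gamma x / Gamma z)" if "x > 0" "z > 0" for x z :: real
  proof -
    have "Gamma (x + 1) = x * Gamma x" "Gamma (z + 1) = z * Gamma z" using that by (auto intro!: Gamma_plus1)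
    then show ?thesis by simp
  qed
  have 1: "Gamma ((\<rho> h + (y + e)) * sqrt \<tau>) / Gamma ((\<rho> h + (y + e)) * sqrt \<tau> + row_shape d j h) =
     (1 + e * ((- row_shape d j h) * (1 / (\<rho> h + y + row_shape d j h * e)))) *
      (Gamma ((\<rho> h + y) * sqrt \<tau>) / Gamma ((\<rho> h + y) * sqrt \<tau> + row_shape d j h))" if h: "h \<in> {1..r}" for h
  proof -
    define R D where "R = \<rho> h + y" and "D = row_shape d j h"
    have RD: "R > 0" "D > 0" using okn(3)[OF h] d[OF h] by (auto simp: R_def D_def row_shape_def)
    have "(\<rho> h + (y + e)) * sqrt \<tau> = R * sqrt \<tau> + 1" using e(3) by (simp add: R_def algebra_simps)
    moreover have "R * sqrt \<tau> + 1 + D = (R * sqrt \<tau> + D) + 1" by simp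
    moreover have "R * sqrt \<tau> > 0" "R * sqrt \<tau> + D > 0" using RD \<tau> by (auto intro: add_pos_pos)
    moreover have "R * sqrt \<tau> / (R * sqrt \<tau> + D) = 1 + e * ((- D) * (1 / (R + D * e)))"
    proof -
      have "R + D * e > 0" using RD e(1) by (intro add_pos_pos) auto
      then show ?thesis unfolding e(2) using e(1) RD by (simp add: divide_simps)
    qed
    ultimately show ?thesis unfolding R_def[symmetric] D_def[symmetric] by (simp only: Gr)
  qed
  have 2: "2 * (Gamma (\<tau> + (a + (y + e)) * sqrt \<tau>) / Gamma (2 * \<tau> + (y + e) * sqrt \<tau> + \<delta>)) =
     (1 + e * ((2 * a + y + (- \<delta>) * e) * (1 / (2 + y * e + \<delta> * e\<^sup>2)))) *
       (Gamma (\<tau> + (a + y) * sqrt \<tau>) / Gamma (2 * \<tau> + y * sqrt \<tau> + \<delta>))"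
  proof -
    have X: "\<tau> + (a + y) * sqrt \<tau> = (1 + (a + y) * e) / e\<^sup>2" "2 * \<tau> + y * sqrt \<tau> + \<delta> = (2 + y * e + \<delta> * e\<^sup>2) / e\<^sup>2"
      unfolding e(2) unfolding e(4) using e(1) by (simp_all add: field_simps power2_eq_square)
    have "2 + y * e > 0" using okn(1,2) by (simp add: algebra_simps)
    moreover have "\<delta> * e\<^sup>2 \<ge> 0" using \<delta> by simp
    ultimately have B: "2 + y * e + \<delta> * e\<^sup>2 > 0" by linarith
    have pos: "\<tau> + (a + y) * sqrt \<tau> > 0" "2 * \<tau> + y * sqrt \<tau> + \<delta> > 0"
      unfolding X using okn(1) B e(1) by (auto intro!: divide_pos_pos)
    have q: "2 * ((\<tau> + (a + y) * sqrt \<tau>) / (2 * \<tau> + y * sqrt \<tau> + \<delta>)) = 1 + e * ((2 * a + y + (- \<delta>) * e) * (1 / (2 + y * e + \<delta> * e\<^sup>2)))"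
      unfolding X using e(1) B by (simp add: divide_simps power2_eq_square) (simp add: algebra_simps)
    have "\<tau> + (a + (y + e)) * sqrt \<tau> = (\<tau> + (a + y) * sqrt \<tau>) + 1" "2 * \<tau> + (y + e) * sqrt \<tau> + \<delta> = (2 * \<tau> + y * sqrt \<tau> + \<delta>) + 1"
      using e(3) by (simp_all add: algebra_simps)
    then show ?thesis unfolding q[symmetric] by (simp only: Gr[OF pos])
  qed
  have 3: "(\<Prod>h=1..r. Gamma ((\<rho> h + (y + e)) * sqrt \<tau>) / Gamma ((\<rho> h + (y + e)) * sqrt \<tau> + row_shape d j h)) =
     (\<Prod>h=1..r. 1 + e * ((- row_shape d j h) * (1 / (\<rho> h + y + row_shape d j h * e)))) *
     (\<Prod>h=1..r. Gamma ((\<rho> h + y) * sqrt \<tau>) / Gamma ((\<rho> h + y) * sqrt \<tau> + row_shape d j h))"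
    unfolding prod.distrib[symmetric] by (intro prod.cong refl 1)
  have comb: "2 * (A' * B') = F * q * (A * B)" if "A' = F * A" "2 * B' = q * B" for A A' B B' F q :: real
  proof -
    have "2 * (A' * B') = A' * (2 * B')" by simp
    then show ?thesis unfolding that by simp
  qed
  show ?thesis unfolding mellin_ratio_def \<delta>_def[symmetric] by (rule comb[OF 3 2])
qed

lemma eventually_jacobi_ok:
  assumes "\<And>h. h \<in> {1..r} \<Longrightarrow> \<rho> h + y > 0"
  shows "\<forall>\<^sub>F \<tau> in at_top. jacobi_ok r \<rho> a \<tau> y"
proof -
  have "\<forall>\<^sub>F \<tau>::real in at_top. 1 + c * \<tau> powr (-1/2) > 0" for c
  proof -
    have "((\<lambda>\<tau>::real. 1 + c * \<tau> powr (-1/2)) \<longlongrightarrow> 1 + c * 0) at_top" by (intro tendsto_intros) real_asymp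
    then show ?thesis by (rule order_tendstoD) simp
  qed
  from this[of "a + y"] this[of a] this[of "- a"] eventually_gt_at_top[of 0]
  show ?thesis by eventually_elim (use assms in \<open>auto simp: jacobi_ok_def\<close>)
qed

definition jacobi_moment ::
    "nat \<Rightarrow> (nat \<Rightarrow> real) \<Rightarrow> (nat \<Rightarrow> real) \<Rightarrow> real \<Rightarrow> nat \<Rightarrow> real \<Rightarrow> nat \<Rightarrow> real \<Rightarrow> real" where
  "jacobi_moment r \<rho> d a j \<tau> v y =
     (LBINT t:I_jacobi \<tau>. t ^ v * V_jacobi r \<rho> d a \<tau> j t * (1 + \<tau> powr (-1/2) * t) powr (y * sqrt \<tau>))"

lemma jacobi_ok_0: "jacobi_ok r \<rho> a \<tau> y \<Longrightarrow> (\<And>h. h \<in> {1..r} \<Longrightarrow> \<rho> h > 0) \<Longrightarrow> jacobi_ok r \<rho> a \<tau> 0"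
  by (simp add: jacobi_ok_def)

lemma jacobi_ok_shift:
  assumes "jacobi_ok r \<rho> a \<tau> y"
  shows "jacobi_ok r \<rho> a \<tau> (y + \<tau> powr (-1/2))"
proof -
  have "\<tau> powr (-1/2) > 0" using assms by (intro scale_facts(1)) (simp add: jacobi_ok_def)
  then have "\<tau> powr (-1/2) > 0" "\<tau> powr (-1/2) * \<tau> powr (-1/2) > 0" by (simp_all only: mult_pos_pos)
  then show ?thesis using assms unfolding jacobi_ok_def distrib_right distrib_left
    by (auto simp del: powr_gt_zero intro: add_pos_pos simp: add.assoc[symmetric])
qed

text \<open>The change of variable \<open>x = (1 + e * t) / 2\<close> turns the moment of order zero
  into a Mellin transform. The weight vanishes outside \<open>I_jacobi\<close>, so the restriction
  to the interval is harmless, and \<open>2 powr (y * sqrt \<tau>)\<close> undoes the halving inside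
  the power.\<close>

lemma jacobi_moment_0:
  assumes d: "\<And>h. h \<in> {1..r} \<Longrightarrow> d h > 0" and \<rho>: "\<And>h. h \<in> {1..r} \<Longrightarrow> \<rho> h > 0" and ok: "jacobi_ok r \<rho> a \<tau> y"
  shows "set_integrable lborel (I_jacobi \<tau>) (\<lambda>t. V_jacobi r \<rho> d a \<tau> j t * (1 + \<tau> powr (-1/2) * t) powr (y * sqrt \<tau>))"
    and "jacobi_moment r \<rho> d a j \<tau> 0 y = 2 powr (y * sqrt \<tau>) * (mellin_ratio r \<rho> d a j \<tau> y / mellin_ratio r \<rho> d a j \<tau> 0)"
    and "\<And>t. V_jacobi r \<rho> d a \<tau> j t \<ge> 0"
proof -
  define e where "e = \<tau> powr (-1/2)"
  define s where "s = y * sqrt \<tau>"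
  define w where "w = w_jacobi r \<rho> d a \<tau> j"
  define Z where "Z = mellin_ratio r \<rho> d a j \<tau> 0"
  have \<tau>: "\<tau> > 0" using ok by (simp add: jacobi_ok_def)
  have e: "e > 0" "sqrt \<tau> = 1 / e" using scale_facts[OF \<tau>] by (auto simp: e_def)
  have w: "unit_weight w" unfolding w_def by (rule mellin_w_jacobi(1)[OF d \<rho> ok])
  have M: "has_bochner_integral lborel (\<lambda>x. x powr s * w x) (mellin_ratio r \<rho> d a j \<tau> y)"
    unfolding w_def s_def by (rule mellin_w_jacobi(2)[OF d \<rho> ok])
  have "has_bochner_integral lborel (\<lambda>x. x powr (0 * sqrt \<tau>) * w x) Z"
    unfolding w_def Z_def by (rule mellin_w_jacobi(2)[OF d \<rho> jacobi_ok_0[OF ok \<rho>]])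
  moreover have "(\<lambda>x. x powr (0 * sqrt \<tau>) * w x) = (\<lambda>x. indicator {0<..<1} x *\<^sub>R w x)"
  proof
    fix x
    have "w x = 0" if "\<not> (0 < x \<and> x < 1)" using w that by (auto simp: unit_weight_def not_less)
    then show "x powr (0 * sqrt \<tau>) * w x = indicator {0<..<1} x *\<^sub>R w x" by (cases "0 < x \<and> x < 1") auto
  qed
  ultimately have Z: "Z_jacobi r \<rho> d a \<tau> j = Z"
    by (simp add: Z_jacobi_def set_lebesgue_integral_def has_bochner_integral_iff w_def)
  have Z0: "Z > 0" unfolding Z_def by (rule mellin_ratio_pos[OF d jacobi_ok_0[OF ok \<rho>]])
  have V: "V_jacobi r \<rho> d a \<tau> j t = e / (2 * Z) * w ((1 + e * t) / 2)" for t
    by (simp only: V_jacobi_def Let_def Z e_def w_def)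
  show "V_jacobi r \<rho> d a \<tau> j t \<ge> 0" for t unfolding V using w Z0 e by (auto simp: unit_weight_def)
  let ?F = "\<lambda>x. x powr s * w x"
  define K where "K = 2 powr s * (e / (2 * Z))"
  have "has_bochner_integral lborel (\<lambda>t. ?F (1/2 + e/2 * t)) (mellin_ratio r \<rho> d a j \<tau> y /\<^sub>R \<bar>e/2\<bar>)"
    using e(1) by (intro lborel_has_bochner_integral_real_affine_iff[THEN iffD1, OF _ M]) simp
  then have "has_bochner_integral lborel (\<lambda>t. K * ?F (1/2 + e/2 * t)) (K * (mellin_ratio r \<rho> d a j \<tau> y /\<^sub>R \<bar>e/2\<bar>))"
    by (rule has_bochner_integral_mult_right)
  moreover have "K * (mellin_ratio r \<rho> d a j \<tau> y /\<^sub>R \<bar>e/2\<bar>) = 2 powr s * (mellin_ratio r \<rho> d a j \<tau> y / Z)"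
    using e(1) Z0 by (simp add: K_def field_simps)
  moreover have "(\<lambda>t. K * ?F (1/2 + e/2 * t)) = (\<lambda>t. indicator (I_jacobi \<tau>) t *\<^sub>R (V_jacobi r \<rho> d a \<tau> j t * (1 + e * t) powr s))"
  proof
    fix t
    have x: "1/2 + e/2 * t = (1 + e * t) / 2" by (simp add: field_simps)
    show "K * ?F (1/2 + e/2 * t) = indicator (I_jacobi \<tau>) t *\<^sub>R (V_jacobi r \<rho> d a \<tau> j t * (1 + e * t) powr s)"
    proof (cases "t \<in> I_jacobi \<tau>")
      case True
      then have "- 1 < e * t" using e(1) unfolding I_jacobi_def e(2) by (simp add: field_simps)
      then have "2 powr s * ((1 + e * t) / 2) powr s = (1 + e * t) powr s"
      proof -
        have "(2 * ((1 + e * t) / 2)) powr s = 2 powr s * ((1 + e * t) / 2) powr s"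
          by (rule powr_mult)
        moreover have "2 * ((1 + e * t) / 2) = 1 + e * t" by simp
        ultimately show ?thesis by (simp only:)
      qed
      then show ?thesis using True unfolding x V K_def by (simp add: mult_ac)
    next
      case False
      then have "(1 + e * t) / 2 \<le> 0 \<or> (1 + e * t) / 2 \<ge> 1"
        using e(1) unfolding I_jacobi_def e(2) by (auto simp: field_simps)
      then have "w ((1 + e * t) / 2) = 0" using w unfolding unit_weight_def by blast
      then show ?thesis using False unfolding x by simp
    qed
  qed
  ultimately have "has_bochner_integral lborel (\<lambda>t. indicator (I_jacobi \<tau>) t *\<^sub>R (V_jacobi r \<rho> d a \<tau> j t * (1 + e * t) powr s))
     (2 powr s * (mellin_ratio r \<rho> d a j \<tau> y / Z))" by simp
  then show "set_integrable lborel (I_jacobi \<tau>) (\<lambda>t. V_jacobi r \<rho> d a \<tau> j t * (1 + \<tau> powr (-1/2) * t) powr (y * sqrt \<tau>))"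
    and "jacobi_moment r \<rho> d a j \<tau> 0 y = 2 powr (y * sqrt \<tau>) * (mellin_ratio r \<rho> d a j \<tau> y / mellin_ratio r \<rho> d a j \<tau> 0)"
    unfolding e_def[symmetric] s_def[symmetric] Z_def[symmetric] jacobi_moment_def set_integrable_def set_lebesgue_integral_def
    by (simp_all add: has_bochner_integral_iff)
qed

text \<open>On the interval \<open>e * t\<close> is \<open>(1 + e * t) - 1\<close>, and
  multiplication by \<open>1 + e * t\<close> is the shift from \<open>y\<close> to
  \<open>y + e\<close>. Each power of \<open>t\<close> is thus reduced to a lower one at two
  arguments, for integrability as well as for the value.\<close>

lemma jacobi_moment_integrable:
  assumes d: "\<And>h. h \<in> {1..r} \<Longrightarrow> d h > 0" and \<rho>: "\<And>h. h \<in> {1..r} \<Longrightarrow> \<rho> h > 0" and ok: "jacobi_ok r \<rho> a \<tau> y"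
  shows "set_integrable lborel (I_jacobi \<tau>) (\<lambda>t. t ^ v * V_jacobi r \<rho> d a \<tau> j t * (1 + \<tau> powr (-1/2) * t) powr (y * sqrt \<tau>))"
    and "jacobi_moment r \<rho> d a j \<tau> v (y + \<tau> powr (-1/2)) =
       jacobi_moment r \<rho> d a j \<tau> v y + \<tau> powr (-1/2) * jacobi_moment r \<rho> d a j \<tau> (Suc v) y"
proof -
  define e where "e = \<tau> powr (-1/2)"
  have \<tau>: "\<tau> > 0" using ok by (simp add: jacobi_ok_def)
  have e: "e > 0" "sqrt \<tau> = 1 / e" "e * sqrt \<tau> = 1" using scale_facts[OF \<tau>] by (auto simp: e_def)
  let ?f = "\<lambda>v y t. t ^ v * V_jacobi r \<rho> d a \<tau> j t * (1 + e * t) powr (y * sqrt \<tau>)"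
  have rel: "?f (Suc v) y t = (?f v (y + e) t - ?f v y t) / e" if "t \<in> I_jacobi \<tau>" for v y t
  proof -
    have "1 + e * t > 0" using that e(1) unfolding I_jacobi_def e(2) by (simp add: field_simps)
    then have "(1 + e * t) powr ((y + e) * sqrt \<tau>) = (1 + e * t) powr (y * sqrt \<tau>) * (1 + e * t)"
      using e(3) by (simp add: distrib_right powr_add)
    then show ?thesis using e(1) by (simp add: field_simps)
  qed
  have int: "set_integrable lborel (I_jacobi \<tau>) (?f v y)" if "jacobi_ok r \<rho> a \<tau> y" for v y
    using that
  proof (induction v arbitrary: y)
    case 0
    then show ?case using jacobi_moment_0(1)[OF d \<rho>] by (simp add: e_def)
  next
    case (Suc v)
    have "set_integrable lborel (I_jacobi \<tau>) (\<lambda>t. (?f v (y + e) t - ?f v y t) / e)"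
      using Suc.IH[OF Suc.prems] Suc.IH[OF jacobi_ok_shift[OF Suc.prems, folded e_def]]
      by (intro set_integral_diff set_integrable_divide)
    then show ?case
      by (rule set_integrable_cong[THEN iffD1, rotated -1]) (simp_all only: rel)
  qed
  show "set_integrable lborel (I_jacobi \<tau>) (\<lambda>t. t ^ v * V_jacobi r \<rho> d a \<tau> j t * (1 + \<tau> powr (-1/2) * t) powr (y * sqrt \<tau>))"
    using int[OF ok] unfolding e_def .
  have "jacobi_moment r \<rho> d a j \<tau> (Suc v) y = (LBINT t:I_jacobi \<tau>. (?f v (y + e) t - ?f v y t) / e)"
    unfolding jacobi_moment_def e_def[symmetric] 
    by (rule set_lebesgue_integral_cong, simp add: I_jacobi_def, intro allI impI, rule rel)
  also have "\<dots> = ((LBINT t:I_jacobi \<tau>. ?f v (y + e) t) - (LBINT t:I_jacobi \<tau>. ?f v y t)) / e"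
    using set_integral_diff(2)[OF int[OF jacobi_ok_shift[OF ok, folded e_def]] int[OF ok], of v v] by simp
  finally show "jacobi_moment r \<rho> d a j \<tau> v (y + \<tau> powr (-1/2)) =
       jacobi_moment r \<rho> d a j \<tau> v y + \<tau> powr (-1/2) * jacobi_moment r \<rho> d a j \<tau> (Suc v) y"
    using e(1) unfolding jacobi_moment_def e_def[symmetric] by (simp add: field_simps)
qed

text \<open>The cross terms carry a further factor \<open>e\<close>, so at \<open>e = 0\<close> only
  the sum of the \<open>p h\<close> remains, as for a logarithmic derivative of a product.\<close>

lemma tame_prod:
  assumes "finite H" "\<And>h. h \<in> H \<Longrightarrow> tame R (p h)"
  shows "\<exists>P. tame R P \<and> (\<forall>e y. (\<Prod>h\<in>H. 1 + e * p h e y) = 1 + e * P e y) \<and> (\<forall>y. P 0 y = (\<Sum>h\<in>H. p h 0 y))"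
  using assms
proof (induction H rule: finite_induct)
  case empty
  show ?case by (intro exI[of _ "\<lambda>e y. 0"]) (auto intro: tame.intros)
next
  case (insert h H)
  then obtain P where P: "tame R P" "\<And>e y. (\<Prod>h\<in>H. 1 + e * p h e y) = 1 + e * P e y" "\<And>y. P 0 y = (\<Sum>h\<in>H. p h 0 y)"
    by auto
  have "tame R (\<lambda>e y. p h e y + P e y + e * (p h e y * P e y))"
    using insert.prems P(1) by (intro tame.intros) auto
  then show ?case using insert.hyps P(2,3)
    by (intro exI[of _ "\<lambda>e y. p h e y + P e y + e * (p h e y * P e y)"]) (auto simp: algebra_simps)
qed

lemma jacobi_moment_conv:
  assumes d: "\<And>h. h \<in> {1..r} \<Longrightarrow> d h > 0" and \<rho>: "\<And>h. h \<in> {1..r} \<Longrightarrow> \<rho> h > 0" and j: "j \<in> {1..Suc r}"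
    and y: "\<And>h. h \<in> {1..r} \<Longrightarrow> \<rho> h + y > 0"
  shows "(\<lambda>\<tau>. jacobi_moment r \<rho> d a j \<tau> v y - (LBINT t. t ^ v * U_hermite r \<rho> d a j t * exp (y * t)))
     \<in> O[at_top](\<lambda>\<tau>. \<tau> powr (-1/2))"
proof -
  let ?R = "\<rho> ` {1..r}" and ?U = "U_hermite r \<rho> d a j"
  define D where "D = {y. \<forall>h\<in>?R. h + y > 0}"
  define \<delta> :: real where "\<delta> = (if j = Suc r then 1 else 0)"
  have shape: "row_shape d j h > 0" if "h \<in> {1..r}" for h using d[OF that] by (auto simp: row_shape_def)
  have U: "line_weight ?U" using laplace_U_hermite(1)[OF d \<rho> j] .
  have L: "has_bochner_integral lborel (\<lambda>t. ?U t * exp (z * t)) (laplace_limit r \<rho> (row_shape d j) a z)" if "z \<in> D" for z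
    using laplace_U_hermite(2)[OF d \<rho> j] that by (auto simp: D_def)
  have "D = (\<Inter>h\<in>?R. {y. h + y > 0})" by (auto simp: D_def)
  moreover have "open (\<Inter>h\<in>?R. {y. h + y > 0})"
    by (intro open_INT ballI open_Collect_less continuous_intros) auto
  ultimately have "open D" by simp
  have "tame ?R (\<lambda>e y. (- row_shape d j h) * (1 / (\<rho> h + y + row_shape d j h * e)))" if "h \<in> {1..r}" for h
    using shape[OF that] that by (intro tame.mult tame.const tame.recip_rate) auto
  then have "\<exists>P. tame ?R P \<and>
      (\<forall>e y. (\<Prod>h=1..r. 1 + e * ((- row_shape d j h) * (1 / (\<rho> h + y + row_shape d j h * e)))) = 1 + e * P e y) \<and>
      (\<forall>y. P 0 y = (\<Sum>h=1..r. (- row_shape d j h) * (1 / (\<rho> h + y + row_shape d j h * 0))))"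
    by (intro tame_prod[where p = "\<lambda>h e y. (- row_shape d j h) * (1 / (\<rho> h + y + row_shape d j h * e))"]) auto
  then obtain P1 where P1': "tame ?R P1 \<and>
      (\<forall>e y. (\<Prod>h=1..r. 1 + e * ((- row_shape d j h) * (1 / (\<rho> h + y + row_shape d j h * e)))) = 1 + e * P1 e y) \<and>
      (\<forall>y. P1 0 y = (\<Sum>h=1..r. (- row_shape d j h) * (1 / (\<rho> h + y + row_shape d j h * 0))))" ..
  note P1 = P1'[THEN conjunct1] P1'[THEN conjunct2, THEN conjunct1, rule_format] P1'[THEN conjunct2, THEN conjunct2, rule_format]
  let ?P2 = "\<lambda>e y. (2 * a + y + (- \<delta>) * e) * (1 / (2 + y * e + \<delta> * e\<^sup>2))"
  define P where "P e y = P1 e y + ?P2 e y + e * (P1 e y * ?P2 e y)" for e y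
  have tP2: "tame ?R ?P2" by (intro tame.intros) (simp add: \<delta>_def)
  have tP: "tame ?R P" unfolding P_def[abs_def]
    by (rule tame.add[OF tame.add[OF P1(1) tP2] tame.mult[OF tame.eps tame.mult[OF P1(1) tP2]]])
  have "1 + e * (p + q + e * (p * q)) = (1 + e * p) * (1 + e * q)" for e p q :: real
    by (simp add: algebra_simps)
  then have PP: "1 + e * P e y = (1 + e * P1 e y) * (1 + e * ?P2 e y)" for e y unfolding P_def .
  \<comment> \<open>At \<open>e = 0\<close> the relative increment becomes the logarithmic
    derivative of the limit transform; this identifies the two towers.\<close>
  have P0: "P 0 y = a + y / 2 - (\<Sum>h=1..r. row_shape d j h / (\<rho> h + y))" for y
    by (simp add: P_def P1(3) sum_negf add_divide_distrib)
  have \<epsilon>: "((\<lambda>\<tau>::real. \<tau> powr (-1/2)) \<longlongrightarrow> 0) at_top" "\<forall>\<^sub>F \<tau>::real in at_top. \<tau> powr (-1/2) > 0"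
    by real_asymp+
  have m0: "jacobi_moment r \<rho> d a j \<tau> 0 y = 2 powr (y * sqrt \<tau>) * (mellin_ratio r \<rho> d a j \<tau> y / mellin_ratio r \<rho> d a j \<tau> 0)"
    if "jacobi_ok r \<rho> a \<tau> y" for \<tau> y by (rule jacobi_moment_0(2)[OF d \<rho> that])
  have \<mu>0: "(LBINT t. t ^ 0 * ?U t * exp (z * t)) = laplace_limit r \<rho> (row_shape d j) a z" if "z \<in> D" for z
    using L[OF that] by (simp add: has_bochner_integral_iff)
  show ?thesis
  proof (rule moment_tower_conv[where P = P and ok = "jacobi_ok r \<rho> a" and R = ?R and J = "jacobi_moment r \<rho> d a j"
        and \<mu> = "\<lambda>v y. LBINT t. t ^ v * ?U t * exp (y * t)" and v = v and y = y, OF tP])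
    fix \<tau> y assume ok: "jacobi_ok r \<rho> a \<tau> y"
    show "jacobi_ok r \<rho> a \<tau> (y + \<tau> powr (-1/2))" by (rule jacobi_ok_shift[OF ok])
    show "\<tau> powr (-1/2) > 0 \<and> (\<forall>\<rho>\<in>?R. \<rho> + y > 0) \<and> 2 + y * \<tau> powr (-1/2) > 0"
      using ok scale_facts(1)[of \<tau>] by (auto simp: jacobi_ok_def distrib_right)
    show "jacobi_moment r \<rho> d a j \<tau> v (y + \<tau> powr (-1/2)) =
       jacobi_moment r \<rho> d a j \<tau> v y + \<tau> powr (-1/2) * jacobi_moment r \<rho> d a j \<tau> (Suc v) y" for v
      by (rule jacobi_moment_integrable(2)[OF d \<rho> ok])
    \<comment> \<open>The exponent grows by one unit; the resulting factor 2 is the one that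
      \<open>mellin_ratio_shift\<close> expects.\<close>
    have p: "2 powr ((y + \<tau> powr (-1/2)) * sqrt \<tau>) = 2 powr (y * sqrt \<tau>) * 2"
      using scale_facts(3)[of \<tau>] ok by (simp add: jacobi_ok_def distrib_right powr_add)
    show "jacobi_moment r \<rho> d a j \<tau> 0 (y + \<tau> powr (-1/2)) =
       (1 + \<tau> powr (-1/2) * P (\<tau> powr (-1/2)) y) * jacobi_moment r \<rho> d a j \<tau> 0 y"
    proof -
      have "2 * mellin_ratio r \<rho> d a j \<tau> (y + \<tau> powr (-1/2)) =
          (1 + \<tau> powr (-1/2) * P (\<tau> powr (-1/2)) y) * mellin_ratio r \<rho> d a j \<tau> y"
        using mellin_ratio_shift[where r = r and d = d and j = j, OF d ok] unfolding P1(2) \<delta>_def[symmetric] PP .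
      then show ?thesis
        unfolding m0[OF jacobi_ok_shift[OF ok]] m0[OF ok] p by simp
    qed
  next
    fix y assume y: "\<forall>\<rho>\<in>?R. \<rho> + y > 0"
    show "\<forall>\<^sub>F \<tau> in at_top. jacobi_ok r \<rho> a \<tau> y" using y by (intro eventually_jacobi_ok) auto
    have yD: "y \<in> D" using y by (simp add: D_def)
    show "((\<lambda>y. LBINT t. t ^ v * ?U t * exp (y * t)) has_field_derivative (LBINT t. t ^ Suc v * ?U t * exp (y * t))) (at y)" for v
      using U L by (intro exp_moment_derivative[OF _ \<open>open D\<close> yD]) (auto simp: line_weight_def has_bochner_integral_iff)
    have "(laplace_limit r \<rho> (row_shape d j) a has_field_derivative
       laplace_limit r \<rho> (row_shape d j) a y * (a + y / 2 - (\<Sum>h=1..r. row_shape d j h / (\<rho> h + y)))) (at y)"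
      using y by (intro laplace_limit_derivative \<rho>) auto
    then have "((\<lambda>y. LBINT t. t ^ 0 * ?U t * exp (y * t)) has_field_derivative
       laplace_limit r \<rho> (row_shape d j) a y * (a + y / 2 - (\<Sum>h=1..r. row_shape d j h / (\<rho> h + y)))) (at y)"
      by (rule has_field_derivative_transform_within_open[OF _ \<open>open D\<close> yD]) (rule \<mu>0[symmetric])
    then show "((\<lambda>y. LBINT t. t ^ 0 * ?U t * exp (y * t)) has_field_derivative P 0 y * (LBINT t. t ^ 0 * ?U t * exp (y * t))) (at y)"
      unfolding \<mu>0[OF yD] P0 by (simp add: mult.commute)
  next
    show "\<forall>\<rho>\<in>?R. \<rho> + y > 0" using y by auto
    then have yD: "y \<in> D" by (simp add: D_def)
    have "\<forall>\<^sub>F \<tau> in at_top. jacobi_ok r \<rho> a \<tau> y" by (rule eventually_jacobi_ok[OF y])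
    then have "\<forall>\<^sub>F \<tau> in at_top. 2 powr (y * sqrt \<tau>)
      * (\<Prod>h=1..r. (Gamma ((\<rho> h + y) * sqrt \<tau>) / Gamma ((\<rho> h + y) * sqrt \<tau> + row_shape d j h)) / (Gamma (\<rho> h * sqrt \<tau>) / Gamma (\<rho> h * sqrt \<tau> + row_shape d j h)))
      * ((Gamma (\<tau> + (a + y) * sqrt \<tau>) / Gamma (2 * \<tau> + y * sqrt \<tau> + \<delta>)) / (Gamma (\<tau> + a * sqrt \<tau>) / Gamma (2 * \<tau> + \<delta>)))
      - (\<Prod>h=1..r. (\<rho> h / (\<rho> h + y)) powr row_shape d j h) * exp (a * y + y\<^sup>2 / 4)
      = jacobi_moment r \<rho> d a j \<tau> 0 y - (LBINT t. t ^ 0 * ?U t * exp (y * t))"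
    proof eventually_elim
      case (elim \<tau>)
      show ?case unfolding m0[OF elim] \<mu>0[OF yD] mellin_ratio_def laplace_limit_def \<delta>_def
        by (simp add: prod_dividef prod.distrib mult_ac)
    qed
    from landau_o.big.in_cong[OF this] gamma_ratio_conv[where d = "row_shape d j" and a = a and \<delta> = \<delta> and r = r and \<rho> = \<rho> and y = y] shape \<rho> y
    show "(\<lambda>\<tau>. jacobi_moment r \<rho> d a j \<tau> 0 y - (LBINT t. t ^ 0 * ?U t * exp (y * t))) \<in> O[at_top](\<lambda>\<tau>. \<tau> powr (-1/2))"
      by (simp add: \<delta>_def)
  qed (use \<epsilon> in auto)
qed

subsection \<open>Convergence of the mixed-type problems\<close>

lemma moment_U_hermite:
  fixes a :: real and r j :: nat
  assumes d: "\<And>h. h \<in> {1..r} \<Longrightarrow> d h > 0" and \<rho>: "\<And>h. h \<in> {1..r} \<Longrightarrow> \<rho> h > 0" and j: "j \<in> {1..Suc r}"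
  defines "D \<equiv> {z. \<forall>h\<in>{1..r}. \<rho> h + z > 0}" and "U \<equiv> U_hermite r \<rho> d a j"
  shows "open D" "U \<in> borel_measurable borel" "\<And>t. U t \<ge> 0"
    and "\<And>z. z \<in> D \<Longrightarrow> integrable lborel (\<lambda>t. U t * exp (z * t))"
    and "\<And>z. z \<in> D \<Longrightarrow> (LBINT t. U t * exp (z * t)) = laplace_limit r \<rho> (row_shape d j) a z"
    and "\<And>v z. z \<in> D \<Longrightarrow> integrable lborel (\<lambda>t. t ^ v * U t * exp (z * t))"
    and "\<And>v z. z \<in> D \<Longrightarrow> ((\<lambda>z. LBINT t. t ^ v * U t * exp (z * t)) has_field_derivative
           (LBINT t. t ^ Suc v * U t * exp (z * t))) (at z)"
proof -
  have "D = (\<Inter>h\<in>{1..r}. {z. \<rho> h + z > 0})" by (auto simp: D_def)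
  moreover have "open (\<Inter>h\<in>{1..r}. {z. \<rho> h + z > 0})"
    by (intro open_INT ballI open_Collect_less continuous_intros) auto
  ultimately show D: "open D" by simp
  have U: "line_weight U" unfolding U_def by (rule laplace_U_hermite(1)[OF d \<rho> j])
  then show m: "U \<in> borel_measurable borel" and "\<And>t. U t \<ge> 0" by (auto simp: line_weight_def)
  have L: "has_bochner_integral lborel (\<lambda>t. U t * exp (z * t)) (laplace_limit r \<rho> (row_shape d j) a z)" if "z \<in> D" for z
    unfolding U_def using that by (intro laplace_U_hermite(2)[OF d \<rho> j]) (auto simp: D_def)
  then show i: "integrable lborel (\<lambda>t. U t * exp (z * t))"
    and "(LBINT t. U t * exp (z * t)) = laplace_limit r \<rho> (row_shape d j) a z" if "z \<in> D" for z
    using that by (auto simp: has_bochner_integral_iff)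
  show "integrable lborel (\<lambda>t. t ^ v * U t * exp (z * t))" if "z \<in> D" for v z
    by (rule integrable_moments_exp[OF m D that i])
  show "((\<lambda>z. LBINT t. t ^ v * U t * exp (z * t)) has_field_derivative
           (LBINT t. t ^ Suc v * U t * exp (z * t))) (at z)" if "z \<in> D" for v z
    by (rule exp_moment_derivative[OF m D that i])
qed

definition hermite_moment ::
    "nat \<Rightarrow> (nat \<Rightarrow> real) \<Rightarrow> (nat \<Rightarrow> real) \<Rightarrow> real \<Rightarrow> (nat \<Rightarrow> real) \<Rightarrow> nat \<times> nat \<Rightarrow> nat \<times> nat \<Rightarrow> real" where
  "hermite_moment r \<rho> d a \<xi> c e =
     (LBINT t. t ^ (snd c + snd e) * U_hermite r \<rho> d a (fst c) t * exp (\<xi> (fst e) * t))"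

lemma hermite_square_trivial:
  fixes p r :: nat
  assumes d: "\<And>h. h \<in> {1..r} \<Longrightarrow> d h > 0" and \<rho>: "\<And>h. h \<in> {1..r} \<Longrightarrow> \<rho> h > 0"
    and \<xi>: "\<And>h i. h \<in> {1..r} \<Longrightarrow> i \<in> {1..p} \<Longrightarrow> \<rho> h + \<xi> i > 0"
    and adm: "laguerre_admissible (Suc r) lam" and inj: "inj_on \<xi> {1..p}" "inj_on \<rho> {h \<in> {1..r}. lam h > 0}"
    and card: "sum m {1..p} = sum lam {1..Suc r}"
    and eq: "\<And>e. e \<in> coeff_index p m \<Longrightarrow> (\<Sum>c\<in>coeff_index (Suc r) lam. hermite_moment r \<rho> d a \<xi> c e * b c) = 0"
  shows "\<forall>c\<in>coeff_index (Suc r) lam. b c = 0"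
proof (rule square_system_trivial[where D = "{z. \<forall>h\<in>{1..r}. \<rho> h + z > 0}" and H = "{h \<in> {1..r}. lam h > 0}"
      and \<rho> = \<rho> and d = d and a = a and r = r and p = p and m = m and \<xi> = \<xi> and G = "laplace_limit r \<rho> d a"
      and \<mu> = "\<lambda>j k z. LBINT t. t ^ k * U_hermite r \<rho> d a j t * exp (z * t)"])
  fix z assume z: "z \<in> {z. \<forall>h\<in>{1..r}. \<rho> h + z > 0}"
  show "laplace_limit r \<rho> d a z \<noteq> 0" using laplace_limit_pos[of r \<rho> z d a] \<rho> z by fastforce
  show "(laplace_limit r \<rho> d a has_field_derivative
     laplace_limit r \<rho> d a z * (a + z / 2 - (\<Sum>h=1..r. d h / (\<rho> h + z)))) (at z)"
    using z by (intro laplace_limit_derivative \<rho>) auto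
  show "((\<lambda>z. LBINT t. t ^ k * U_hermite r \<rho> d a j t * exp (z * t)) has_field_derivative
     (LBINT t. t ^ Suc k * U_hermite r \<rho> d a j t * exp (z * t))) (at z)" if "j \<in> {1..Suc r}" for j k
    by (rule moment_U_hermite(7)[where r = r and d = d and \<rho> = \<rho>, OF d \<rho> that z])
  have \<mu>0: "(LBINT t. t ^ 0 * U_hermite r \<rho> d a j t * exp (z * t)) =
      laplace_limit r \<rho> d a z * (if j \<le> r then \<rho> j / (\<rho> j + z) else 1)" if "j \<in> {1..Suc r}" for j
    using moment_U_hermite(5)[where r = r and d = d and \<rho> = \<rho>, OF d \<rho> that z] laplace_limit_row_shape[of j r \<rho> z d a] that \<rho> z by auto
  show "(LBINT t. t ^ 0 * U_hermite r \<rho> d a h t * exp (z * t)) = laplace_limit r \<rho> d a z * (\<rho> h / (\<rho> h + z))"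
    if "h \<in> {1..r}" for h using \<mu>0[of h] that by simp
  show "(LBINT t. t ^ 0 * U_hermite r \<rho> d a (Suc r) t * exp (z * t)) = laplace_limit r \<rho> d a z"
    using \<mu>0[of "Suc r"] by simp
next
  show "(\<Sum>c\<in>coeff_index (Suc r) lam. b c * (LBINT t. t ^ (snd c + l) * U_hermite r \<rho> d a (fst c) t * exp (\<xi> i * t))) = 0"
    if "i \<in> {1..p}" "l < m i" for i l
    using eq[of "(i, l)"] that by (simp add: coeff_index_def hermite_moment_def mult.commute)
  show "open {z. \<forall>h\<in>{1..r}. \<rho> h + z > 0}" by (rule moment_U_hermite(1)[where d = d and \<rho> = \<rho> and j = "Suc r" and r = r, OF d \<rho>]) auto
qed (use assms in auto)

section \<open>Weak normality of the Hermite problems in both balances\<close>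

lemma coeff_index_decrease:
  assumes "i \<in> {1..n}" "m i > 0"
  shows "coeff_index n m = insert (i, m i - 1) (coeff_index n (m(i := m i - 1)))"
    and "(i, m i - 1) \<notin> coeff_index n (m(i := m i - 1))"
    and "sum m {1..n} = sum (m(i := m i - 1)) {1..n} + 1"
proof -
  show "coeff_index n m = insert (i, m i - 1) (coeff_index n (m(i := m i - 1)))"
    using assms by (auto simp: coeff_index_def split: if_splits)
  show "(i, m i - 1) \<notin> coeff_index n (m(i := m i - 1))" by (auto simp: coeff_index_def)
  have "sum (m(i := m i - 1)) ({1..n} - {i}) = sum m ({1..n} - {i})" by (intro sum.cong) auto
  then show "sum m {1..n} = sum (m(i := m i - 1)) {1..n} + 1"
    using assms sum.remove[of "{1..n}" i m] sum.remove[of "{1..n}" i "m(i := m i - 1)"] by simp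
qed

text \<open>Removing the top coefficient of one component leaves a square system. Its unknowns sit
  on the column side whereas the zero count treats the row side, so the transpose is used. Any
  positive \<open>m i\<close> may be lowered because the count imposes no relation among the column
  indices.\<close>

lemma hermite_A_injective:
  fixes p r :: nat
  assumes d: "\<And>h. h \<in> {1..r} \<Longrightarrow> d h > 0" and \<rho>: "\<And>h. h \<in> {1..r} \<Longrightarrow> \<rho> h > 0"
    and \<xi>: "\<And>h i. h \<in> {1..r} \<Longrightarrow> i \<in> {1..p} \<Longrightarrow> \<rho> h + \<xi> i > 0"
    and adm: "laguerre_admissible (Suc r) lam" and inj: "inj_on \<xi> {1..p}" "inj_on \<rho> {h \<in> {1..r}. lam h > 0}"
    and card: "sum m {1..p} = sum lam {1..Suc r} + 1"
  shows "\<exists>c\<in>coeff_index p m. \<forall>x. (\<forall>e\<in>coeff_index (Suc r) lam. (\<Sum>f\<in>coeff_index p m. hermite_moment r \<rho> d a \<xi> e f * x f) = 0)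
      \<longrightarrow> x c = 0 \<longrightarrow> (\<forall>f\<in>coeff_index p m. x f = 0)"
proof -
  have "\<exists>i\<in>{1..p}. m i > 0"
  proof (rule ccontr)
    assume "\<not> ?thesis"
    then have "sum m {1..p} = 0" by auto
    then show False using card by simp
  qed
  then obtain i where i: "i \<in> {1..p}" "m i > 0" by auto
  define m' where "m' = m(i := m i - 1)"
  note dec = coeff_index_decrease[where m = m, OF i, folded m'_def]
  show ?thesis
  proof (intro bexI[of _ "(i, m i - 1)"] allI impI)
    fix x assume x: "\<forall>e\<in>coeff_index (Suc r) lam. (\<Sum>f\<in>coeff_index p m. hermite_moment r \<rho> d a \<xi> e f * x f) = 0"
      "x (i, m i - 1) = 0"
    have "\<forall>f\<in>coeff_index p m'. x f = 0"
    proof (rule transpose_trivial_kernel[where M = "\<lambda>f e. hermite_moment r \<rho> d a \<xi> e f" and C = "coeff_index (Suc r) lam"])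
      show "card (coeff_index p m') = card (coeff_index (Suc r) lam)"
        using dec(3) card by (simp add: card_coeff_index)
      show "\<forall>c\<in>coeff_index (Suc r) lam. X c = 0"
        if "\<And>f. f \<in> coeff_index p m' \<Longrightarrow> (\<Sum>c\<in>coeff_index (Suc r) lam. hermite_moment r \<rho> d a \<xi> c f * X c) = 0" for X
        using dec(3) card by (intro hermite_square_trivial[OF d \<rho> \<xi> adm inj _ that]) auto
      show "(\<Sum>f\<in>coeff_index p m'. hermite_moment r \<rho> d a \<xi> c f * x f) = 0" if "c \<in> coeff_index (Suc r) lam" for c
        using x(1)[rule_format, OF that] dec(2) x(2) unfolding dec(1) by simp
    qed auto
    then show "\<forall>f\<in>coeff_index p m. x f = 0" unfolding dec(1) using x(2) by simp
  qed (simp add: dec(1))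
qed

text \<open>The lowered row index must leave an admissible vector, so a largest one is chosen; rows
  with positive index can only become fewer, and distinctness of their rates is inherited.\<close>

lemma hermite_B_injective:
  fixes p r :: nat
  assumes d: "\<And>h. h \<in> {1..r} \<Longrightarrow> d h > 0" and \<rho>: "\<And>h. h \<in> {1..r} \<Longrightarrow> \<rho> h > 0"
    and \<xi>: "\<And>h i. h \<in> {1..r} \<Longrightarrow> i \<in> {1..p} \<Longrightarrow> \<rho> h + \<xi> i > 0"
    and adm: "laguerre_admissible (Suc r) lam" and inj: "inj_on \<xi> {1..p}" "inj_on \<rho> {h \<in> {1..r}. lam h > 0}"
    and card: "sum lam {1..Suc r} = sum m {1..p} + 1"
  shows "\<exists>c\<in>coeff_index (Suc r) lam. \<forall>x. (\<forall>e\<in>coeff_index p m. (\<Sum>f\<in>coeff_index (Suc r) lam. hermite_moment r \<rho> d a \<xi> f e * x f) = 0)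
      \<longrightarrow> x c = 0 \<longrightarrow> (\<forall>f\<in>coeff_index (Suc r) lam. x f = 0)"
proof -
  define M where "M = Max (lam ` {1..Suc r})"
  have M: "lam h \<le> M" if "h \<in> {1..Suc r}" for h using that unfolding M_def by (intro Max_ge) auto
  have "M \<in> lam ` {1..Suc r}" unfolding M_def by (intro Max_in) auto
  then obtain j where j: "j \<in> {1..Suc r}" "lam j = M" by auto
  have M0: "lam j > 0"
  proof (rule ccontr)
    assume "\<not> ?thesis"
    then have "sum lam {1..Suc r} = 0" using M j by (intro sum.neutral) force
    then show False using card by simp
  qed
  define lam' where "lam' = lam(j := lam j - 1)"
  note dec = coeff_index_decrease[where m = lam, OF j(1) M0, folded lam'_def]
  have adm': "laguerre_admissible (Suc r) lam'"
    unfolding laguerre_admissible_def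
  proof (intro ballI)
    fix h k assume hk: "h \<in> {1..Suc r}" "k \<in> {1..Suc r}"
    then have "lam h \<le> lam k + 1" "lam h \<le> lam j" "lam j \<le> lam k + 1"
      using adm M j by (auto simp: laguerre_admissible_def)
    then show "lam' h \<le> lam' k + 1" by (auto simp: lam'_def)
  qed
  have inj': "inj_on \<rho> {h \<in> {1..r}. lam' h > 0}"
    using inj(2) by (rule inj_on_subset) (auto simp: lam'_def split: if_splits)
  show ?thesis
  proof (intro bexI[of _ "(j, lam j - 1)"] allI impI)
    fix x assume x: "\<forall>e\<in>coeff_index p m. (\<Sum>f\<in>coeff_index (Suc r) lam. hermite_moment r \<rho> d a \<xi> f e * x f) = 0"
      "x (j, lam j - 1) = 0"
    have "\<forall>f\<in>coeff_index (Suc r) lam'. x f = 0"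
    proof (rule hermite_square_trivial[OF d \<rho> \<xi> adm' inj(1) inj'])
      show "sum m {1..p} = sum lam' {1..Suc r}" using dec(3) card by simp
      show "(\<Sum>f\<in>coeff_index (Suc r) lam'. hermite_moment r \<rho> d a \<xi> f e * x f) = 0" if "e \<in> coeff_index p m" for e
        using x(1)[rule_format, OF that] dec(2) x(2) unfolding dec(1) by simp
    qed
    then show "\<forall>f\<in>coeff_index (Suc r) lam. x f = 0" unfolding dec(1) using x(2) by simp
  qed (simp add: dec(1))
qed

text \<open>The density extended by zero is one function \<open>F\<close> on the line, so restricted
  moments become plain ones and the method of moments applies without reference to the moving
  interval.\<close>

lemma weak_conv_densities:
  fixes f :: "real \<Rightarrow> real \<Rightarrow> real"
  assumes f: "\<forall>\<^sub>F \<tau> in at_top. (\<forall>t. indicator (S \<tau>) t * f \<tau> t \<ge> 0) \<and> (\<forall>k. set_integrable lborel (S \<tau>) (\<lambda>t. t ^ k * f \<tau> t))"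
    and g: "\<And>t. g t \<ge> 0" "\<And>k. integrable lborel (\<lambda>t. t ^ k * g t)" "(LBINT t. g t) > 0"
    and \<delta>: "\<delta> > 0" "\<And>k. integrable lborel (\<lambda>t. t ^ k * (exp (\<delta> * \<bar>t\<bar>) * g t))"
    and mom: "\<And>k. ((\<lambda>\<tau>. LBINT t:S \<tau>. t ^ k * f \<tau> t) \<longlongrightarrow> (LBINT t. t ^ k * g t)) at_top"
  shows "weak_conv_measures (\<lambda>\<tau>. density_on (S \<tau>) (f \<tau>)) (density_on UNIV g)"
proof -
  define F where "F \<tau> t = indicator (S \<tau>) t * f \<tau> t" for \<tau> t
  have F: "\<forall>\<^sub>F \<tau> in at_top. (\<forall>t. F \<tau> t \<ge> 0) \<and> (\<forall>k. integrable lborel (\<lambda>t. t ^ k * F \<tau> t))"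
    using f by eventually_elim (simp add: F_def set_integrable_def mult.left_commute)
  have dens: "finite_measure (density lborel (\<lambda>t. ennreal (h t)))"
    "\<And>\<phi>. \<phi> \<in> borel_measurable borel \<Longrightarrow> integral\<^sup>L (density lborel (\<lambda>t. ennreal (h t))) \<phi> = (LBINT t. h t * \<phi> t)"
    if h: "\<And>t. h t \<ge> 0" "integrable lborel h" for h :: "real \<Rightarrow> real"
  proof -
    have "emeasure (density lborel (\<lambda>t. ennreal (h t))) UNIV = (\<integral>\<^sup>+ t. h t \<partial>lborel)"
      using h(2) by (subst emeasure_density) auto
    also have "\<dots> = ennreal (LBINT t. h t)" using h by (intro nn_integral_eq_integral) auto
    finally show "finite_measure (density lborel (\<lambda>t. ennreal (h t)))" by (intro finite_measureI) simp
    show "integral\<^sup>L (density lborel (\<lambda>t. ennreal (h t))) \<phi> = (LBINT t. h t * \<phi> t)" if "\<phi> \<in> borel_measurable borel" for \<phi>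
      using h that by (subst integral_density) auto
  qed
  have gi: "integrable lborel g" using g(2)[of 0] by simp
  have Dg: "density_on UNIV g = density lborel (\<lambda>t. ennreal (g t))" by (simp add: density_on_def)
  have Df: "density_on (S \<tau>) (f \<tau>) = density lborel (\<lambda>t. ennreal (F \<tau> t))" for \<tau> by (simp add: density_on_def F_def)
  have ev: "\<forall>\<^sub>F \<tau> in at_top. (\<forall>t. F \<tau> t \<ge> 0) \<and> integrable lborel (F \<tau>)"
    using F
  proof eventually_elim
    case (elim \<tau>)
    then have "integrable lborel (\<lambda>t. t ^ 0 * F \<tau> t)" by blast
    then show ?case using elim by simp
  qed
  show ?thesis
    unfolding weak_conv_measures_def Df Dg
  proof (intro conjI allI impI)
    show "\<forall>\<^sub>F \<tau> in at_top. finite_measure (density lborel (\<lambda>t. ennreal (F \<tau> t)))"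
      using ev by eventually_elim (auto intro: dens)
    show "finite_measure (density lborel (\<lambda>t. ennreal (g t)))" using g(1) gi by (rule dens)
    fix \<phi> :: "real \<Rightarrow> real" assume \<phi>: "continuous_on UNIV \<phi> \<and> bounded (range \<phi>)"
    then obtain B where B: "\<And>t. \<bar>\<phi> t\<bar> \<le> B" by (auto simp: bounded_iff)
    have m: "\<phi> \<in> borel_measurable borel" using \<phi> by (intro borel_measurable_continuous_onI) auto
    have "((\<lambda>\<tau>. LBINT t. F \<tau> t * \<phi> t) \<longlongrightarrow> (LBINT t. g t * \<phi> t)) at_top"
    proof (rule moments_imp_weak_conv_at_top[OF F g \<delta> _ _ B])
      show "((\<lambda>\<tau>. LBINT t. t ^ k * F \<tau> t) \<longlongrightarrow> (LBINT t. t ^ k * g t)) at_top" for k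
        using mom[of k] by (simp add: F_def set_lebesgue_integral_def mult.left_commute)
    qed (use \<phi> in auto)
    moreover have "\<forall>\<^sub>F \<tau> in at_top. (LBINT t. F \<tau> t * \<phi> t) = integral\<^sup>L (density lborel (\<lambda>t. ennreal (F \<tau> t))) \<phi>"
      using ev by eventually_elim (simp add: dens m)
    ultimately have "((\<lambda>\<tau>. integral\<^sup>L (density lborel (\<lambda>t. ennreal (F \<tau> t))) \<phi>) \<longlongrightarrow> (LBINT t. g t * \<phi> t)) at_top"
      using tendsto_cong by fastforce
    then show "((\<lambda>\<tau>. integral\<^sup>L (density lborel (\<lambda>t. ennreal (F \<tau> t))) \<phi>) \<longlongrightarrow> integral\<^sup>L (density lborel (\<lambda>t. ennreal (g t))) \<phi>) at_top"
      using dens(2)[OF g(1) gi m] by simp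
  qed
qed

theorem theorem5p23:
  fixes r q p :: nat
    and d \<rho> \<xi> :: "nat \<Rightarrow> real"
    and a_hat :: real
    and V C :: "real \<Rightarrow> nat \<Rightarrow> real \<Rightarrow> real"
    and U E :: "nat \<Rightarrow> real \<Rightarrow> real"
  assumes "q = r + 1" and "p \<ge> 1"
    and "\<And>h. h \<in> {1..r} \<Longrightarrow> d h > 0"
    and "\<And>h. h \<in> {1..r} \<Longrightarrow> \<rho> h > 0"
    and "\<And>h i. h \<in> {1..r} \<Longrightarrow> i \<in> {1..p} \<Longrightarrow> \<rho> h + \<xi> i > 0"
  defines "V \<equiv> V_jacobi r \<rho> d a_hat"
    and "C \<equiv> C_jacobi \<xi>"
    and "U \<equiv> U_hermite r \<rho> d a_hat"
    and "E \<equiv> V_hermite \<xi>"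
  shows
    "(\<forall>j\<in>{1..q}. \<forall>i\<in>{1..p}. \<forall>v::nat.
      (\<forall>\<^sub>F \<tau> in at_top. set_integrable lborel (I_jacobi \<tau>) (\<lambda>t. t ^ v * V \<tau> j t * C \<tau> i t)) \<and>
      integrable lborel (\<lambda>t. t ^ v * U j t * E i t) \<and>
      (\<lambda>\<tau>. (LBINT t:I_jacobi \<tau>. t ^ v * V \<tau> j t * C \<tau> i t) - (LBINT t. t ^ v * U j t * E i t))
        \<in> O[at_top](\<lambda>\<tau>. \<tau> powr (- 1 / 2))) \<and>
     (\<forall>j\<in>{1..q}. \<forall>i\<in>{1..p}.
      (\<forall>\<^sub>F \<tau> in at_top. \<forall>t\<in>I_jacobi \<tau>. 0 \<le> V \<tau> j t * C \<tau> i t) \<and>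
      (\<forall>t. 0 \<le> U j t * E i t) \<and>
      weak_conv_measures (\<lambda>\<tau>. density_on (I_jacobi \<tau>) (\<lambda>t. V \<tau> j t * C \<tau> i t))
        (density_on UNIV (\<lambda>t. U j t * E i t))) \<and>
     (\<forall>lam :: nat \<Rightarrow> nat.
      laguerre_admissible q lam \<and> inj_on \<xi> {1..p} \<and> inj_on \<rho> {h \<in> {1..r}. lam h > 0} \<longrightarrow>
      (\<forall>m :: nat \<Rightarrow> nat.
        (sum m {1..p} = sum lam {1..q} + 1 \<longrightarrow>
          (\<forall>\<^sub>F \<tau> in at_top. weakly_normal (A_solutions (I_jacobi \<tau>) q p (V \<tau>) (C \<tau>) lam m)) \<and>
          weakly_normal (A_solutions UNIV q p U E lam m) \<and>
          normalized_solutions_conv p (\<lambda>\<tau>. A_solutions (I_jacobi \<tau>) q p (V \<tau>) (C \<tau>) lam m)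
            (A_solutions UNIV q p U E lam m)) \<and>
        (sum lam {1..q} = sum m {1..p} + 1 \<longrightarrow>
          (\<forall>\<^sub>F \<tau> in at_top. weakly_normal (B_solutions (I_jacobi \<tau>) q p (V \<tau>) (C \<tau>) lam m)) \<and>
          weakly_normal (B_solutions UNIV q p U E lam m) \<and>
          normalized_solutions_conv q (\<lambda>\<tau>. B_solutions (I_jacobi \<tau>) q p (V \<tau>) (C \<tau>) lam m)
            (B_solutions UNIV q p U E lam m))))"
proof -
  note d = assms(3) and \<rho> = assms(4) and \<rho>\<xi> = assms(5)
  have q: "q = Suc r" using assms(1) by simp
  let ?D = "{z. \<forall>h\<in>{1..r}. \<rho> h + z > 0}"
  have \<xi>D: "\<xi> i \<in> ?D" if "i \<in> {1..p}" for i using \<rho>\<xi> that by auto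
  have j': "j \<in> {1..Suc r}" if "j \<in> {1..q}" for j using that q by simp
  have \<epsilon>: "((\<lambda>\<tau>::real. \<tau> powr (- 1 / 2)) \<longlongrightarrow> 0) at_top" by real_asymp
  have ok: "\<forall>\<^sub>F \<tau> in at_top. \<forall>i\<in>{1..p}. jacobi_ok r \<rho> a_hat \<tau> (\<xi> i)"
    using \<rho>\<xi> by (intro eventually_ball_finite ballI eventually_jacobi_ok) auto
  have int: "set_integrable lborel (I_jacobi \<tau>) (\<lambda>t. t ^ v * V \<tau> j t * C \<tau> i t)"
    if "\<forall>i\<in>{1..p}. jacobi_ok r \<rho> a_hat \<tau> (\<xi> i)" "i \<in> {1..p}" for \<tau> i j v
    unfolding V_def C_def C_jacobi_def using that by (intro jacobi_moment_integrable(1) d \<rho>) auto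
  have nonneg: "0 \<le> V \<tau> j t * C \<tau> i t"
    if "\<forall>i\<in>{1..p}. jacobi_ok r \<rho> a_hat \<tau> (\<xi> i)" "i \<in> {1..p}" for \<tau> i j t
    unfolding V_def C_def C_jacobi_def
    using that jacobi_moment_0(3)[where r = r and d = d and \<rho> = \<rho> and a = a_hat and \<tau> = \<tau> and y = "\<xi> i", OF d \<rho>] by (intro mult_nonneg_nonneg) auto
  have intH: "integrable lborel (\<lambda>t. t ^ v * U j t * E i t)" if "j \<in> {1..q}" "i \<in> {1..p}" for j i v
    unfolding U_def E_def V_hermite_def by (rule moment_U_hermite(6)[where r = r and d = d and \<rho> = \<rho>, OF d \<rho> j'[OF that(1)] \<xi>D[OF that(2)]])
  have conv: "(\<lambda>\<tau>. (LBINT t:I_jacobi \<tau>. t ^ v * V \<tau> j t * C \<tau> i t) - (LBINT t. t ^ v * U j t * E i t))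
        \<in> O[at_top](\<lambda>\<tau>. \<tau> powr (- 1 / 2))" if "j \<in> {1..q}" "i \<in> {1..p}" for j i v
    using jacobi_moment_conv[where r = r and d = d and \<rho> = \<rho>, OF d \<rho> j'[OF that(1)] \<rho>\<xi>[OF _ that(2)], of a_hat v]
    unfolding V_def C_def C_jacobi_def U_def E_def V_hermite_def jacobi_moment_def by simp
  have part1: "\<forall>j\<in>{1..q}. \<forall>i\<in>{1..p}. \<forall>v::nat.
      (\<forall>\<^sub>F \<tau> in at_top. set_integrable lborel (I_jacobi \<tau>) (\<lambda>t. t ^ v * V \<tau> j t * C \<tau> i t)) \<and>
      integrable lborel (\<lambda>t. t ^ v * U j t * E i t) \<and>
      (\<lambda>\<tau>. (LBINT t:I_jacobi \<tau>. t ^ v * V \<tau> j t * C \<tau> i t) - (LBINT t. t ^ v * U j t * E i t))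
        \<in> O[at_top](\<lambda>\<tau>. \<tau> powr (- 1 / 2))"
  proof (intro ballI allI conjI intH conv)
    fix j i v assume ij: "j \<in> {1..q}" "i \<in> {1..p}"
    show "\<forall>\<^sub>F \<tau> in at_top. set_integrable lborel (I_jacobi \<tau>) (\<lambda>t. t ^ v * V \<tau> j t * C \<tau> i t)"
      using ok by eventually_elim (rule int[OF _ ij(2)])
  qed
  have U0: "U j t \<ge> 0" if "j \<in> {1..q}" for j t
    unfolding U_def by (rule moment_U_hermite(3)[where r = r and d = d and \<rho> = \<rho>, OF d \<rho> j'[OF that]])
  have part2: "\<forall>j\<in>{1..q}. \<forall>i\<in>{1..p}.
      (\<forall>\<^sub>F \<tau> in at_top. \<forall>t\<in>I_jacobi \<tau>. 0 \<le> V \<tau> j t * C \<tau> i t) \<and>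
      (\<forall>t. 0 \<le> U j t * E i t) \<and>
      weak_conv_measures (\<lambda>\<tau>. density_on (I_jacobi \<tau>) (\<lambda>t. V \<tau> j t * C \<tau> i t))
        (density_on UNIV (\<lambda>t. U j t * E i t))"
  proof (intro ballI conjI allI)
    fix j i assume ij: "j \<in> {1..q}" "i \<in> {1..p}"
    show "\<forall>\<^sub>F \<tau> in at_top. \<forall>t\<in>I_jacobi \<tau>. 0 \<le> V \<tau> j t * C \<tau> i t"
      using ok by eventually_elim (rule ballI, rule nonneg, assumption, rule ij(2))
    show g0: "0 \<le> U j t * E i t" for t using U0[OF ij(1)] by (simp add: E_def V_hermite_def)
    have "open ?D" by (rule moment_U_hermite(1)[where r = r and d = d and \<rho> = \<rho>, OF d \<rho> j'[OF ij(1)]])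
    \<comment> \<open>The room \<delta> around \<open>\<xi> i\<close> inside the domain serves as
      the exponential decay rate of the limit density.\<close>
    then obtain \<delta> where \<delta>: "\<delta> > 0" "cball (\<xi> i) \<delta> \<subseteq> ?D" using \<xi>D[OF ij(2)] open_contains_cball by blast
    show "weak_conv_measures (\<lambda>\<tau>. density_on (I_jacobi \<tau>) (\<lambda>t. V \<tau> j t * C \<tau> i t))
        (density_on UNIV (\<lambda>t. U j t * E i t))"
    proof (rule weak_conv_densities[where \<delta> = \<delta>])
      show "\<forall>\<^sub>F \<tau> in at_top. (\<forall>t. 0 \<le> indicator (I_jacobi \<tau>) t * (V \<tau> j t * C \<tau> i t)) \<and>
          (\<forall>k. set_integrable lborel (I_jacobi \<tau>) (\<lambda>t. t ^ k * (V \<tau> j t * C \<tau> i t)))"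
        using ok
      proof eventually_elim
        case (elim \<tau>)
        then show ?case using nonneg[OF elim ij(2)] int[OF elim ij(2), of _ j] by (simp add: mult.assoc)
      qed
      show "integrable lborel (\<lambda>t. t ^ k * (U j t * E i t))" for k using intH[OF ij, of k] by (simp add: mult.assoc)
      have "(LBINT t. U j t * E i t) = laplace_limit r \<rho> (row_shape d j) a_hat (\<xi> i)"
        unfolding U_def E_def V_hermite_def by (rule moment_U_hermite(5)[where r = r and d = d and \<rho> = \<rho>, OF d \<rho> j'[OF ij(1)] \<xi>D[OF ij(2)]])
      then show "(LBINT t. U j t * E i t) > 0" using laplace_limit_pos \<rho> \<rho>\<xi>[OF _ ij(2)] by auto
      show "integrable lborel (\<lambda>t. t ^ k * (exp (\<delta> * \<bar>t\<bar>) * (U j t * E i t)))" for k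
      proof (rule Bochner_Integration.integrable_bound)
        have "\<xi> i + \<delta> \<in> ?D" "\<xi> i - \<delta> \<in> ?D" using \<delta> by (auto simp: dist_real_def subset_iff)
        then show "integrable lborel (\<lambda>t. \<bar>t ^ k * U j t * exp ((\<xi> i + \<delta>) * t)\<bar> + \<bar>t ^ k * U j t * exp ((\<xi> i - \<delta>) * t)\<bar>)"
          unfolding U_def by (intro Bochner_Integration.integrable_add integrable_abs moment_U_hermite(6)[where r = r and d = d and \<rho> = \<rho>, OF d \<rho> j'[OF ij(1)]])
        have [measurable]: "U j \<in> borel_measurable borel" unfolding U_def by (rule moment_U_hermite(2)[where r = r and d = d and \<rho> = \<rho>, OF d \<rho> j'[OF ij(1)]])
        show "(\<lambda>t. t ^ k * (exp (\<delta> * \<bar>t\<bar>) * (U j t * E i t))) \<in> borel_measurable lborel"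
          unfolding E_def V_hermite_def by measurable
        show "AE t in lborel. norm (t ^ k * (exp (\<delta> * \<bar>t\<bar>) * (U j t * E i t))) \<le>
            norm (\<bar>t ^ k * U j t * exp ((\<xi> i + \<delta>) * t)\<bar> + \<bar>t ^ k * U j t * exp ((\<xi> i - \<delta>) * t)\<bar>)"
        proof (intro AE_I2)
          fix t :: real
          have "exp (\<delta> * \<bar>t\<bar>) * exp (\<xi> i * t) \<le> exp ((\<xi> i + \<delta>) * t) + exp ((\<xi> i - \<delta>) * t)"
            by (cases "t \<ge> 0") (auto simp: exp_add[symmetric] algebra_simps)
          then have "\<bar>t ^ k * U j t\<bar> * (exp (\<delta> * \<bar>t\<bar>) * exp (\<xi> i * t)) \<le>
              \<bar>t ^ k * U j t\<bar> * (exp ((\<xi> i + \<delta>) * t) + exp ((\<xi> i - \<delta>) * t))" by (intro mult_left_mono) auto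
          then show "norm (t ^ k * (exp (\<delta> * \<bar>t\<bar>) * (U j t * E i t))) \<le>
            norm (\<bar>t ^ k * U j t * exp ((\<xi> i + \<delta>) * t)\<bar> + \<bar>t ^ k * U j t * exp ((\<xi> i - \<delta>) * t)\<bar>)"
            by (simp add: abs_mult E_def V_hermite_def distrib_left mult_ac)
        qed
      qed
      show "((\<lambda>\<tau>. LBINT t:I_jacobi \<tau>. t ^ k * (V \<tau> j t * C \<tau> i t)) \<longlongrightarrow> (LBINT t. t ^ k * (U j t * E i t))) at_top" for k
        using bigo_tendsto_0[OF conv[OF ij, of k] \<epsilon>] by (simp add: LIM_zero_iff mult.assoc)
    qed (use g0 \<delta> in auto)
  qed
  have intH': "set_integrable lborel UNIV (\<lambda>t. t ^ v * U j t * E i t)" if "j \<in> {1..q}" "i \<in> {1..p}" for j i v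
    using intH[OF that] by (simp add: set_integrable_def)
  have M0: "(LBINT t:UNIV. t ^ (snd c + snd e) * U (fst c) t * E (fst e) t) = hermite_moment r \<rho> d a_hat \<xi> c e" for c e
    by (simp add: set_lebesgue_integral_def hermite_moment_def U_def E_def V_hermite_def)
  \<comment> \<open>A single array of finite moments, with row index before column index; the
    B-problem below uses it with the arguments exchanged.\<close>
  define M where "M \<tau> c e = (LBINT t:I_jacobi \<tau>. t ^ (snd c + snd e) * V \<tau> (fst c) t * C \<tau> (fst e) t)" for \<tau> c e
  have Mconv: "(\<lambda>\<tau>. M \<tau> c e - hermite_moment r \<rho> d a_hat \<xi> c e) \<in> O[at_top](\<lambda>\<tau>. \<tau> powr (- 1 / 2))"
    if "c \<in> coeff_index q lam" "e \<in> coeff_index p m" for c e lam m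
  proof -
    have "fst c \<in> {1..q}" "fst e \<in> {1..p}" using that by (auto simp: coeff_index_def)
    from conv[OF this, of "snd c + snd e"] show ?thesis
      by (simp add: M_def hermite_moment_def U_def E_def V_hermite_def)
  qed
  have part3: "(sum m {1..p} = sum lam {1..q} + 1 \<longrightarrow>
          (\<forall>\<^sub>F \<tau> in at_top. weakly_normal (A_solutions (I_jacobi \<tau>) q p (V \<tau>) (C \<tau>) lam m)) \<and>
          weakly_normal (A_solutions UNIV q p U E lam m) \<and>
          normalized_solutions_conv p (\<lambda>\<tau>. A_solutions (I_jacobi \<tau>) q p (V \<tau>) (C \<tau>) lam m)
            (A_solutions UNIV q p U E lam m)) \<and>
        (sum lam {1..q} = sum m {1..p} + 1 \<longrightarrow>
          (\<forall>\<^sub>F \<tau> in at_top. weakly_normal (B_solutions (I_jacobi \<tau>) q p (V \<tau>) (C \<tau>) lam m)) \<and>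
          weakly_normal (B_solutions UNIV q p U E lam m) \<and>
          normalized_solutions_conv q (\<lambda>\<tau>. B_solutions (I_jacobi \<tau>) q p (V \<tau>) (C \<tau>) lam m)
            (B_solutions UNIV q p U E lam m))"
    if lam: "laguerre_admissible q lam" "inj_on \<xi> {1..p}" "inj_on \<rho> {h \<in> {1..r}. lam h > 0}" for lam m :: "nat \<Rightarrow> nat"
  proof (intro conjI[of "_ \<longrightarrow> _"] impI)
    assume card: "sum m {1..p} = sum lam {1..q} + 1"
    from hermite_A_injective[where r = r and d = d and \<rho> = \<rho> and \<xi> = \<xi>, OF d \<rho> \<rho>\<xi> lam[unfolded q] card[unfolded q], of a_hat]
    obtain c where c: "c \<in> coeff_index p m"
      "\<And>x. (\<And>e. e \<in> coeff_index q lam \<Longrightarrow> (\<Sum>f\<in>coeff_index p m. hermite_moment r \<rho> d a_hat \<xi> e f * x f) = 0)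
        \<Longrightarrow> x c = 0 \<Longrightarrow> \<forall>f\<in>coeff_index p m. x f = 0" unfolding q by blast
    show "(\<forall>\<^sub>F \<tau> in at_top. weakly_normal (A_solutions (I_jacobi \<tau>) q p (V \<tau>) (C \<tau>) lam m)) \<and>
          weakly_normal (A_solutions UNIV q p U E lam m) \<and>
          normalized_solutions_conv p (\<lambda>\<tau>. A_solutions (I_jacobi \<tau>) q p (V \<tau>) (C \<tau>) lam m)
            (A_solutions UNIV q p U E lam m)"
    proof (rule normalized_kernel_conv[where R = "coeff_index q lam" and M = M and ?M0.0 = "hermite_moment r \<rho> d a_hat \<xi>",
          OF finite_coeff_index _ c])
      show "sum m {1..p} = card (coeff_index q lam) + 1" using card by (simp add: card_coeff_index)
      show "\<forall>\<^sub>F \<tau> in at_top. A_solutions (I_jacobi \<tau>) q p (V \<tau>) (C \<tau>) lam m = kernel_vectors p m (coeff_index q lam) (M \<tau>)"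
        using ok
      proof eventually_elim
        case (elim \<tau>)
        show ?case unfolding M_def[abs_def] by (rule A_solutions_eq_kernel) (rule int[OF elim])
      qed
      show "A_solutions UNIV q p U E lam m = kernel_vectors p m (coeff_index q lam) (hermite_moment r \<rho> d a_hat \<xi>)"
        using A_solutions_eq_kernel[of q p UNIV U E lam m, OF intH'] unfolding M0 by simp
    qed (use Mconv in auto)
  next
    assume card: "sum lam {1..q} = sum m {1..p} + 1"
    from hermite_B_injective[where r = r and d = d and \<rho> = \<rho> and \<xi> = \<xi>, OF d \<rho> \<rho>\<xi> lam[unfolded q] card[unfolded q], of a_hat]
    obtain c where c: "c \<in> coeff_index q lam"
      "\<And>x. (\<And>e. e \<in> coeff_index p m \<Longrightarrow> (\<Sum>f\<in>coeff_index q lam. hermite_moment r \<rho> d a_hat \<xi> f e * x f) = 0)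
        \<Longrightarrow> x c = 0 \<Longrightarrow> \<forall>f\<in>coeff_index q lam. x f = 0" unfolding q by blast
    show "(\<forall>\<^sub>F \<tau> in at_top. weakly_normal (B_solutions (I_jacobi \<tau>) q p (V \<tau>) (C \<tau>) lam m)) \<and>
          weakly_normal (B_solutions UNIV q p U E lam m) \<and>
          normalized_solutions_conv q (\<lambda>\<tau>. B_solutions (I_jacobi \<tau>) q p (V \<tau>) (C \<tau>) lam m)
            (B_solutions UNIV q p U E lam m)"
    proof (rule normalized_kernel_conv[where R = "coeff_index p m" and M = "\<lambda>\<tau> e c. M \<tau> c e"
          and ?M0.0 = "\<lambda>e c. hermite_moment r \<rho> d a_hat \<xi> c e", OF finite_coeff_index _ c])
      show "sum lam {1..q} = card (coeff_index p m) + 1" using card by (simp add: card_coeff_index)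
      show "\<forall>\<^sub>F \<tau> in at_top. B_solutions (I_jacobi \<tau>) q p (V \<tau>) (C \<tau>) lam m = kernel_vectors q lam (coeff_index p m) (\<lambda>e c. M \<tau> c e)"
        using ok
      proof eventually_elim
        case (elim \<tau>)
        show ?case unfolding M_def
          using B_solutions_eq_kernel[of q p "I_jacobi \<tau>" "V \<tau>" "C \<tau>" lam m, OF int[OF elim]] by (simp add: add.commute)
      qed
      show "B_solutions UNIV q p U E lam m = kernel_vectors q lam (coeff_index p m) (\<lambda>e c. hermite_moment r \<rho> d a_hat \<xi> c e)"
        using B_solutions_eq_kernel[of q p UNIV U E lam m, OF intH'] unfolding M0[symmetric] by (simp add: add.commute)
    qed (use Mconv in auto)
  qed
  show ?thesis using part1 part2 part3 by blast
qed

end
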